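(* If $a$ is a ($C^\infty$-)smooth $\mathbb C$-convex boundary point of a domain $D\subset\mathbb C^n$, then $\mathcal L(a)=\mathcal M(a)=\Delta(a)$, where $\mathcal L(a)$ is the linear multitype, $\mathcal M(a)$ the Catlin multitype and $\Delta(a)$ the D'Angelo (multi)type of $a$.
   Context: A domain is $\mathbb C$-convex if every non-empty intersection of it with a complex (affine) line is a simply connected domain (in particular connected). A point $a\in\partial D$ is a $\mathbb C$-convex boundary point of $D$ if there is a neighborhood $U$ of $a$ such that $D\cap U$ is a $\mathbb C$-convex domain. Smooth means that there is a $C^\infty$ function $r$ near $a$ with $dr(a)\neq0$ and $D=\{r<0\}$ near $a$. The point is not assumed to be of finite type. Catlin multitype. Let $\Gamma_n$ be the set of $n$-tuples $\Lambda=(\lambda_1,\dots,\lambda_n)$ with $1\le\lambda_1\le\dots\le\lambda_n\le\infty$ such that for each $k$ either $\lambda_k=\infty$ or there are non-negative integers $a_1,\dots,a_k$ with $a_k>0$ and $\sum_{j=1}^k a_j/\lambda_j=1$; order $\Gamma_n$ lexicographically. $\Lambda\in\Gamma_n$ is called distinguished (at $a$) if there are local holomorphic coordinates $z_1,\dots,z_n$ centered at $a$ in which $D^\alpha\overline D^\beta r(0)=0$ for all multi-indices $\alpha,\beta$ with $\sum_{j=1}^n(\alpha_j+\beta_j)/\lambda_j<1$ (where $D^\alpha\overline D^\beta=\partial^{|\alpha|+|\beta|}/\partial z^\alpha\partial\bar z^\beta$ and $1/\infty=0$). $\mathcal M(a)$ is the smallest element of $\Gamma_n$ that is $\ge\Lambda$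 lexicographically for every distinguished $\Lambda$. Linear multitype. $\mathcal L(a)$ is defined exactly as $\mathcal M(a)$, except that only coordinates obtained from the standard ones by complex affine changes of coordinates (centered at $a$) are allowed in the definition of distinguished weights. D'Angelo (multi)type. $\Delta(a)=(\Delta_n(a),\dots,\Delta_1(a))$, where for $1\le q\le n$ the $q$-type is $\Delta_q(a)=\inf_S\sup_\varphi \operatorname{ord}_0(r\circ\varphi)/\operatorname{ord}_0(\varphi-a)$; here $S$ runs over all $(n-q+1)$-dimensional complex affine subspaces of $\mathbb C^n$ through $a$, $\varphi$ runs over all non-constant holomorphic maps from a neighborhood of $0\in\mathbb C$ into $S$ with $\varphi(0)=a$, and $\operatorname{ord}_0$ denotes order of vanishing at $0$. *)

theory Defs
  imports "HOL-Analysis.Analysis" "HOL-Library.Fun_Lexorder"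
begin

text \<open>
  Complex \<open>n\<close>-space is \<^typ>\<open>complex ^ 'n\<close> for a finite linearly ordered index type \<open>'n\<close>,
  with \<open>n = CARD('n)\<close>.  The order on \<open>'n\<close> gives meaning to \<open>n\<close>-tuples being
  non-decreasing and being compared lexicographically; the index \<open>k :: 'n\<close> plays the role of
  the number \<open>card {..k}\<close> in \<open>1, \<dots>, n\<close>.  Tuples of weights are functions \<open>'n \<Rightarrow> ereal\<close>.
\<close>

subsection \<open>Smooth functions\<close>

primrec Ck_on :: "nat \<Rightarrow> ('a::real_normed_vector \<Rightarrow> 'b::real_normed_vector) \<Rightarrow> 'a set \<Rightarrow> bool" where
  "Ck_on 0 f S \<longleftrightarrow> continuous_on S f"
| "Ck_on (Suc k) f S \<longleftrightarrow>
     (\<forall>x\<in>S. f differentiable (at x)) \<and> (\<forall>v. Ck_on k (\<lambda>x. frechet_derivative f (at x) v) S)"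

definition C_infinity_on :: "('a::real_normed_vector \<Rightarrow> 'b::real_normed_vector) \<Rightarrow> 'a set \<Rightarrow> bool" where
  "C_infinity_on f S \<longleftrightarrow> (\<forall>k. Ck_on k f S)"

definition smooth_defining_function ::
    "(complex ^ 'n) set \<Rightarrow> complex ^ 'n \<Rightarrow> (complex ^ 'n \<Rightarrow> real) \<Rightarrow> bool" where
  "smooth_defining_function D a r \<longleftrightarrow>
     (\<exists>V. open V \<and> a \<in> V \<and> C_infinity_on r V \<and> D \<inter> V = {x \<in> V. r x < 0}) \<and>
     frechet_derivative r (at a) \<noteq> (\<lambda>v. 0)"

subsection \<open>\<open>\<complex>\<close>-convexity\<close>

definition complex_line :: "complex ^ 'n \<Rightarrow> complex ^ 'n \<Rightarrow> (complex ^ 'n) set" where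
  "complex_line p v = range (\<lambda>c. p + c *s v)"

text \<open>The sections of an open set by a complex line are automatically open in that line, and
  \<^const>\<open>simply_connected\<close> includes path-connectedness.\<close>

definition C_convex_domain :: "(complex ^ 'n) set \<Rightarrow> bool" where
  "C_convex_domain D \<longleftrightarrow> open D \<and> connected D \<and> D \<noteq> {} \<and>
     (\<forall>p v. v \<noteq> 0 \<longrightarrow> D \<inter> complex_line p v \<noteq> {} \<longrightarrow> simply_connected (D \<inter> complex_line p v))"

definition C_convex_boundary_point :: "(complex ^ 'n) set \<Rightarrow> complex ^ 'n \<Rightarrow> bool" where
  "C_convex_boundary_point D a \<longleftrightarrow>
     a \<in> frontier D \<and> (\<exists>U. open U \<and> a \<in> U \<and> C_convex_domain (D \<inter> U))"

subsection \<open>Wirtinger derivatives\<close>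

definition wirtinger :: "'n::finite \<Rightarrow> (complex ^ 'n \<Rightarrow> complex) \<Rightarrow> complex ^ 'n \<Rightarrow> complex" where
  "wirtinger j f = (\<lambda>x. (frechet_derivative f (at x) (axis j 1)
                         - \<i> * frechet_derivative f (at x) (axis j \<i>)) / 2)"

definition wirtinger_bar :: "'n::finite \<Rightarrow> (complex ^ 'n \<Rightarrow> complex) \<Rightarrow> complex ^ 'n \<Rightarrow> complex" where
  "wirtinger_bar j f = (\<lambda>x. (frechet_derivative f (at x) (axis j 1)
                             + \<i> * frechet_derivative f (at x) (axis j \<i>)) / 2)"

text \<open>A multi-index is a function \<open>'n \<Rightarrow> nat\<close>; for smooth functions the order of
  differentiation chosen here is irrelevant.\<close>

definition wirtinger_multi ::
    "('n \<Rightarrow> nat) \<Rightarrow> (complex ^ 'n::{finite,linorder} \<Rightarrow> complex) \<Rightarrow> complex ^ 'n::{finite,linorder} \<Rightarrow> complex" where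
  "wirtinger_multi \<alpha> f = foldr (\<lambda>j. wirtinger j ^^ \<alpha> j) (sorted_list_of_set UNIV) f"

definition wirtinger_bar_multi ::
    "('n \<Rightarrow> nat) \<Rightarrow> (complex ^ 'n::{finite,linorder} \<Rightarrow> complex) \<Rightarrow> complex ^ 'n::{finite,linorder} \<Rightarrow> complex" where
  "wirtinger_bar_multi \<beta> f = foldr (\<lambda>j. wirtinger_bar j ^^ \<beta> j) (sorted_list_of_set UNIV) f"

subsection \<open>Local holomorphic and affine coordinates\<close>

text \<open>Holomorphic maps: the real derivative exists and is complex linear.\<close>

definition holomorphic_map_on :: "(complex ^ 'n \<Rightarrow> complex ^ 'm) \<Rightarrow> (complex ^ 'n) set \<Rightarrow> bool" where
  "holomorphic_map_on F S \<longleftrightarrow>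
     (\<forall>x\<in>S. \<exists>A :: complex ^ 'n ^ 'm. (F has_derivative (\<lambda>v. A *v v)) (at x))"

text \<open>\<open>z\<close> is a system of local holomorphic coordinates centered at \<open>a\<close>, and \<open>\<psi>\<close> is its local
  inverse, so that a function \<open>f\<close> reads \<open>f \<circ> \<psi>\<close> in these coordinates.\<close>

definition local_holomorphic_coordinates ::
    "complex ^ 'n \<Rightarrow> (complex ^ 'n \<Rightarrow> complex ^ 'n) \<Rightarrow> (complex ^ 'n \<Rightarrow> complex ^ 'n) \<Rightarrow> bool" where
  "local_holomorphic_coordinates a z \<psi> \<longleftrightarrow>
     (\<exists>U W. open U \<and> a \<in> U \<and> open W \<and> homeomorphism U W z \<psi> \<and>
        holomorphic_map_on z U \<and> holomorphic_map_on \<psi> W) \<and> z a = 0"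

definition affine_coordinates ::
    "complex ^ 'n \<Rightarrow> (complex ^ 'n \<Rightarrow> complex ^ 'n) \<Rightarrow> (complex ^ 'n \<Rightarrow> complex ^ 'n) \<Rightarrow> bool" where
  "affine_coordinates a z \<psi> \<longleftrightarrow>
     (\<exists>B :: complex ^ 'n ^ 'n. invertible B \<and>
        z = (\<lambda>x. B *v (x - a)) \<and> \<psi> = (\<lambda>w. a + matrix_inv B *v w))"

subsection \<open>Catlin multitype and linear multitype\<close>

text \<open>Division in \<^typ>\<open>ereal\<close> satisfies \<open>x / \<infinity> = 0\<close>.\<close>

definition weights :: "('n::{finite,linorder} \<Rightarrow> ereal) set" where
  "weights = {\<Lambda>. (\<forall>k. 1 \<le> \<Lambda> k) \<and> mono \<Lambda> \<and>
     (\<forall>k. \<Lambda> k = \<infinity> \<or>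
        (\<exists>m :: 'n \<Rightarrow> nat. m k > 0 \<and> (\<Sum>j\<in>{..k}. ereal (real (m j)) / \<Lambda> j) = 1))}"

definition lex_le :: "('n::linorder \<Rightarrow> ereal) \<Rightarrow> ('n \<Rightarrow> ereal) \<Rightarrow> bool" where
  "lex_le \<Lambda> M \<longleftrightarrow> less_fun \<Lambda> M \<or> \<Lambda> = M"

definition vanishes_to_weight ::
    "(complex ^ 'n::{finite,linorder} \<Rightarrow> real) \<Rightarrow> ('n \<Rightarrow> ereal) \<Rightarrow> bool" where
  "vanishes_to_weight \<rho> \<Lambda> \<longleftrightarrow>
     (\<forall>\<alpha> \<beta> :: 'n \<Rightarrow> nat. (\<Sum>j\<in>UNIV. ereal (real (\<alpha> j + \<beta> j)) / \<Lambda> j) < 1 \<longrightarrow>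
        wirtinger_multi \<alpha> (wirtinger_bar_multi \<beta> (\<lambda>w. complex_of_real (\<rho> w))) 0 = 0)"

definition distinguished ::
    "(complex ^ 'n::{finite,linorder} \<Rightarrow> real) \<Rightarrow> complex ^ 'n::{finite,linorder} \<Rightarrow> ('n \<Rightarrow> ereal) set" where
  "distinguished r a =
     {\<Lambda> \<in> weights. \<exists>z \<psi>. local_holomorphic_coordinates a z \<psi> \<and> vanishes_to_weight (r \<circ> \<psi>) \<Lambda>}"

definition linearly_distinguished ::
    "(complex ^ 'n::{finite,linorder} \<Rightarrow> real) \<Rightarrow> complex ^ 'n::{finite,linorder} \<Rightarrow> ('n \<Rightarrow> ereal) set" where
  "linearly_distinguished r a =
     {\<Lambda> \<in> weights. \<exists>z \<psi>. affine_coordinates a z \<psi> \<and> vanishes_to_weight (r \<circ> \<psi>) \<Lambda>}"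

definition least_upper_weight :: "('n::{finite,linorder} \<Rightarrow> ereal) set \<Rightarrow> ('n \<Rightarrow> ereal) \<Rightarrow> bool" where
  "least_upper_weight X M \<longleftrightarrow>
     M \<in> weights \<and> (\<forall>\<Lambda>\<in>X. lex_le \<Lambda> M) \<and>
     (\<forall>M'\<in>weights. (\<forall>\<Lambda>\<in>X. lex_le \<Lambda> M') \<longrightarrow> lex_le M M')"

text \<open>The least upper weight is unique, and it always exists: the constant weight \<open>\<infinity>\<close> is an
  upper bound, and \<^const>\<open>weights\<close> is lexicographically well-ordered because, given the entries
  before position \<open>k\<close>, only finitely many values of the entry at \<open>k\<close> lie below a given finite
  bound.\<close>

definition catlin_multitype ::
    "(complex ^ 'n::{finite,linorder} \<Rightarrow> real) \<Rightarrow> complex ^ 'n::{finite,linorder} \<Rightarrow> 'n \<Rightarrow> ereal" where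
  "catlin_multitype r a = (THE M. least_upper_weight (distinguished r a) M)"

definition linear_multitype ::
    "(complex ^ 'n::{finite,linorder} \<Rightarrow> real) \<Rightarrow> complex ^ 'n::{finite,linorder} \<Rightarrow> 'n \<Rightarrow> ereal" where
  "linear_multitype r a = (THE M. least_upper_weight (linearly_distinguished r a) M)"

subsection \<open>D'Angelo type\<close>

primrec iterated_derivative ::
    "('a::real_normed_vector \<Rightarrow> 'b::real_normed_vector) \<Rightarrow> 'a list \<Rightarrow> 'a \<Rightarrow> 'b" where
  "iterated_derivative f [] = f"
| "iterated_derivative f (v # vs) =
     (\<lambda>x. frechet_derivative (iterated_derivative f vs) (at x) v)"

text \<open>The least order of a partial derivative (of a smooth function) that does not vanish at
  \<open>x\<close>, and \<open>\<infinity>\<close> if there is none.\<close>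

definition vanishing_order ::
    "('a::real_normed_vector \<Rightarrow> 'b::real_normed_vector) \<Rightarrow> 'a \<Rightarrow> ereal" where
  "vanishing_order f x =
     Inf {ereal (real (length vs)) | vs. iterated_derivative f vs x \<noteq> 0}"

definition complex_affine_subspaces :: "complex ^ 'n \<Rightarrow> nat \<Rightarrow> (complex ^ 'n) set set" where
  "complex_affine_subspaces a d = {(\<lambda>v. a + v) ` L | L. vec.subspace L \<and> vec.dim L = d}"

definition holomorphic_discs ::
    "complex ^ 'n \<Rightarrow> (complex ^ 'n) set \<Rightarrow> (complex \<Rightarrow> complex ^ 'n) set" where
  "holomorphic_discs a S =
     {\<phi>. \<phi> 0 = a \<and> (\<exists>e>0. (\<forall>j. (\<lambda>\<zeta>. \<phi> \<zeta> $ j) holomorphic_on ball 0 e) \<and>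
        \<phi> ` ball 0 e \<subseteq> S \<and> \<not> \<phi> constant_on ball 0 e)}"

definition dangelo_type :: "(complex ^ 'n \<Rightarrow> real) \<Rightarrow> complex ^ 'n \<Rightarrow> nat \<Rightarrow> ereal" where
  "dangelo_type r a q =
     (INF S \<in> complex_affine_subspaces a (CARD('n) - q + 1).
        SUP \<phi> \<in> holomorphic_discs a S.
          vanishing_order (r \<circ> \<phi>) 0 / vanishing_order (\<lambda>\<zeta>. \<phi> \<zeta> - a) 0)"

text \<open>The tuple \<open>(\<Delta>\<^sub>n, \<dots>, \<Delta>\<^sub>1)\<close>: its entry at position \<open>card {..k}\<close> is the \<open>q\<close>-type with
  \<open>q = n + 1 - card {..k}\<close>.\<close>

definition dangelo_multitype ::
    "(complex ^ 'n::{finite,linorder} \<Rightarrow> real) \<Rightarrow> complex ^ 'n::{finite,linorder} \<Rightarrow> 'n \<Rightarrow> ereal" where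
  "dangelo_multitype r a = (\<lambda>k. dangelo_type r a (CARD('n) + 1 - card {..k}))"

end

theory Submission
  imports Defs "HOL-Complex_Analysis.Complex_Analysis"
    "HOL-Computational_Algebra.Fundamental_Theorem_Algebra"
begin

text \<open>
  Smoothness and \<open>\<complex>\<close>-convexity give weak linear convexity near \<open>a\<close>: the complex tangent hyperplane at a
  boundary point \<open>p\<close> misses the domain, since otherwise rotating complex lines through \<open>p\<close> about a point
  of the intersection would produce a continuous argument on the circle.  As a consequence, if the
  domain contains a translate \<open>q + x(\<zeta>)\<close>, \<open>|\<zeta>| \<le> t\<close>, of a polynomial disc \<open>x(\<zeta>) = \<Sum> \<zeta>\<^sup>i v\<^sub>i\<close>, then
  it contains \<open>q + \<eta> v\<^sub>d\<close> for \<open>|\<eta>| < c t\<^sup>d\<close>: a complex hyperplane missing the polynomial disc is given by a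
  polynomial in \<open>\<zeta>\<close> without zeros, whose coefficients are controlled by the constant one.  Letting \<open>q\<close> tend to \<open>a\<close>
  along the normal, a curve with large order of contact forces its leading coefficient to span a line
  with large order of contact.

  The directions in which the complex line through \<open>a\<close> has order of contact at least \<open>m\<close> form a
  linear subspace \<open>V\<^sub>m\<close>, and the jumps of the flag \<open>V\<^sub>1 \<supseteq> V\<^sub>2 \<supseteq> \<dots>\<close> form a weight.  A basis
  adapted to the flag shows that this weight is linearly distinguished; the statement on curves shows that
  it dominates every distinguished weight and that it is the D'Angelo multitype.
\<close>

subsection \<open>Calculus of smooth maps\<close>

text \<open>The type may be infinite, so there is no finite Taylor model of \<open>r\<close> to
  argue with. A condition "order at least m" is therefore always a bound: O(|x|^m) on lines and
  subspaces, or O(t^M) on boxes with sides A t^b when weights are involved. Smoothness absorbs the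
  higher Taylor terms on a segment of length t^b, so such bounds can be differentiated without loss
  and turn into vanishing derivatives.

  Hull arguments only show that points belong to the domain, so they bound \<open>r\<close> from
  above. The bound from below comes from the boundary point itself: its complex tangent hyperplane
  misses the domain, so \<open>r\<close> is nonnegative there. Directions outside this hyperplane
  have order 1 and cost a Lipschitz estimate.

  A curve with large order of contact need not lie in the domain. A push along the inner normal by a
  multiple of t^s, the size of \<open>r\<close> on it, moves the piece over |\<zeta>| \<le> t
  inside, and the way back costs a multiple of the same t^s. An infinite entry of a weight is
  replaced by a large integer depending on the multi-indices at hand.\<close>

lemma Ck_on_imp_continuous_on: "Ck_on k f S \<Longrightarrow> continuous_on S f"
  by (cases k) (auto intro!: continuous_at_imp_continuous_on differentiable_imp_continuous_within)

lemma Ck_on_SucD: "Ck_on (Suc k) f S \<Longrightarrow> Ck_on k f S"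
proof (induction k arbitrary: f)
  case 0
  then show ?case using Ck_on_imp_continuous_on[of "Suc 0" f S] by simp
next
  case (Suc k)
  from Suc.prems[unfolded Ck_on.simps(2)[of "Suc k"]] Suc.IH show ?case
    unfolding Ck_on.simps(2)[of k] by blast
qed

lemma Ck_on_subset: "Ck_on k f S \<Longrightarrow> T \<subseteq> S \<Longrightarrow> Ck_on k f T"
  by (induction k arbitrary: f) (auto intro: continuous_on_subset)

lemma Ck_on_cong:
  assumes "open S" "\<And>x. x \<in> S \<Longrightarrow> f x = g x" "Ck_on k f S"
  shows "Ck_on k g S"
  using assms(2,3)
proof (induction k arbitrary: f g)
  case 0
  then show ?case using continuous_on_cong[of S S f g] by simp
next
  case (Suc k)
  have eq: "frechet_derivative f (at x) = frechet_derivative g (at x)" if "x \<in> S" for x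
    using Suc.prems that by (intro frechet_derivative_transform_within_open[OF _ assms(1)]) auto
  have "g differentiable (at x)" if "x \<in> S" for x
    using has_derivative_transform_within_open[OF _ assms(1) that, of f _ UNIV g] Suc.prems that
    unfolding differentiable_def Ck_on.simps(2) by metis
  moreover have "Ck_on k (\<lambda>x. frechet_derivative g (at x) v) S" for v
    by (rule Suc.IH[of "\<lambda>x. frechet_derivative f (at x) v"]) (use Suc.prems eq in auto)
  ultimately show ?case by simp
qed

text \<open>\<open>Ck_on\<close> is phrased with \<open>frechet_derivative\<close>, whereas the
  differentiation rules deliver some derivative \<open>f'\<close>. Uniqueness identifies the two on
  \<open>S\<close>; closure under algebraic operations and composition goes through this
  rule.\<close>

lemma Ck_on_SucI:
  assumes "open S" "\<And>x. x \<in> S \<Longrightarrow> (f has_derivative f' x) (at x)"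
    and "\<And>v. Ck_on k (\<lambda>x. f' x v) S"
  shows "Ck_on (Suc k) f S"
proof -
  have "Ck_on k (\<lambda>x. frechet_derivative f (at x) v) S" for v
    by (rule Ck_on_cong[OF assms(1) _ assms(3)[of v]]) (use assms(2) frechet_derivative_at in metis)
  then show ?thesis using assms(2) by (auto simp: differentiable_def)
qed

lemma Ck_on_SucE:
  assumes "Ck_on (Suc k) f S"
  shows "\<And>x. x \<in> S \<Longrightarrow> (f has_derivative frechet_derivative f (at x)) (at x)"
    and "\<And>v. Ck_on k (\<lambda>x. frechet_derivative f (at x) v) S"
  using assms frechet_derivative_works by auto

lemma Ck_on_const: "Ck_on k (\<lambda>x. c) S"
  by (induction k arbitrary: c) auto

lemma Ck_on_bounded_linear:
  assumes "open S" "bounded_linear L" "Ck_on k f S"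
  shows "Ck_on k (\<lambda>x. L (f x)) S"
  using assms(3)
proof (induction k arbitrary: f)
  case 0
  then show ?case by (simp add: assms(2) bounded_linear.continuous_on)
next
  case (Suc k)
  show ?case
    by (rule Ck_on_SucI[OF assms(1) bounded_linear.has_derivative[OF assms(2) Ck_on_SucE(1)[OF Suc.prems]]])
      (auto intro: Suc.IH Ck_on_SucE(2)[OF Suc.prems])
qed

lemma Ck_on_add:
  assumes "open S" "Ck_on k f S" "Ck_on k g S"
  shows "Ck_on k (\<lambda>x. f x + g x) S"
  using assms(2,3)
proof (induction k arbitrary: f g)
  case 0
  then show ?case by (simp add: continuous_on_add)
next
  case (Suc k)
  show ?case
    by (rule Ck_on_SucI[OF assms(1) has_derivative_add[OF Ck_on_SucE(1)[OF Suc.prems(1)] Ck_on_SucE(1)[OF Suc.prems(2)]]])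
      (auto intro: Suc.IH Ck_on_SucE(2)[OF Suc.prems(1)] Ck_on_SucE(2)[OF Suc.prems(2)])
qed

lemma Ck_on_sum:
  assumes "open S" "\<And>i. i \<in> I \<Longrightarrow> Ck_on k (f i) S"
  shows "Ck_on k (\<lambda>x. \<Sum>i\<in>I. f i x) S"
  using assms(2)
  by (induction I rule: infinite_finite_induct) (auto intro: Ck_on_const Ck_on_add assms(1))

lemma Ck_on_bilinear:
  assumes "open S" "bounded_bilinear P" "Ck_on k f S" "Ck_on k g S"
  shows "Ck_on k (\<lambda>x. P (f x) (g x)) S"
  using assms(3,4)
proof (induction k arbitrary: f g)
  case 0
  then show ?case by (simp add: assms(2) bounded_bilinear.continuous_on)
next
  case (Suc k)
  show ?case
    by (rule Ck_on_SucI[OF assms(1) bounded_bilinear.FDERIV[OF assms(2) Ck_on_SucE(1)[OF Suc.prems(1)] Ck_on_SucE(1)[OF Suc.prems(2)]]])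
      (auto intro!: Ck_on_add Suc.IH assms(1) Ck_on_SucE(2)[OF Suc.prems(1)] Ck_on_SucE(2)[OF Suc.prems(2)]
        Ck_on_SucD[OF Suc.prems(1)] Ck_on_SucD[OF Suc.prems(2)])
qed

text \<open>In the chain rule both the derivative of \<open>f\<close> and its direction vary with
  the point, while \<open>Ck_on\<close> knows only derivatives in fixed directions. Expanding
  \<open>frechet_derivative g (at x) v\<close> in the basis gives a finite sum of products with
  fixed directions, to which the induction applies; hence the Euclidean middle space.\<close>

lemma Ck_on_compose:
  fixes g :: "'a::real_normed_vector \<Rightarrow> 'b::euclidean_space" and f :: "'b \<Rightarrow> 'c::real_normed_vector"
  assumes "open S" "open T" "g ` S \<subseteq> T" "Ck_on k g S" "Ck_on k f T"
  shows "Ck_on k (f \<circ> g) S"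
  using assms(4,5)
proof (induction k arbitrary: f)
  case 0
  then show ?case using continuous_on_compose[of S g f] continuous_on_subset[OF _ assms(3)] by auto
next
  case (Suc k)
  let ?f' = "\<lambda>x v. \<Sum>b\<in>Basis. (frechet_derivative g (at x) v \<bullet> b) *\<^sub>R (frechet_derivative f (at (g x)) b)"
  show ?case
  proof (rule Ck_on_SucI[OF assms(1), of _ ?f'])
    fix x assume x: "x \<in> S"
    have F: "(f has_derivative frechet_derivative f (at (g x))) (at (g x))"
      using Ck_on_SucE(1)[OF Suc.prems(2)] x assms(3) by auto
    have "frechet_derivative f (at (g x)) w = (\<Sum>b\<in>Basis. (w \<bullet> b) *\<^sub>R frechet_derivative f (at (g x)) b)" for w
    proof -
      have L: "linear (frechet_derivative f (at (g x)))" using F has_derivative_linear by blast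
      show ?thesis
        by (subst (1) euclidean_representation[of w, symmetric]) (simp add: linear_sum[OF L] linear_scale[OF L])
    qed
    then have "frechet_derivative f (at (g x)) \<circ> frechet_derivative g (at x) = ?f' x"
      unfolding o_def by (intro ext) blast
    moreover have "(f \<circ> g has_derivative frechet_derivative f (at (g x)) \<circ> frechet_derivative g (at x)) (at x)"
      using F Ck_on_SucE(1)[OF Suc.prems(1) x] diff_chain_at by blast
    ultimately show "(f \<circ> g has_derivative ?f' x) (at x)" by simp
  next
    fix v
    have "Ck_on k ((\<lambda>y. frechet_derivative f (at y) b) \<circ> g) S" for b
      by (rule Suc.IH) (use Ck_on_SucD[OF Suc.prems(1)] Ck_on_SucE(2)[OF Suc.prems(2)] in auto)
    moreover have "Ck_on k (\<lambda>x. frechet_derivative g (at x) v \<bullet> b) S" for b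
      by (rule Ck_on_bounded_linear[OF assms(1) bounded_linear_inner_left Ck_on_SucE(2)[OF Suc.prems(1)]])
    ultimately show "Ck_on k (\<lambda>x. ?f' x v) S"
      unfolding o_def
      by (intro Ck_on_sum[OF assms(1)] Ck_on_bilinear[OF assms(1) bounded_bilinear_scaleR])
  qed
qed

section \<open>Derivatives along fixed vectors and Taylor estimates\<close>

definition deriv_along :: "'a::real_normed_vector \<Rightarrow> ('a \<Rightarrow> 'b::real_normed_vector) \<Rightarrow> 'a \<Rightarrow> 'b" where
  "deriv_along v f = (\<lambda>x. frechet_derivative f (at x) v)"

lemma C_infinity_on_deriv_along: "C_infinity_on f S \<Longrightarrow> C_infinity_on (deriv_along v f) S"
  unfolding C_infinity_on_def deriv_along_def by (metis Ck_on.simps(2))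

lemma C_infinity_on_funpow_deriv_along:
  "C_infinity_on f S \<Longrightarrow> C_infinity_on ((deriv_along v ^^ l) f) S"
  by (induction l) (auto intro: C_infinity_on_deriv_along)

lemma C_infinity_on_has_derivative:
  "C_infinity_on f S \<Longrightarrow> x \<in> S \<Longrightarrow> (f has_derivative (\<lambda>v. deriv_along v f x)) (at x)"
  unfolding C_infinity_on_def deriv_along_def using Ck_on_SucE(1) by metis

lemma C_infinity_on_continuous_on: "C_infinity_on f S \<Longrightarrow> continuous_on S f"
  unfolding C_infinity_on_def using Ck_on_imp_continuous_on by blast

lemma C_infinity_on_subset: "C_infinity_on f S \<Longrightarrow> T \<subseteq> S \<Longrightarrow> C_infinity_on f T"
  unfolding C_infinity_on_def using Ck_on_subset by blast

lemma C_infinity_on_bounded_linear: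
  "open S \<Longrightarrow> bounded_linear L \<Longrightarrow> C_infinity_on f S \<Longrightarrow> C_infinity_on (\<lambda>x. L (f x)) S"
  unfolding C_infinity_on_def using Ck_on_bounded_linear by blast

lemma C_infinity_on_add:
  "open S \<Longrightarrow> C_infinity_on f S \<Longrightarrow> C_infinity_on g S \<Longrightarrow> C_infinity_on (\<lambda>x. f x + g x) S"
  unfolding C_infinity_on_def using Ck_on_add by blast

lemma C_infinity_on_sum:
  "open S \<Longrightarrow> (\<And>i. i \<in> I \<Longrightarrow> C_infinity_on (f i) S) \<Longrightarrow> C_infinity_on (\<lambda>x. \<Sum>i\<in>I. f i x) S"
  unfolding C_infinity_on_def by (auto intro: Ck_on_sum)

lemma C_infinity_on_compose:
  fixes g :: "'a::real_normed_vector \<Rightarrow> 'b::euclidean_space" and f :: "'b \<Rightarrow> 'c::real_normed_vector"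
  shows "open S \<Longrightarrow> open T \<Longrightarrow> g ` S \<subseteq> T \<Longrightarrow> C_infinity_on g S \<Longrightarrow> C_infinity_on f T \<Longrightarrow> C_infinity_on (f \<circ> g) S"
  unfolding C_infinity_on_def by (metis Ck_on_compose)

lemma C_infinity_on_affine:
  assumes "open S" "bounded_linear L"
  shows "C_infinity_on (\<lambda>x. a + L x) S"
  unfolding C_infinity_on_def
proof
  fix k
  have "((\<lambda>x. a + L x) has_derivative L) (at x)" for x
    using bounded_linear.has_derivative[OF assms(2) has_derivative_ident] by (intro derivative_eq_intros) auto
  then have 1: "Ck_on (Suc k) (\<lambda>x. a + L x) S" for k
    using Ck_on_const by (intro Ck_on_SucI[OF assms(1)]) auto
  then show "Ck_on k (\<lambda>x. a + L x) S" using Ck_on_SucD by blast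
qed

lemma deriv_along_cong:
  assumes "open S" "\<And>x. x \<in> S \<Longrightarrow> f x = g x" "C_infinity_on f S" "x \<in> S"
  shows "deriv_along v f x = deriv_along v g x"
  unfolding deriv_along_def
  using C_infinity_on_has_derivative[OF assms(3,4)] assms
  by (metis differentiable_def frechet_derivative_transform_within_open)

lemma deriv_along_eq: "(f has_derivative f') (at x) \<Longrightarrow> deriv_along v f x = f' v"
  unfolding deriv_along_def using frechet_derivative_at by metis

lemma has_vector_derivative_along:
  assumes "C_infinity_on f S" "x + s *\<^sub>R v \<in> S"
  shows "((\<lambda>s. f (x + s *\<^sub>R v)) has_vector_derivative deriv_along v f (x + s *\<^sub>R v)) (at s)"
proof -
  have "((\<lambda>s. x + s *\<^sub>R v) has_derivative (\<lambda>s. s *\<^sub>R v)) (at s)"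
    by (auto intro!: derivative_eq_intros)
  from diff_chain_at[OF this C_infinity_on_has_derivative[OF assms]]
  have "((\<lambda>s. f (x + s *\<^sub>R v)) has_derivative (\<lambda>t. deriv_along (t *\<^sub>R v) f (x + s *\<^sub>R v))) (at s)"
    by (simp add: o_def)
  moreover have "deriv_along (t *\<^sub>R v) f (x + s *\<^sub>R v) = t *\<^sub>R deriv_along v f (x + s *\<^sub>R v)" for t
    using linear_scale[OF has_derivative_linear[OF C_infinity_on_has_derivative[OF assms]]] .
  ultimately show ?thesis by (simp add: has_vector_derivative_def)
qed

text \<open>Induction on \<open>K\<close>: the derivative in \<open>h\<close> of the remainder of
  \<open>f\<close> is the remainder of \<open>deriv_along v f\<close> of one order less, and the
  mean value inequality integrates its bound. The factor \<open>1 / fact K\<close> is given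
  away.\<close>

lemma Taylor_along:
  assumes "convex S" "C_infinity_on f S" "x \<in> S" "x + h *\<^sub>R v \<in> S" "0 \<le> h"
    and "\<And>s. 0 \<le> s \<Longrightarrow> s \<le> h \<Longrightarrow> norm ((deriv_along v ^^ K) f (x + s *\<^sub>R v)) \<le> B"
  shows "norm (f (x + h *\<^sub>R v) - (\<Sum>l<K. (h ^ l / fact l) *\<^sub>R (deriv_along v ^^ l) f x)) \<le> B * h ^ K"
  using assms(2,4,5,6)
proof (induction K arbitrary: f h)
  case 0
  then show ?case by simp
next
  case (Suc K)
  have B0: "0 \<le> B" using Suc.prems(4)[of 0] Suc.prems(3) norm_ge_zero order_trans by blast
  have seg: "x + s *\<^sub>R v \<in> S" if "0 \<le> s" "s \<le> h" for s
  proof (cases "h = 0")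
    case True then show ?thesis using that assms(3) by simp
  next
    case False
    have "x + s *\<^sub>R v = (1 - s/h) *\<^sub>R x + (s/h) *\<^sub>R (x + h *\<^sub>R v)"
      using False by (simp add: algebra_simps)
    also have "\<dots> \<in> S" using assms(1,3) Suc.prems(2,3) that False
      by (intro convexD_alt) (auto simp: field_simps)
    finally show ?thesis .
  qed
  let ?g = "deriv_along v f"
  let ?F = "\<lambda>s. f (x + s *\<^sub>R v) - (\<Sum>l<Suc K. (s ^ l / fact l) *\<^sub>R (deriv_along v ^^ l) f x)"
  let ?F' = "\<lambda>s. ?g (x + s *\<^sub>R v) - (\<Sum>l<K. (s ^ l / fact l) *\<^sub>R (deriv_along v ^^ l) ?g x)"
  have F0: "?F 0 = 0"
    by (simp add: sum.lessThan_Suc_shift del: sum.lessThan_Suc)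
  have der: "(?F has_vector_derivative ?F' s) (at s within {0..h})" if "s \<in> {0..h}" for s
  proof -
    have "((\<lambda>s. \<Sum>l<Suc K. (s ^ l / fact l) *\<^sub>R (deriv_along v ^^ l) f x) has_vector_derivative
        (\<Sum>l<Suc K. (real l * s ^ (l-1) / fact l) *\<^sub>R (deriv_along v ^^ l) f x)) (at s)"
      by (intro has_vector_derivative_sum) (auto intro!: derivative_eq_intros simp: has_vector_derivative_def field_simps)
    moreover have "(\<Sum>l<Suc K. (real l * s ^ (l-1) / fact l) *\<^sub>R (deriv_along v ^^ l) f x)
       = (\<Sum>l<K. (s ^ l / fact l) *\<^sub>R (deriv_along v ^^ l) ?g x)"
      by (simp add: sum.lessThan_Suc_shift funpow_swap1 del: sum.lessThan_Suc)
    ultimately show ?thesis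
      using has_vector_derivative_along[OF Suc.prems(1) seg, of s] that
      by (auto intro!: has_vector_derivative_diff intro: has_vector_derivative_at_within)
  qed
  have bd: "norm (?F' s) \<le> B * h ^ K" if "s \<in> {0..h}" for s
  proof -
    have "norm (?F' s) \<le> B * s ^ K"
      using that Suc.prems(4) seg
      by (intro Suc.IH) (auto simp: funpow_swap1 intro: C_infinity_on_deriv_along[OF Suc.prems(1)])
    also have "\<dots> \<le> B * h ^ K" using that B0 by (intro mult_left_mono power_mono) auto
    finally show ?thesis .
  qed
  have "norm (?F h - ?F 0) \<le> B * h ^ K * norm (h - 0)"
  proof (rule differentiable_bound[of "{0..h}" ?F "\<lambda>s t. t *\<^sub>R ?F' s"])
    show "onorm (\<lambda>t. t *\<^sub>R ?F' s) \<le> B * h ^ K" if "s \<in> {0..h}" for s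
      by (rule onorm_le) (use mult_right_mono[OF bd[OF that] abs_ge_zero] in \<open>simp add: mult.commute\<close>)
  qed (use der Suc.prems in \<open>auto simp: has_vector_derivative_def\<close>)
  then show ?case using F0 Suc.prems(3) by (simp add: mult.assoc mult.commute[of h])
qed

text \<open>The constant depends on the degree alone, so it can be used on intervals of length
  \<open>t ^ b\<close> with \<open>t\<close> tending to 0. In 2^N P(s/2) - P(s), with N the degree,
  the top term cancels and the linear coefficient is multiplied by 2^(N-1) - 1.\<close>

lemma polynomial_linear_coeff_bound:
  "\<exists>C\<ge>0. \<forall>(a::nat \<Rightarrow> 'a::real_normed_vector) h A. 0 \<le> h \<longrightarrow>
     (\<forall>s\<in>{0..h}. norm (\<Sum>l<Suc (Suc K). s ^ l *\<^sub>R a l) \<le> A) \<longrightarrow> norm (a 1) * h \<le> C * A"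
proof (induction K)
  case 0
  have "norm (a 1) * h \<le> 2 * A" if "0 \<le> h" and b: "\<forall>s\<in>{0..h}. norm (\<Sum>l<Suc (Suc 0). s ^ l *\<^sub>R a l) \<le> A"
    for a :: "nat \<Rightarrow> 'a" and h A
  proof -
    have "norm (a 0) \<le> A" "norm (a 0 + h *\<^sub>R a 1) \<le> A"
      using b[rule_format, of 0] b[rule_format, of h] that(1) by simp_all
    then have "norm ((a 0 + h *\<^sub>R a 1) - a 0) \<le> A + A"
      using norm_triangle_ineq4 order_trans add_mono by (metis (no_types, lifting))
    then show ?thesis using that(1) by (simp add: mult.commute)
  qed
  then show ?case by (intro exI[of _ 2]) auto
next
  case (Suc K)
  then obtain C where C: "C \<ge> 0" "\<And>(a::nat \<Rightarrow> 'a) h A. 0 \<le> h \<Longrightarrow>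
     (\<forall>s\<in>{0..h}. norm (\<Sum>l<Suc (Suc K). s ^ l *\<^sub>R a l) \<le> A) \<Longrightarrow> norm (a 1) * h \<le> C * A"
    by blast
  let ?K = "Suc (Suc K)"
  have "norm (a 1) * h \<le> C * (2 ^ ?K + 1) * A"
    if h: "0 \<le> h" and b: "\<forall>s\<in>{0..h}. norm (\<Sum>l<Suc ?K. s ^ l *\<^sub>R a l) \<le> A"
    for a :: "nat \<Rightarrow> 'a" and h A
  proof -
    let ?P = "\<lambda>s. \<Sum>l<Suc ?K. s ^ l *\<^sub>R a l"
    let ?b = "\<lambda>l. (2 ^ (?K - l) - 1::real) *\<^sub>R a l"
    have eq: "(\<Sum>l<?K. s ^ l *\<^sub>R ?b l) = 2 ^ ?K *\<^sub>R ?P (s/2) - ?P s" for s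
    proof -
      have "2 ^ ?K *\<^sub>R ?P (s/2) - ?P s = (\<Sum>l<Suc ?K. (2 ^ ?K * (s/2)^l - s^l) *\<^sub>R a l)"
        by (simp only: scaleR_sum_right sum_subtractf[symmetric] scaleR_left_diff_distrib scaleR_scaleR)
      also have "\<dots> = (\<Sum>l<Suc ?K. s ^ l *\<^sub>R ?b l)"
      proof (rule sum.cong[OF refl])
        fix l assume "l \<in> {..<Suc ?K}"
        then have "(2::real) ^ ?K = 2 ^ (?K - l) * 2 ^ l"
          by (simp only: power_add[symmetric]) simp
        then show "(2 ^ ?K * (s/2)^l - s^l) *\<^sub>R a l = s ^ l *\<^sub>R ?b l"
          by (simp only: scaleR_scaleR power_divide) (simp add: algebra_simps)
      qed
      also have "\<dots> = (\<Sum>l<?K. s ^ l *\<^sub>R ?b l)" by simp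
      finally show ?thesis by simp
    qed
    have "\<forall>s\<in>{0..h}. norm (\<Sum>l<?K. s ^ l *\<^sub>R ?b l) \<le> (2 ^ ?K + 1) * A"
    proof
      fix s assume s: "s \<in> {0..h}"
      have "norm (2 ^ ?K *\<^sub>R ?P (s/2) - ?P s) \<le> 2 ^ ?K * norm (?P (s/2)) + norm (?P s)"
        by (rule order_trans[OF norm_triangle_ineq4]) simp
      also have "\<dots> \<le> 2 ^ ?K * A + A"
        using b[rule_format, of s] b[rule_format, of "s/2"] s
        by (intro add_mono mult_left_mono) (auto simp del: sum.lessThan_Suc)
      finally show "norm (\<Sum>l<?K. s ^ l *\<^sub>R ?b l) \<le> (2 ^ ?K + 1) * A"
        unfolding eq by (simp add: algebra_simps)
    qed
    from C(2)[OF h this] have 1: "norm (?b 1) * h \<le> C * ((2 ^ ?K + 1) * A)" .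
    \<comment> \<open>The base case has degree 1, so in the step the exponent \<open>?K - 1\<close>
      is at least 1 and the factor of \<open>a 1\<close> is at least 1.\<close>
    have "(1::real) \<le> 2 ^ K" by simp
    then have "1 \<le> \<bar>(2 ^ (?K - 1) - 1::real)\<bar>" by (simp only: diff_Suc_1 diff_Suc_Suc power_Suc)
    from mult_right_mono[OF this norm_ge_zero[of "a 1"]]
    have "norm (a 1) \<le> norm (?b 1)" by (simp only: norm_scaleR mult_1)
    then have "norm (a 1) * h \<le> norm (?b 1) * h" using h by (rule mult_right_mono)
    with 1 show ?thesis by (simp add: mult.assoc)
  qed
  then show ?case using C(1) by (intro exI[of _ "C * (2 ^ ?K + 1)"]) auto
qed

lemma vector_derivative_linear_bound:
  fixes F :: "real \<Rightarrow> 'a::real_normed_vector"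
  assumes "0 \<le> t" "\<And>s. s \<in> {0..t} \<Longrightarrow> (F has_vector_derivative F' s) (at s)"
    and "\<And>s. s \<in> {0..t} \<Longrightarrow> norm (F' s - c) \<le> e"
  shows "norm (F t - F 0 - t *\<^sub>R c) \<le> e * t"
proof -
  have "norm ((F t - t *\<^sub>R c) - (F 0 - 0 *\<^sub>R c)) \<le> e * norm (t - 0)"
  proof (rule differentiable_bound[of "{0..t}" "\<lambda>s. F s - s *\<^sub>R c" "\<lambda>s h. h *\<^sub>R (F' s - c)"])
    show "((\<lambda>s. F s - s *\<^sub>R c) has_derivative (\<lambda>h. h *\<^sub>R (F' s - c))) (at s within {0..t})"
      if "s \<in> {0..t}" for s
      using assms(2)[OF that] unfolding has_vector_derivative_def
      by (auto intro!: derivative_eq_intros has_derivative_at_withinI[where s = "{0..t}"] simp: scaleR_diff_right)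
    show "onorm (\<lambda>h. h *\<^sub>R (F' s - c)) \<le> e" if "s \<in> {0..t}" for s
      by (rule onorm_le) (use mult_right_mono[OF assms(3)[OF that] abs_ge_zero] in \<open>simp add: mult.commute\<close>)
  qed (use assms(1) in auto)
  then show ?thesis using assms(1) by (simp add: algebra_simps)
qed

text \<open>Two nested mean value estimates: in the outer one the difference in direction
  \<open>v\<close> is a function of the step along \<open>u\<close>, in the inner one
  \<open>deriv_along u f\<close> is compared with its linear part along \<open>v\<close>. Continuity
  of the second derivative at \<open>x\<close> makes it vary by less than \<open>e\<close> on the
  small parallelogram.\<close>

lemma mixed_difference_bound:
  assumes "C_infinity_on f (ball x d)" "0 < e" and True: "0 < d"
  shows "\<exists>s0>0. \<forall>s. 0 < s \<longrightarrow> s < s0 \<longrightarrow>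
     norm (f (x + s *\<^sub>R u + s *\<^sub>R v) - f (x + s *\<^sub>R u) - (f (x + s *\<^sub>R v) - f x)
       - s\<^sup>2 *\<^sub>R deriv_along v (deriv_along u f) x) \<le> e * s\<^sup>2"
proof -
  let ?h = "deriv_along v (deriv_along u f)"
  have Ch: "C_infinity_on ?h (ball x d)" by (intro C_infinity_on_deriv_along assms)
  have Cu: "C_infinity_on (deriv_along u f) (ball x d)" by (intro C_infinity_on_deriv_along assms)
  have "isCont ?h x"
    using C_infinity_on_continuous_on[OF Ch] True continuous_on_eq_continuous_at[of "ball x d" ?h] by auto
  then obtain d' where d': "d' > 0" "\<And>y. dist y x < d' \<Longrightarrow> dist (?h y) (?h x) < e"
    using assms(2) unfolding continuous_at_eps_delta by metis
  define m where "m = norm u + norm v + 1"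
  have m: "m > 0" using norm_ge_zero[of u] norm_ge_zero[of v] by (simp add: m_def add_nonneg_pos)
  define s0 where "s0 = min d d' / m"
  have s0: "s0 > 0" using True d' m by (simp add: s0_def)
  have near: "dist (x + \<sigma> *\<^sub>R u + \<tau> *\<^sub>R v) x < min d d'"
    if "0 \<le> \<sigma>" "\<sigma> \<le> s" "0 \<le> \<tau>" "\<tau> \<le> s" "0 < s" "s < s0" for \<sigma> \<tau> s
  proof -
    have "dist (x + \<sigma> *\<^sub>R u + \<tau> *\<^sub>R v) x \<le> \<sigma> * norm u + \<tau> * norm v"
      using norm_triangle_ineq[of "\<sigma> *\<^sub>R u" "\<tau> *\<^sub>R v"] that by (simp add: dist_norm add.assoc)
    also have "\<dots> \<le> s * norm u + s * norm v" using that by (intro add_mono mult_right_mono) auto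
    also have "\<dots> < s * m" using that by (simp add: m_def algebra_simps)
    also have "\<dots> < min d d'" using that m by (simp add: s0_def pos_less_divide_eq)
    finally show ?thesis .
  qed
  show ?thesis
  proof (intro exI[of _ s0] conjI allI impI s0)
    fix s assume s: "0 < s" "s < s0"
    let ?G = "\<lambda>\<sigma>. f (x + \<sigma> *\<^sub>R u + s *\<^sub>R v) - f (x + \<sigma> *\<^sub>R u)"
    let ?G' = "\<lambda>\<sigma>. deriv_along u f (x + \<sigma> *\<^sub>R u + s *\<^sub>R v) - deriv_along u f (x + \<sigma> *\<^sub>R u)"
    have inb: "x + \<sigma> *\<^sub>R u + \<tau> *\<^sub>R v \<in> ball x d" "dist (?h (x + \<sigma> *\<^sub>R u + \<tau> *\<^sub>R v)) (?h x) < e"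
      if "\<sigma> \<in> {0..s}" "\<tau> \<in> {0..s}" for \<sigma> \<tau>
      using near[of \<sigma> s \<tau>] that s d'(2) by (auto simp: dist_commute[of x])
    have inb0: "x + \<sigma> *\<^sub>R u \<in> ball x d" if "\<sigma> \<in> {0..s}" for \<sigma>
      using inb(1)[OF that, of 0] s by auto
    have "norm (?G s - ?G 0 - s *\<^sub>R (s *\<^sub>R ?h x)) \<le> (e * s) * s"
    proof (rule vector_derivative_linear_bound[of s ?G ?G'])
      fix \<sigma> assume \<sigma>: "\<sigma> \<in> {0..s}"
      have "((\<lambda>\<sigma>. f ((x + s *\<^sub>R v) + \<sigma> *\<^sub>R u)) has_vector_derivative deriv_along u f ((x + s *\<^sub>R v) + \<sigma> *\<^sub>R u)) (at \<sigma>)"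
        using inb(1)[OF \<sigma>, of s] s by (intro has_vector_derivative_along[OF assms(1)]) (auto simp: algebra_simps)
      then show "(?G has_vector_derivative ?G' \<sigma>) (at \<sigma>)"
        using has_vector_derivative_along[OF assms(1) inb0[OF \<sigma>]]
        by (intro has_vector_derivative_diff) (simp_all add: algebra_simps)
      have "norm (deriv_along u f ((x + \<sigma> *\<^sub>R u) + s *\<^sub>R v) - deriv_along u f ((x + \<sigma> *\<^sub>R u) + 0 *\<^sub>R v) - s *\<^sub>R ?h x) \<le> e * s"
      proof (rule vector_derivative_linear_bound[of s "\<lambda>\<tau>. deriv_along u f ((x + \<sigma> *\<^sub>R u) + \<tau> *\<^sub>R v)"
            "\<lambda>\<tau>. ?h ((x + \<sigma> *\<^sub>R u) + \<tau> *\<^sub>R v)"])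
        fix \<tau> assume \<tau>: "\<tau> \<in> {0..s}"
        show "((\<lambda>\<tau>. deriv_along u f ((x + \<sigma> *\<^sub>R u) + \<tau> *\<^sub>R v)) has_vector_derivative
          ?h ((x + \<sigma> *\<^sub>R u) + \<tau> *\<^sub>R v)) (at \<tau>)"
          by (rule has_vector_derivative_along[OF Cu inb(1)[OF \<sigma> \<tau>]])
        show "norm (?h (x + \<sigma> *\<^sub>R u + \<tau> *\<^sub>R v) - ?h x) \<le> e"
          using inb(2)[OF \<sigma> \<tau>] by (simp add: dist_norm)
      qed (use s in auto)
      then show "norm (?G' \<sigma> - s *\<^sub>R ?h x) \<le> e * s" by simp
    qed (use s in auto)
    then show "norm (f (x + s *\<^sub>R u + s *\<^sub>R v) - f (x + s *\<^sub>R u) - (f (x + s *\<^sub>R v) - f x) - s\<^sup>2 *\<^sub>R ?h x) \<le> e * s\<^sup>2"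
      by (simp add: power2_eq_square mult.assoc)
  qed
qed

text \<open>The second difference over the parallelogram is symmetric in \<open>u\<close> and
  \<open>v\<close>, and divided by \<open>s\<^sup>2\<close> it tends to both mixed
  derivatives.\<close>

lemma deriv_along_commute:
  assumes "C_infinity_on f S" "open S" "x \<in> S"
  shows "deriv_along u (deriv_along v f) x = deriv_along v (deriv_along u f) x"
proof -
  obtain d where d: "d > 0" "ball x d \<subseteq> S" using assms(2,3) openE by blast
  have C: "C_infinity_on f (ball x d)" using C_infinity_on_subset assms(1) d(2) by blast
  let ?a = "deriv_along u (deriv_along v f) x" and ?b = "deriv_along v (deriv_along u f) x"
  have "norm (?a - ?b) \<le> e" if "e > 0" for e
  proof -
    have e: "e/2 > 0" using that by simp
    obtain s1 where s1: "s1 > 0" "\<And>s. 0 < s \<Longrightarrow> s < s1 \<Longrightarrow> norm (f (x + s *\<^sub>R u + s *\<^sub>R v) - f (x + s *\<^sub>R u) - (f (x + s *\<^sub>R v) - f x)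
       - s\<^sup>2 *\<^sub>R ?b) \<le> e/2 * s\<^sup>2" using mixed_difference_bound[OF C e d(1), of u v] by blast
    obtain s2 where s2: "s2 > 0" "\<And>s. 0 < s \<Longrightarrow> s < s2 \<Longrightarrow> norm (f (x + s *\<^sub>R v + s *\<^sub>R u) - f (x + s *\<^sub>R v) - (f (x + s *\<^sub>R u) - f x)
       - s\<^sup>2 *\<^sub>R ?a) \<le> e/2 * s\<^sup>2" using mixed_difference_bound[OF C e d(1), of v u] by blast
    define s where "s = min s1 s2 / 2"
    have s: "0 < s" "s < s1" "s < s2" using s1 s2 by (auto simp: s_def)
    let ?D = "f (x + s *\<^sub>R u + s *\<^sub>R v) - f (x + s *\<^sub>R u) - (f (x + s *\<^sub>R v) - f x)"
    have eq: "f (x + s *\<^sub>R v + s *\<^sub>R u) - f (x + s *\<^sub>R v) - (f (x + s *\<^sub>R u) - f x) = ?D"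
      by (simp add: algebra_simps)
    have "norm ((?D - s\<^sup>2 *\<^sub>R ?b) - (?D - s\<^sup>2 *\<^sub>R ?a)) \<le> e/2 * s\<^sup>2 + e/2 * s\<^sup>2"
      by (rule order_trans[OF norm_triangle_ineq4 add_mono[OF s1(2)[OF s(1,2)] s2(2)[OF s(1,3), unfolded eq]]])
    also have "(?D - s\<^sup>2 *\<^sub>R ?b) - (?D - s\<^sup>2 *\<^sub>R ?a) = s\<^sup>2 *\<^sub>R (?a - ?b)"
      by (simp add: scaleR_diff_right)
    finally have "s\<^sup>2 * norm (?a - ?b) \<le> s\<^sup>2 * e"
      by (simp only: norm_scaleR abs_power2) (simp add: field_simps)
    moreover have "0 < s\<^sup>2" using s(1) by simp
    ultimately show ?thesis by (rule mult_left_le_imp_le)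
  qed
  then have "norm (?a - ?b) \<le> 0" using field_le_epsilon[of "norm (?a - ?b)" 0] by simp
  then show ?thesis by simp
qed

text \<open>\<open>S A t\<close> is thought of as an anisotropic box with sides \<open>A t\<^sup>b\<close> for integers \<open>b\<close> depending on the side.\<close>

definition boxes_shrink :: "(real \<Rightarrow> real \<Rightarrow> 'a::real_normed_vector set) \<Rightarrow> bool" where
  "boxes_shrink S \<longleftrightarrow> (\<forall>A>0. \<forall>e>0. \<exists>t0>0. \<forall>t. 0 < t \<longrightarrow> t < t0 \<longrightarrow> S A t \<subseteq> ball 0 e)"

text \<open>The bound is required for every \<open>A\<close>, since differentiation looks at
  segments which leave \<open>S A t\<close> and stay only in a box with a larger constant.\<close>

definition box_bigo :: "(real \<Rightarrow> real \<Rightarrow> 'a::real_normed_vector set) \<Rightarrow> nat \<Rightarrow> ('a \<Rightarrow> 'b::real_normed_vector) \<Rightarrow> bool" where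
  "box_bigo S M f \<longleftrightarrow> (\<forall>A>0. \<exists>C t0. 0 < t0 \<and> (\<forall>t x. 0 < t \<longrightarrow> t < t0 \<longrightarrow> x \<in> S A t \<longrightarrow> norm (f x) \<le> C * t ^ M))"

text \<open>Moving by at most \<open>t ^ b\<close> along \<open>v\<close> enlarges the constant of
  the box by an amount independent of \<open>t\<close>: in this direction the box has size of order
  t^b.\<close>

definition box_direction :: "(real \<Rightarrow> real \<Rightarrow> 'a::real_normed_vector set) \<Rightarrow> nat \<Rightarrow> 'a \<Rightarrow> bool" where
  "box_direction S b v \<longleftrightarrow> (\<exists>c\<ge>0. \<forall>A t x s. 0 < A \<longrightarrow> 0 < t \<longrightarrow> t < 1 \<longrightarrow> x \<in> S A t \<longrightarrow>
     0 \<le> s \<longrightarrow> s \<le> t ^ b \<longrightarrow> x + s *\<^sub>R v \<in> S (A + c) t)"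

lemma box_bigoD:
  "box_bigo S M f \<Longrightarrow> 0 < A \<Longrightarrow> \<exists>C t0. 0 < t0 \<and> (\<forall>t x. 0 < t \<longrightarrow> t < t0 \<longrightarrow> x \<in> S A t \<longrightarrow> norm (f x) \<le> C * t ^ M)"
  unfolding box_bigo_def by blast

lemma box_bigo_add:
  assumes "box_bigo S M f" "box_bigo S M g"
  shows "box_bigo S M (\<lambda>x. f x + g x)"
  unfolding box_bigo_def
proof (intro allI impI)
  fix A :: real assume "0 < A"
  obtain C t0 where 1: "0 < t0" "\<forall>t x. 0 < t \<longrightarrow> t < t0 \<longrightarrow> x \<in> S A t \<longrightarrow> norm (f x) \<le> C * t ^ M"
    using box_bigoD[OF assms(1) \<open>0 < A\<close>] by blast
  obtain C' t0' where 2: "0 < t0'" "\<forall>t x. 0 < t \<longrightarrow> t < t0' \<longrightarrow> x \<in> S A t \<longrightarrow> norm (g x) \<le> C' * t ^ M"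
    using box_bigoD[OF assms(2) \<open>0 < A\<close>] by blast
  have "norm (f x + g x) \<le> (C + C') * t ^ M" if "0 < t" "t < min t0 t0'" "x \<in> S A t" for t x
    using 1(2)[rule_format, of t x] 2(2)[rule_format, of t x] that norm_triangle_ineq[of "f x" "g x"] by (simp add: algebra_simps)
  then show "\<exists>C t0. 0 < t0 \<and> (\<forall>t x. 0 < t \<longrightarrow> t < t0 \<longrightarrow> x \<in> S A t \<longrightarrow> norm (f x + g x) \<le> C * t ^ M)"
    using 1(1) 2(1) by (intro exI[of _ "C + C'"] exI[of _ "min t0 t0'"]) simp
qed

lemma box_bigo_mult:
  fixes f :: "'a::real_normed_vector \<Rightarrow> 'b::real_normed_algebra"
  assumes "box_bigo S M f"
  shows "box_bigo S M (\<lambda>x. k * f x)"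
  unfolding box_bigo_def
proof (intro allI impI)
  fix A :: real assume "0 < A"
  obtain C t0 where *: "0 < t0" "\<forall>t x. 0 < t \<longrightarrow> t < t0 \<longrightarrow> x \<in> S A t \<longrightarrow> norm (f x) \<le> C * t ^ M"
    using box_bigoD[OF assms \<open>0 < A\<close>] by blast
  have "norm (k * f x) \<le> (norm k * C) * t ^ M" if "0 < t" "t < t0" "x \<in> S A t" for t x
    using mult_left_mono[OF *(2)[rule_format, OF that] norm_ge_zero[of k]] norm_mult_ineq[of k "f x"] by (simp add: mult.assoc)
  then show "\<exists>C t0. 0 < t0 \<and> (\<forall>t x. 0 < t \<longrightarrow> t < t0 \<longrightarrow> x \<in> S A t \<longrightarrow> norm (k * f x) \<le> C * t ^ M)"
    using *(1) by blast
qed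

lemma box_bigo_zero:
  assumes "box_bigo S M f" "0 < M" "0 < A" "\<And>t. 0 < t \<Longrightarrow> 0 \<in> S A t"
  shows "f 0 = 0"
proof -
  obtain C t0 where *: "0 < t0" "\<forall>t x. 0 < t \<longrightarrow> t < t0 \<longrightarrow> x \<in> S A t \<longrightarrow> norm (f x) \<le> C * t ^ M"
    using box_bigoD[OF assms(1,3)] by blast
  have "((\<lambda>t. C * t ^ M) \<longlongrightarrow> C * 0 ^ M) (at_right 0)"
    by (intro tendsto_intros)
  moreover have "eventually (\<lambda>t. norm (f 0) \<le> C * t ^ M) (at_right 0)"
    using *(2) assms(4) eventually_at_right_less[of 0] eventually_at_right_real[OF *(1)]
    by (auto elim: eventually_mono)
  ultimately have "norm (f 0) \<le> C * 0 ^ M"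
    by (rule tendsto_lowerbound) simp
  then show ?thesis using assms(2) by (simp add: power_0_left)
qed

text \<open>Comparing \<open>f\<close> with its Taylor polynomial on a segment of length \<open>t\<^sup>b\<close>
  bounds the linear coefficient: no information on higher derivatives is lost.\<close>

lemma box_bigo_deriv_along:
  assumes "C_infinity_on f (ball 0 R)" "0 < R" "boxes_shrink S" "box_direction S b v"
    and "0 < b" "b \<le> M" "box_bigo S M f"
  shows "box_bigo S (M - b) (deriv_along v f)"
  unfolding box_bigo_def
proof (intro allI impI)
  fix A :: real assume A: "0 < A"
  \<comment> \<open>The remainder of order \<open>K\<close> is O(s^K) with s \<le> t^b, and
    \<open>b * K \<ge> M\<close> because \<open>b \<ge> 1\<close>, so it disappears in the O(t^M).
    The form \<open>Suc (Suc M)\<close> fits \<open>polynomial_linear_coeff_bound\<close>.\<close>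
  define K where "K = Suc (Suc M)"
  let ?D = "(deriv_along v ^^ K) f"
  have "continuous_on (ball 0 R) ?D"
    by (intro C_infinity_on_continuous_on C_infinity_on_funpow_deriv_along assms(1))
  then have "isCont ?D 0" using assms(2) continuous_on_eq_continuous_at[of "ball 0 R" ?D] by auto
  then obtain e where e: "e > 0" "\<And>y. dist y 0 < e \<Longrightarrow> dist (?D y) (?D 0) < 1"
    unfolding continuous_at_eps_delta by (metis zero_less_one)
  define B where "B = norm (?D 0) + 1"
  have B: "norm (?D y) \<le> B" if "norm y < e" for y
    using e(2)[of y] that norm_triangle_sub[of "?D y" "?D 0"] by (simp add: B_def dist_norm)
  have B0: "B \<ge> 0" by (simp add: B_def)
  obtain c where c: "c \<ge> 0" "\<And>A t x s. 0 < A \<Longrightarrow> 0 < t \<Longrightarrow> t < 1 \<Longrightarrow> x \<in> S A t \<Longrightarrow>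
     0 \<le> s \<Longrightarrow> s \<le> t ^ b \<Longrightarrow> x + s *\<^sub>R v \<in> S (A + c) t"
    using assms(4) unfolding box_direction_def by metis
  have Ac: "0 < A + c" using A c(1) by simp
  obtain t1 where t1: "t1 > 0" "\<And>t. 0 < t \<Longrightarrow> t < t1 \<Longrightarrow> S (A + c) t \<subseteq> ball 0 (min e R)"
    using assms(2,3) e(1) Ac unfolding boxes_shrink_def by (metis min_less_iff_conj)
  obtain C t2 where t2: "0 < t2" "\<forall>t x. 0 < t \<longrightarrow> t < t2 \<longrightarrow> x \<in> S (A + c) t \<longrightarrow> norm (f x) \<le> C * t ^ M"
    using box_bigoD[OF assms(7) Ac] by blast
  obtain C' where C': "C' \<ge> 0" "\<And>(a::nat \<Rightarrow> 'b) h A. 0 \<le> h \<Longrightarrow>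
     (\<forall>s\<in>{0..h}. norm (\<Sum>l<Suc (Suc M). s ^ l *\<^sub>R a l) \<le> A) \<Longrightarrow> norm (a 1) * h \<le> C' * A"
    using polynomial_linear_coeff_bound[of M, where ?'a = 'b] by blast
  define t0 where "t0 = min 1 (min t1 t2)"
  have "norm (deriv_along v f x) \<le> (C' * (C + B)) * t ^ (M - b)"
    if t: "0 < t" "t < t0" and x: "x \<in> S A t" for t x
  proof -
    have t': "t < 1" "t < t1" "t < t2" using t by (auto simp: t0_def)
    let ?h = "t ^ b"
    have seg: "x + s *\<^sub>R v \<in> S (A + c) t" if "0 \<le> s" "s \<le> ?h" for s
      using c(2)[OF A t(1) t'(1) x that] .
    have seg': "norm (x + s *\<^sub>R v) < min e R" if "0 \<le> s" "s \<le> ?h" for s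
      using seg[OF that] t1(2)[OF t(1) t'(2)] by (auto simp: subset_iff)
    have h0: "0 \<le> ?h" using t by simp
    have "\<forall>s\<in>{0..?h}. norm (\<Sum>l<Suc (Suc M). s ^ l *\<^sub>R ((1 / fact l) *\<^sub>R (deriv_along v ^^ l) f x)) \<le> (C + B) * t ^ M"
    proof
      fix s assume s: "s \<in> {0..?h}"
      let ?P = "\<Sum>l<K. (s ^ l / fact l) *\<^sub>R (deriv_along v ^^ l) f x"
      have "norm (f (x + s *\<^sub>R v) - ?P) \<le> B * s ^ K"
        using s seg'[of s] seg'[of 0] seg' h0 B
        by (intro Taylor_along[OF convex_ball[of 0 R] assms(1)]) auto
      also have "\<dots> \<le> B * t ^ M"
      proof (intro mult_left_mono B0)
        have "s ^ K \<le> ?h ^ K" using s by (intro power_mono) auto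
        also have "\<dots> = t ^ (b * K)" by (simp add: power_mult)
        also have "\<dots> \<le> t ^ M" using t(1) t'(1) le_trans[of M "1 * K" "b * K"] mult_le_mono1[of 1 b K] assms(5)
          by (intro power_decreasing) (auto simp: K_def)
        finally show "s ^ K \<le> t ^ M" .
      qed
      finally have "norm (f (x + s *\<^sub>R v) - ?P) \<le> B * t ^ M" .
      moreover have "norm (f (x + s *\<^sub>R v)) \<le> C * t ^ M"
        using t2(2)[rule_format, OF t(1) t'(3) seg] s by auto
      ultimately have "norm (f (x + s *\<^sub>R v) - (f (x + s *\<^sub>R v) - ?P)) \<le> C * t ^ M + B * t ^ M"
        using norm_triangle_ineq4 add_mono order_trans by (metis (no_types, lifting))
      then show "norm (\<Sum>l<Suc (Suc M). s ^ l *\<^sub>R ((1 / fact l) *\<^sub>R (deriv_along v ^^ l) f x)) \<le> (C + B) * t ^ M"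
        by (simp add: K_def algebra_simps del: sum.lessThan_Suc)
    qed
    \<comment> \<open>The linear coefficient of the Taylor polynomial is the derivative sought;
      dividing by the length \<open>t ^ b\<close> of the segment loses exactly \<open>b\<close>
      powers of \<open>t\<close>.\<close>
    from C'(2)[OF h0 this] have "norm (deriv_along v f x) * t ^ b \<le> C' * ((C + B) * t ^ M)" by simp
    also have "t ^ M = t ^ (M - b) * t ^ b" using assms(6) by (simp flip: power_add)
    finally show ?thesis using t(1) by (simp add: mult_le_cancel_right_pos flip: mult.assoc)
  qed
  moreover have "0 < t0" using t1 t2 by (simp add: t0_def)
  ultimately show "\<exists>C t0. 0 < t0 \<and> (\<forall>t x. 0 < t \<longrightarrow> t < t0 \<longrightarrow> x \<in> S A t \<longrightarrow> norm (deriv_along v f x) \<le> C * t ^ (M - b))"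
    by blast
qed

text \<open>\<open>X\<close> will be the whole space or a coordinate subspace. The second case
  expresses the part of Catlin's condition that concerns the last coordinates only.\<close>

definition bigo_on :: "'a::real_normed_vector set \<Rightarrow> nat \<Rightarrow> ('a \<Rightarrow> 'b::real_normed_vector) \<Rightarrow> bool" where
  "bigo_on X s f \<longleftrightarrow> (\<exists>C e. 0 \<le> C \<and> 0 < e \<and> (\<forall>x\<in>X. norm x < e \<longrightarrow> norm (f x) \<le> C * norm x ^ s))"

lemma bigo_onI:
  assumes "0 < e" "\<And>x. x \<in> X \<Longrightarrow> norm x < e \<Longrightarrow> norm (f x) \<le> C * norm x ^ s"
  shows "bigo_on X s f"
proof -
  have "norm (f x) \<le> \<bar>C\<bar> * norm x ^ s" if "x \<in> X" "norm x < e" for x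
    using assms(2)[OF that] mult_right_mono[OF abs_ge_self[of C], of "norm x ^ s"] by simp
  then show ?thesis using assms(1) unfolding bigo_on_def by (intro exI[of _ "\<bar>C\<bar>"] exI[of _ e]) simp
qed

lemma bigo_on_mono: "bigo_on X s f \<Longrightarrow> t \<le> s \<Longrightarrow> bigo_on X t f"
proof -
  assume "bigo_on X s f" and ts: "t \<le> s"
  then obtain C e where *: "0 \<le> C" "0 < e" "\<forall>x\<in>X. norm x < e \<longrightarrow> norm (f x) \<le> C * norm x ^ s"
    unfolding bigo_on_def by blast
  have "norm (f x) \<le> C * norm x ^ t" if "x \<in> X" "norm x < min e 1" for x
  proof -
    have "norm (f x) \<le> C * norm x ^ s" using * that by simp
    also have "\<dots> \<le> C * norm x ^ t" using * that ts by (intro mult_left_mono power_decreasing) auto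
    finally show ?thesis .
  qed
  then show ?thesis using *(2) by (intro bigo_onI[of "min e 1"]) auto
qed

lemma bigo_on_sum_norm:
  assumes "finite I" "\<And>i. i \<in> I \<Longrightarrow> bigo_on X s (g i)"
  shows "bigo_on X s (\<lambda>x. \<Sum>i\<in>I. norm (g i x))"
  using assms
proof (induction I rule: finite_induct)
  case empty
  show ?case by (rule bigo_onI[of 1 _ _ 0]) auto
next
  case (insert i I)
  obtain C e where 1: "0 < e" "\<forall>x\<in>X. norm x < e \<longrightarrow> norm (g i x) \<le> C * norm x ^ s"
    using insert.prems unfolding bigo_on_def by blast
  obtain C' e' where 2: "0 < e'" "\<forall>x\<in>X. norm x < e' \<longrightarrow> norm (\<Sum>i\<in>I. norm (g i x)) \<le> C' * norm x ^ s"
    using insert.IH insert.prems unfolding bigo_on_def by blast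
  show ?case
  proof (rule bigo_onI[of "min e e'" _ _ "C + C'"])
    fix x assume "x \<in> X" "norm x < min e e'"
    then show "norm (\<Sum>i\<in>insert i I. norm (g i x)) \<le> (C + C') * norm x ^ s"
      using 1(2)[rule_format, of x] 2(2)[rule_format, of x] insert.hyps norm_triangle_ineq[of "norm (g i x)" "\<Sum>i\<in>I. norm (g i x)"]
      by (simp add: algebra_simps)
  qed (use 1 2 in auto)
qed

lemma C_infinity_on_bigo_0:
  assumes "C_infinity_on f (ball 0 R)" "0 < R"
  shows "bigo_on X 0 f"
proof -
  have "isCont f 0"
    using C_infinity_on_continuous_on[OF assms(1)] assms(2) continuous_on_eq_continuous_at[of "ball 0 R" f] by auto
  then obtain e where e: "e > 0" "\<And>y. dist y 0 < e \<Longrightarrow> dist (f y) (f 0) < 1"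
    unfolding continuous_at_eps_delta by (metis zero_less_one)
  have "norm (f y) \<le> (norm (f 0) + 1) * norm y ^ 0" if "norm y < e" for y
    using e(2)[of y] that norm_triangle_sub[of "f y" "f 0"] by (simp add: dist_norm)
  then show ?thesis using e(1) by (intro bigo_onI[of e])
qed

text \<open>On the ray from 0 to \<open>w\<close>, which stays in the cone \<open>X\<close>, the
  derivative of \<open>f\<close> along \<open>w\<close> is of size |w| times O(|x|^s); integrating
  it gains one power. The functions \<open>g i\<close> stand for the derivatives of \<open>f\<close>
  in those directions that matter on \<open>X\<close>.\<close>

lemma bigo_on_Suc:
  assumes "C_infinity_on f (ball 0 R)" "0 < R" "f 0 = 0" "finite I"
    and "\<And>x t. x \<in> X \<Longrightarrow> 0 \<le> t \<Longrightarrow> t *\<^sub>R x \<in> X"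
    and "\<And>i. i \<in> I \<Longrightarrow> bigo_on X s (g i)"
    and "\<And>w x. w \<in> X \<Longrightarrow> x \<in> X \<Longrightarrow> norm x < R \<Longrightarrow> norm (deriv_along w f x) \<le> norm w * (\<Sum>i\<in>I. norm (g i x))"
  shows "bigo_on X (Suc s) f"
proof -
  obtain C e where *: "0 \<le> C" "0 < e" "\<forall>x\<in>X. norm x < e \<longrightarrow> norm (\<Sum>i\<in>I. norm (g i x)) \<le> C * norm x ^ s"
    using bigo_on_sum_norm[of I X s g, OF assms(4,6)] unfolding bigo_on_def by blast
  show ?thesis
  proof (rule bigo_onI[of "min e R" _ _ C])
    fix w assume w: "w \<in> X" "norm w < min e R"
    have "norm (f (0 + 1 *\<^sub>R w) - f (0 + 0 *\<^sub>R w) - 1 *\<^sub>R 0) \<le> (C * norm w ^ Suc s) * 1"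
    proof (rule vector_derivative_linear_bound[of 1 "\<lambda>\<sigma>. f (0 + \<sigma> *\<^sub>R w)" "\<lambda>\<sigma>. deriv_along w f (0 + \<sigma> *\<^sub>R w)"])
      fix \<sigma> :: real assume \<sigma>: "\<sigma> \<in> {0..1}"
      have le: "norm (\<sigma> *\<^sub>R w) \<le> norm w" using \<sigma> by (simp add: mult_left_le_one_le)
      have X: "\<sigma> *\<^sub>R w \<in> X" using assms(5) w(1) \<sigma> by auto
      show "((\<lambda>\<sigma>. f (0 + \<sigma> *\<^sub>R w)) has_vector_derivative deriv_along w f (0 + \<sigma> *\<^sub>R w)) (at \<sigma>)"
        using le w by (intro has_vector_derivative_along[OF assms(1)]) auto
      have "norm (deriv_along w f (\<sigma> *\<^sub>R w)) \<le> norm w * (\<Sum>i\<in>I. norm (g i (\<sigma> *\<^sub>R w)))"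
        using assms(7) w X le by auto
      also have "\<dots> \<le> norm w * (C * norm (\<sigma> *\<^sub>R w) ^ s)"
        using *(3)[rule_format, OF X] le w by (intro mult_left_mono) (auto simp: abs_le_iff)
      also have "\<dots> \<le> norm w * (C * norm w ^ s)"
        using le *(1) by (intro mult_left_mono power_mono) auto
      finally show "norm (deriv_along w f (0 + \<sigma> *\<^sub>R w) - 0) \<le> C * norm w ^ Suc s"
        by (simp add: mult.left_commute)
    qed auto
    then show "norm (f w) \<le> C * norm w ^ Suc s" using assms(3) by simp
  qed (use * assms in auto)
qed

subsection \<open>Vanishing order\<close>

definition norm_box :: "nat \<Rightarrow> real \<Rightarrow> real \<Rightarrow> 'a::real_normed_vector set" where
  "norm_box b A t = {x. norm x \<le> A * t ^ b}"

lemma boxes_shrink_norm_box: "0 < b \<Longrightarrow> boxes_shrink (norm_box b)"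
  unfolding boxes_shrink_def
proof (intro allI impI)
  fix A e :: real assume b: "0 < b" and A: "0 < A" and e: "0 < e"
  have "A * t ^ b < e" if "0 < t" "t < min 1 (e / A)" for t
  proof -
    have "A * t ^ b \<le> A * t ^ 1" using b A that by (intro mult_left_mono power_decreasing) auto
    also have "\<dots> < e" using that A by (simp add: field_simps)
    finally show ?thesis .
  qed
  then show "\<exists>t0>0. \<forall>t. 0 < t \<longrightarrow> t < t0 \<longrightarrow> norm_box b A t \<subseteq> ball 0 e"
    using A e unfolding norm_box_def by (intro exI[of _ "min 1 (e/A)"]) (force simp: divide_pos_pos)
qed

lemma box_direction_norm_box:
  fixes v :: "'a::real_normed_vector"
  shows "box_direction (norm_box b) b v"
  unfolding box_direction_def
proof (intro exI[of _ "norm v"] conjI allI impI)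
  fix A t s :: real and x :: 'a assume *: "0 < A" "0 < t" "t < 1" "x \<in> norm_box b A t" "0 \<le> s" "s \<le> t ^ b"
  have "norm (x + s *\<^sub>R v) \<le> norm x + s * norm v" using norm_triangle_ineq[of x "s *\<^sub>R v"] * by simp
  also have "\<dots> \<le> A * t ^ b + t ^ b * norm v"
    using * by (intro add_mono mult_right_mono) (auto simp: norm_box_def)
  finally show "x + s *\<^sub>R v \<in> norm_box b (A + norm v) t" by (simp add: norm_box_def algebra_simps)
qed auto

lemma C_infinity_on_iterated_derivative:
  "C_infinity_on f S \<Longrightarrow> C_infinity_on (iterated_derivative f vs) S"
  by (induction vs) (use C_infinity_on_deriv_along in \<open>auto simp: deriv_along_def\<close>)

text \<open>The exponent \<open>b\<close> is kept general because for the Taylor coefficient of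
  index \<open>d\<close> of a curve the available bounds live on discs of radius about t^d.\<close>

lemma box_bigo_iterated_derivative:
  assumes "C_infinity_on f (ball 0 R)" "0 < R" "0 < b" "box_bigo (norm_box b) M f" "b * length vs \<le> M"
  shows "box_bigo (norm_box b) (M - b * length vs) (iterated_derivative f vs)"
  using assms(5)
proof (induction vs)
  case Nil
  then show ?case using assms(4) by simp
next
  case (Cons v vs)
  have "box_bigo (norm_box b) (M - b * length vs - b) (deriv_along v (iterated_derivative f vs))"
    using Cons by (intro box_bigo_deriv_along[OF C_infinity_on_iterated_derivative[OF assms(1)] assms(2)
      boxes_shrink_norm_box[OF assms(3)] box_direction_norm_box assms(3)]) auto
  then show ?case by (simp add: deriv_along_def add.commute)
qed

lemma box_bigo_iterated_derivative_zero:
  assumes "C_infinity_on f (ball 0 R)" "0 < R" "0 < b" "box_bigo (norm_box b) M f" "b * length vs < M"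
  shows "iterated_derivative f vs 0 = 0"
  using assms(5)
  by (intro box_bigo_zero[OF box_bigo_iterated_derivative[OF assms(1-4)], of vs 1]) (auto simp: norm_box_def)

text \<open>The recursion of \<open>iterated_derivative\<close> peels off the derivative taken last,
  whereas an induction that replaces \<open>f\<close> by one of its derivatives needs the one taken
  first.\<close>

lemma iterated_derivative_snoc: "iterated_derivative f (vs @ [v]) = iterated_derivative (deriv_along v f) vs"
  by (induction vs) (auto simp: deriv_along_def)

lemma linear_norm_le_Basis:
  fixes A :: "'a::euclidean_space \<Rightarrow> 'b::real_normed_vector"
  assumes "linear A"
  shows "norm (A w) \<le> norm w * (\<Sum>b\<in>Basis. norm (A b))"
proof -
  have "A w = (\<Sum>b\<in>Basis. (w \<bullet> b) *\<^sub>R A b)"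
    using linear_sum[OF assms, of "\<lambda>b. (w \<bullet> b) *\<^sub>R b" Basis] linear_scale[OF assms] by (simp add: euclidean_representation)
  also have "norm \<dots> \<le> (\<Sum>b\<in>Basis. norm w * norm (A b))"
    by (rule sum_norm_le) (auto intro!: mult_right_mono simp: Basis_le_norm)
  finally show ?thesis by (simp add: sum_distrib_left)
qed

lemma bigo_on_if_iterated_derivative_zero:
  fixes f :: "'a::euclidean_space \<Rightarrow> 'b::real_normed_vector"
  assumes "C_infinity_on f (ball 0 R)" "0 < R" "\<And>vs. length vs < s \<Longrightarrow> iterated_derivative f vs 0 = 0"
  shows "bigo_on UNIV s f"
  using assms(1,3)
proof (induction s arbitrary: f)
  case 0
  then show ?case using C_infinity_on_bigo_0 assms(2) by blast
next
  case (Suc s)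
  have g: "bigo_on UNIV s (deriv_along b f)" if "b \<in> Basis" for b
  proof (rule Suc.IH)
    show "iterated_derivative (deriv_along b f) vs 0 = 0" if "length vs < s" for vs
      using Suc.prems(2)[of "vs @ [b]"] that by (simp add: iterated_derivative_snoc)
  qed (rule C_infinity_on_deriv_along[OF Suc.prems(1)])
  show ?case
  proof (rule bigo_on_Suc[OF Suc.prems(1) assms(2) _ finite_Basis _ g])
    show "f 0 = 0" using Suc.prems(2)[of "[]"] by simp
  next
    fix w x :: 'a assume x: "norm x < R"
    have "linear (\<lambda>v. deriv_along v f x)"
      using C_infinity_on_has_derivative[OF Suc.prems(1), of x] x has_derivative_linear by auto
    then show "norm (deriv_along w f x) \<le> norm w * (\<Sum>b\<in>Basis. norm (deriv_along b f x))"
      by (rule linear_norm_le_Basis)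
  qed auto
qed

lemma box_bigo_norm_box_if_bigo_on:
  assumes "bigo_on UNIV s f" "0 < b"
  shows "box_bigo (norm_box b) (b * s) f"
  unfolding box_bigo_def
proof (intro allI impI)
  fix A :: real assume A: "0 < A"
  obtain C e where *: "0 \<le> C" "0 < e" "\<forall>x. norm x < e \<longrightarrow> norm (f x) \<le> C * norm x ^ s"
    using assms(1) unfolding bigo_on_def by blast
  obtain t0 where t0: "t0 > 0" "\<forall>t. 0 < t \<longrightarrow> t < t0 \<longrightarrow> norm_box b A t \<subseteq> ball (0::'a) e"
    using boxes_shrink_norm_box[OF assms(2), where 'a = 'a] A *(2) unfolding boxes_shrink_def by blast
  have "norm (f x) \<le> C * A ^ s * t ^ (b * s)" if "0 < t" "t < t0" "x \<in> norm_box b A t" for t x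
  proof -
    have "norm (f x) \<le> C * norm x ^ s" using *(3) t0(2) that by (auto simp: subset_iff)
    also have "\<dots> \<le> C * (A * t ^ b) ^ s"
      using that *(1) by (intro mult_left_mono power_mono) (auto simp: norm_box_def)
    finally show ?thesis by (simp add: power_mult_distrib power_mult)
  qed
  then show "\<exists>C t0. 0 < t0 \<and> (\<forall>t x. 0 < t \<longrightarrow> t < t0 \<longrightarrow> x \<in> norm_box b A t \<longrightarrow> norm (f x) \<le> C * t ^ (b * s))"
    using t0(1) by blast
qed

text \<open>From right to left by integration along rays, from left to right by differentiating the
  bound on balls of radius proportional to t.\<close>

lemma bigo_on_iff_iterated_derivative:
  fixes f :: "'a::euclidean_space \<Rightarrow> 'b::real_normed_vector"
  assumes "C_infinity_on f (ball 0 R)" "0 < R"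
  shows "bigo_on UNIV s f \<longleftrightarrow> (\<forall>vs. length vs < s \<longrightarrow> iterated_derivative f vs 0 = 0)"
  using bigo_on_if_iterated_derivative_zero[OF assms]
    box_bigo_iterated_derivative_zero[OF assms _ box_bigo_norm_box_if_bigo_on[where b = 1], of s]
  by auto

text \<open>Lower bounds for the order are tested at each natural number separately, so infinite
  order needs no case of its own.\<close>

lemma le_vanishing_order_iff:
  fixes f :: "'a::euclidean_space \<Rightarrow> 'b::real_normed_vector"
  assumes "C_infinity_on f (ball 0 R)" "0 < R"
  shows "ereal (real s) \<le> vanishing_order f 0 \<longleftrightarrow> bigo_on UNIV s f"
  unfolding bigo_on_iff_iterated_derivative[OF assms] vanishing_order_def le_Inf_iff
  by (auto simp: not_less[symmetric])

lemma vanishing_order_eq: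
  fixes f :: "'a::euclidean_space \<Rightarrow> 'b::real_normed_vector"
  assumes "C_infinity_on f (ball 0 R)" "0 < R" "bigo_on UNIV s f" "\<not> bigo_on UNIV (Suc s) f"
  shows "vanishing_order f 0 = ereal (real s)"
proof -
  have 1: "ereal (real s) \<le> vanishing_order f 0" using le_vanishing_order_iff[OF assms(1,2)] assms(3) by simp
  obtain vs where vs: "length vs < Suc s" "iterated_derivative f vs 0 \<noteq> 0"
    using assms(4) bigo_on_iff_iterated_derivative[OF assms(1,2)] by auto
  then have "vanishing_order f 0 \<le> ereal (real (length vs))"
    unfolding vanishing_order_def by (intro Inf_lower) auto
  also have "\<dots> \<le> ereal (real s)" using vs(1) by simp
  finally show ?thesis using 1 by (rule antisym)
qed

subsection \<open>Wirtinger derivatives\<close>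

lemma deriv_along_add_fun:
  assumes "C_infinity_on f S" "C_infinity_on g S" "x \<in> S"
  shows "deriv_along v (\<lambda>x. f x + g x) x = deriv_along v f x + deriv_along v g x"
  using deriv_along_eq[OF has_derivative_add[OF C_infinity_on_has_derivative[OF assms(1,3)] C_infinity_on_has_derivative[OF assms(2,3)]]] .

lemma deriv_along_bounded_linear:
  assumes "bounded_linear L" "C_infinity_on f S" "x \<in> S"
  shows "deriv_along v (\<lambda>x. L (f x)) x = L (deriv_along v f x)"
  using deriv_along_eq[OF bounded_linear.has_derivative[OF assms(1) C_infinity_on_has_derivative[OF assms(2,3)]]] .

lemma wirtinger_conv_deriv_along:
  "wirtinger j f = (\<lambda>x. (1/2) * (deriv_along (axis j 1) f x + (- \<i>) * deriv_along (axis j \<i>) f x))"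
  "wirtinger_bar j f = (\<lambda>x. (1/2) * (deriv_along (axis j 1) f x + \<i> * deriv_along (axis j \<i>) f x))"
  by (auto simp: wirtinger_def wirtinger_bar_def deriv_along_def fun_eq_iff)

text \<open>Both Wirtinger operators have this form, with \<open>c\<close> equal to
  \<open>- \<i>\<close> or \<open>\<i>\<close>; smoothness, locality and commutation are thus proved
  for both at once.\<close>

definition dbl_deriv :: "complex \<Rightarrow> 'a::real_normed_vector \<Rightarrow> 'a \<Rightarrow> ('a \<Rightarrow> complex) \<Rightarrow> 'a \<Rightarrow> complex" where
  "dbl_deriv c u v f = (\<lambda>x. (1/2) * (deriv_along u f x + c * deriv_along v f x))"

lemma wirtinger_conv_dbl_deriv:
  "wirtinger j = dbl_deriv (- \<i>) (axis j 1) (axis j \<i>)"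
  "wirtinger_bar j = dbl_deriv \<i> (axis j 1) (axis j \<i>)"
  by (simp_all add: fun_eq_iff dbl_deriv_def wirtinger_conv_deriv_along)

lemma C_infinity_on_dbl_deriv:
  assumes "open S" "C_infinity_on f S"
  shows "C_infinity_on (dbl_deriv c u v f) S"
  unfolding dbl_deriv_def
  by (intro C_infinity_on_bounded_linear[OF assms(1) bounded_linear_mult_right]
      C_infinity_on_add[OF assms(1)] C_infinity_on_deriv_along assms(2))

lemma deriv_along_dbl_deriv:
  assumes "open S" "C_infinity_on f S" "x \<in> S"
  shows "deriv_along w (dbl_deriv c u v f) x = dbl_deriv c u v (deriv_along w f) x"
proof -
  note C = C_infinity_on_deriv_along[OF assms(2)]
  have C2: "C_infinity_on (\<lambda>x. c * deriv_along v f x) S"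
    by (intro C_infinity_on_bounded_linear[OF assms(1) bounded_linear_mult_right] C)
  have "deriv_along w (dbl_deriv c u v f) x
      = (1/2) * (deriv_along w (deriv_along u f) x + c * deriv_along w (deriv_along v f) x)"
    unfolding dbl_deriv_def
      deriv_along_bounded_linear[OF bounded_linear_mult_right C_infinity_on_add[OF assms(1) C C2] assms(3)]
      deriv_along_add_fun[OF C C2 assms(3)]
      deriv_along_bounded_linear[OF bounded_linear_mult_right C assms(3)] by (rule refl)
  then show ?thesis
    by (simp add: dbl_deriv_def deriv_along_commute[OF assms(2,1,3), of w])
qed

lemma dbl_deriv_commute:
  assumes "open S" "C_infinity_on f S" "x \<in> S"
  shows "dbl_deriv c u v (dbl_deriv c' u' v' f) x = dbl_deriv c' u' v' (dbl_deriv c u v f) x"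
proof -
  have "dbl_deriv c u v (dbl_deriv c' u' v' f) x
      = (1/2) * (dbl_deriv c' u' v' (deriv_along u f) x + c * dbl_deriv c' u' v' (deriv_along v f) x)"
    unfolding dbl_deriv_def[of c u v] deriv_along_dbl_deriv[OF assms] ..
  also have "\<dots> = (1/2) * (dbl_deriv c u v (deriv_along u' f) x + c' * dbl_deriv c u v (deriv_along v' f) x)"
    by (simp add: dbl_deriv_def algebra_simps deriv_along_commute[OF assms(2,1,3), of u'] deriv_along_commute[OF assms(2,1,3), of v'])
  also have "\<dots> = dbl_deriv c' u' v' (dbl_deriv c u v f) x"
    unfolding dbl_deriv_def[of c' u' v'] deriv_along_dbl_deriv[OF assms] ..
  finally show ?thesis .
qed

text \<open>The second conjunct is locality: identities between derivatives hold on \<open>S\<close>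
  only, and locality allows an operator to be applied to both sides of them.\<close>

definition smooth_operator :: "'a::real_normed_vector set \<Rightarrow> (('a \<Rightarrow> complex) \<Rightarrow> 'a \<Rightarrow> complex) \<Rightarrow> bool" where
  "smooth_operator S T \<longleftrightarrow> (\<forall>f. C_infinity_on f S \<longrightarrow> C_infinity_on (T f) S) \<and>
     (\<forall>f g. C_infinity_on f S \<longrightarrow> (\<forall>x\<in>S. f x = g x) \<longrightarrow> (\<forall>x\<in>S. T f x = T g x))"

lemma smooth_operatorD:
  assumes "smooth_operator S T" "C_infinity_on f S"
  shows "C_infinity_on (T f) S" "\<lbrakk>\<And>x. x \<in> S \<Longrightarrow> f x = g x; x \<in> S\<rbrakk> \<Longrightarrow> T f x = T g x"
  using assms unfolding smooth_operator_def by blast+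

definition commute_on ::
    "'a::real_normed_vector set \<Rightarrow> (('a \<Rightarrow> complex) \<Rightarrow> 'a \<Rightarrow> complex) \<Rightarrow> (('a \<Rightarrow> complex) \<Rightarrow> 'a \<Rightarrow> complex) \<Rightarrow> bool" where
  "commute_on S T U \<longleftrightarrow> (\<forall>f. C_infinity_on f S \<longrightarrow> (\<forall>x\<in>S. T (U f) x = U (T f) x))"

lemma smooth_operator_dbl_deriv:
  assumes "open S"
  shows "smooth_operator S (dbl_deriv c u v)"
  unfolding smooth_operator_def
proof (intro conjI allI impI ballI)
  fix f g :: "'a \<Rightarrow> complex" and x assume "C_infinity_on f S" "\<forall>x\<in>S. f x = g x" "x \<in> S"
  then show "dbl_deriv c u v f x = dbl_deriv c u v g x"
    using deriv_along_cong[OF assms, of f g x] by (simp add: dbl_deriv_def)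
qed (rule C_infinity_on_dbl_deriv[OF assms])

lemma commute_on_dbl_deriv: "open S \<Longrightarrow> commute_on S (dbl_deriv c u v) (dbl_deriv c' u' v')"
  unfolding commute_on_def using dbl_deriv_commute by blast

lemma smooth_operator_funpow: "smooth_operator S T \<Longrightarrow> smooth_operator S (T ^^ k)"
proof (induction k)
  case (Suc k)
  then have T: "smooth_operator S T" and Tk: "smooth_operator S (T ^^ k)" by auto
  show ?case unfolding smooth_operator_def
  proof (intro conjI allI impI)
    show "C_infinity_on ((T ^^ Suc k) f) S" if "C_infinity_on f S" for f
      using T Tk that by (simp add: smooth_operator_def)
    show "\<forall>x\<in>S. (T ^^ Suc k) f x = (T ^^ Suc k) g x" if "C_infinity_on f S" "\<forall>x\<in>S. f x = g x" for f g
    proof -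
      have "\<forall>x\<in>S. (T ^^ k) f x = (T ^^ k) g x" "C_infinity_on ((T ^^ k) f) S"
        using Tk that by (auto simp: smooth_operator_def)
      then show ?thesis using T unfolding smooth_operator_def funpow.simps o_apply by blast
    qed
  qed
qed (simp add: smooth_operator_def)

lemma smooth_operator_foldr:
  "(\<And>j. j \<in> set js \<Longrightarrow> smooth_operator S (T j)) \<Longrightarrow> smooth_operator S (foldr T js)"
proof (induction js)
  case (Cons j js)
  then have T: "smooth_operator S (T j)" and Tk: "smooth_operator S (foldr T js)" by auto
  show ?case unfolding smooth_operator_def
  proof (intro conjI allI impI)
    show "C_infinity_on (foldr T (j # js) f) S" if "C_infinity_on f S" for f
      using T Tk that by (simp add: smooth_operator_def)
    show "\<forall>x\<in>S. foldr T (j # js) f x = foldr T (j # js) g x" if "C_infinity_on f S" "\<forall>x\<in>S. f x = g x" for f g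
    proof -
      have "\<forall>x\<in>S. foldr T js f x = foldr T js g x" "C_infinity_on (foldr T js f) S"
        using Tk that by (auto simp: smooth_operator_def)
      then show ?thesis using T unfolding smooth_operator_def foldr.simps o_apply by blast
    qed
  qed
qed (simp add: smooth_operator_def)

lemma commute_on_funpow:
  assumes "smooth_operator S T" "smooth_operator S U" "commute_on S T U"
  shows "commute_on S T (U ^^ k)"
proof (induction k)
  case (Suc k)
  show ?case unfolding commute_on_def
  proof (intro allI impI)
    fix f :: "'a \<Rightarrow> complex" assume f: "C_infinity_on f S"
    have Uk: "C_infinity_on ((U ^^ k) f) S" "C_infinity_on (T ((U ^^ k) f)) S"
      using smooth_operator_funpow[OF assms(2), of k] assms(1) f by (auto simp: smooth_operator_def)
    have 1: "\<forall>x\<in>S. T ((U ^^ k) f) x = (U ^^ k) (T f) x" using Suc f by (auto simp: commute_on_def)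
    have "\<forall>x\<in>S. T (U ((U ^^ k) f)) x = U (T ((U ^^ k) f)) x"
      using assms(3) Uk by (auto simp: commute_on_def)
    moreover have "\<forall>x\<in>S. U (T ((U ^^ k) f)) x = U ((U ^^ k) (T f)) x"
      using assms(2) Uk 1 unfolding smooth_operator_def by blast
    ultimately show "\<forall>x\<in>S. T ((U ^^ Suc k) f) x = (U ^^ Suc k) (T f) x" by simp
  qed
qed (simp add: commute_on_def)

lemma commute_on_foldr:
  assumes "smooth_operator S T" "\<And>j. j \<in> set js \<Longrightarrow> smooth_operator S (U j)"
    and "\<And>j. j \<in> set js \<Longrightarrow> commute_on S T (U j)"
  shows "commute_on S T (foldr U js)"
  using assms(2,3)
proof (induction js)
  case (Cons j js)
  show ?case unfolding commute_on_def
  proof (intro allI impI)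
    fix f :: "'a \<Rightarrow> complex" assume f: "C_infinity_on f S"
    have sm: "smooth_operator S (foldr U js)" using Cons.prems by (intro smooth_operator_foldr) auto
    have Uk: "C_infinity_on (foldr U js f) S" "C_infinity_on (T (foldr U js f)) S"
      using sm assms(1) f by (auto simp: smooth_operator_def)
    have 1: "\<forall>x\<in>S. T (foldr U js f) x = foldr U js (T f) x" using Cons f by (auto simp: commute_on_def)
    have "\<forall>x\<in>S. T (U j (foldr U js f)) x = U j (T (foldr U js f)) x"
      using Cons.prems Uk by (auto simp: commute_on_def)
    moreover have "\<forall>x\<in>S. U j (T (foldr U js f)) x = U j (foldr U js (T f)) x"
      using Cons.prems(1)[of j] Uk 1 unfolding smooth_operator_def by (metis list.set_intros(1))
    ultimately show "\<forall>x\<in>S. T (foldr U (j # js) f) x = foldr U (j # js) (T f) x" by simp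
  qed
qed (simp add: commute_on_def)

text \<open>The extra factor \<open>T j\<close> arises at the place of \<open>j\<close> in the fold
  and commutes outwards past the operators in front of it.\<close>

lemma foldr_funpow_update:
  assumes "\<And>j. smooth_operator S (T j)" "\<And>i j. commute_on S (T i) (T j)"
    and "distinct js" "j \<in> set js" "C_infinity_on f S" "x \<in> S"
  shows "foldr (\<lambda>i. T i ^^ (\<alpha>(j := Suc (\<alpha> j))) i) js f x = T j (foldr (\<lambda>i. T i ^^ \<alpha> i) js f) x"
  using assms(3-6)
proof (induction js arbitrary: x)
  case (Cons i js)
  let ?F = "\<lambda>js f. foldr (\<lambda>i. T i ^^ \<alpha> i) js f" and ?G = "\<lambda>js f. foldr (\<lambda>i. T i ^^ (\<alpha>(j := Suc (\<alpha> j))) i) js f"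
  have smF: "smooth_operator S (\<lambda>f. ?F js f)"
    by (intro smooth_operator_foldr smooth_operator_funpow assms(1))
  have smG: "smooth_operator S (\<lambda>f. ?G js f)"
    by (intro smooth_operator_foldr smooth_operator_funpow assms(1))
  have C: "C_infinity_on (?F js f) S" "C_infinity_on (?G js f) S"
    using smF smG Cons.prems(3) by (auto simp: smooth_operator_def)
  show ?case
  proof (cases "i = j")
    case True
    have "?G js f = ?F js f" using True Cons.prems(1) by (intro foldr_cong) auto
    then have "?G (i # js) f x = (T j ^^ Suc (\<alpha> j)) (?F js f) x" using True by simp
    then show ?thesis using True by simp
  next
    case False
    have eq: "\<forall>y\<in>S. ?G js f y = T j (?F js f) y"
      using Cons False by auto
    have "?G (i # js) f x = (T i ^^ \<alpha> i) (?G js f) x" using False by simp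
    also have "\<dots> = (T i ^^ \<alpha> i) (T j (?F js f)) x"
      using smooth_operator_funpow[OF assms(1)[of i], of "\<alpha> i"] C eq Cons.prems(4) unfolding smooth_operator_def by blast
    also have "\<dots> = T j ((T i ^^ \<alpha> i) (?F js f)) x"
      using commute_on_funpow[OF assms(1)[of j] assms(1)[of i] assms(2)[of j i], of "\<alpha> i"] C Cons.prems(4)
      by (simp add: commute_on_def)
    finally show ?thesis by simp
  qed
qed simp

section \<open>Wirtinger derivatives with multi-indices\<close>

context
  fixes S :: "(complex ^ 'n::{finite,linorder}) set"
  assumes S: "open S"
begin

lemma smooth_operator_wirtinger: "smooth_operator S (wirtinger j)" "smooth_operator S (wirtinger_bar j)"
  unfolding wirtinger_conv_dbl_deriv by (rule smooth_operator_dbl_deriv[OF S])+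

lemma commute_on_wirtinger:
  "commute_on S (wirtinger i) (wirtinger j)" "commute_on S (wirtinger i) (wirtinger_bar j)"
  "commute_on S (wirtinger_bar i) (wirtinger j)" "commute_on S (wirtinger_bar i) (wirtinger_bar j)"
  unfolding wirtinger_conv_dbl_deriv by (rule commute_on_dbl_deriv[OF S])+

lemma smooth_operator_wirtinger_multi:
  "smooth_operator S (wirtinger_multi \<alpha>)" "smooth_operator S (wirtinger_bar_multi \<alpha>)"
  using smooth_operator_foldr[of "sorted_list_of_set UNIV" S "\<lambda>j. wirtinger j ^^ \<alpha> j"]
    smooth_operator_foldr[of "sorted_list_of_set UNIV" S "\<lambda>j. wirtinger_bar j ^^ \<alpha> j"]
    smooth_operator_funpow smooth_operator_wirtinger
  unfolding wirtinger_multi_def[abs_def] wirtinger_bar_multi_def[abs_def] by blast+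

lemma commute_on_wirtinger_multi:
  "commute_on S (wirtinger j) (wirtinger_multi \<alpha>)" "commute_on S (wirtinger j) (wirtinger_bar_multi \<alpha>)"
  "commute_on S (wirtinger_bar j) (wirtinger_bar_multi \<alpha>)"
  unfolding wirtinger_multi_def[abs_def] wirtinger_bar_multi_def[abs_def]
  by (intro commute_on_foldr[of _ _ _ "\<lambda>j. wirtinger j ^^ \<alpha> j"] commute_on_foldr[of _ _ _ "\<lambda>j. wirtinger_bar j ^^ \<alpha> j"]
      commute_on_funpow smooth_operator_funpow smooth_operator_wirtinger commute_on_wirtinger)+

lemma wirtinger_multi_wirtinger:
  assumes "C_infinity_on f S" "x \<in> S"
  shows "wirtinger_multi \<alpha> (wirtinger j f) x = wirtinger_multi (\<alpha>(j := Suc (\<alpha> j))) f x"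
proof -
  have "wirtinger j (wirtinger_multi \<alpha> f) x = wirtinger_multi \<alpha> (wirtinger j f) x"
    using commute_on_wirtinger_multi(1) assms unfolding commute_on_def by metis
  moreover have "wirtinger_multi (\<alpha>(j := Suc (\<alpha> j))) f x = wirtinger j (wirtinger_multi \<alpha> f) x"
    unfolding wirtinger_multi_def
    by (rule foldr_funpow_update[OF smooth_operator_wirtinger(1) commute_on_wirtinger(1) _ _ assms]) auto
  ultimately show ?thesis by simp
qed

lemma wirtinger_bar_multi_wirtinger_bar:
  assumes "C_infinity_on f S" "x \<in> S"
  shows "wirtinger_bar_multi \<alpha> (wirtinger_bar j f) x = wirtinger_bar_multi (\<alpha>(j := Suc (\<alpha> j))) f x"
proof -
  have "wirtinger_bar j (wirtinger_bar_multi \<alpha> f) x = wirtinger_bar_multi \<alpha> (wirtinger_bar j f) x"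
    using commute_on_wirtinger_multi(3) assms unfolding commute_on_def by metis
  moreover have "wirtinger_bar_multi (\<alpha>(j := Suc (\<alpha> j))) f x = wirtinger_bar j (wirtinger_bar_multi \<alpha> f) x"
    unfolding wirtinger_bar_multi_def
    by (rule foldr_funpow_update[OF smooth_operator_wirtinger(2) commute_on_wirtinger(4) _ _ assms]) auto
  ultimately show ?thesis by simp
qed

lemma wirtinger_bar_multi_wirtinger:
  assumes "C_infinity_on f S" "x \<in> S"
  shows "wirtinger_bar_multi \<alpha> (wirtinger j f) x = wirtinger j (wirtinger_bar_multi \<alpha> f) x"
  using commute_on_wirtinger_multi(2) assms unfolding commute_on_def by metis

text \<open>An induction on the order replaces \<open>f\<close> by a Wirtinger derivative of
  \<open>f\<close>, while a multi-index operator keeps its factors in a fixed order. Commutation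
  lets the new innermost derivative be counted in \<open>\<alpha>\<close> or
  \<open>\<beta>\<close>.\<close>

lemma wirtinger_multi_bar_multi_step:
  assumes "C_infinity_on f S" "x \<in> S"
  shows "wirtinger_multi \<alpha> (wirtinger_bar_multi \<beta> (wirtinger j f)) x
      = wirtinger_multi (\<alpha>(j := Suc (\<alpha> j))) (wirtinger_bar_multi \<beta> f) x"
    and "wirtinger_multi \<alpha> (wirtinger_bar_multi \<beta> (wirtinger_bar j f)) x
      = wirtinger_multi \<alpha> (wirtinger_bar_multi (\<beta>(j := Suc (\<beta> j))) f) x"
proof -
  note sm = smooth_operator_wirtinger smooth_operator_wirtinger_multi
  have C: "C_infinity_on (wirtinger_bar_multi \<beta> f) S" "C_infinity_on (wirtinger_bar_multi \<beta> (wirtinger j f)) S"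
    "C_infinity_on (wirtinger_bar_multi \<beta> (wirtinger_bar j f)) S"
    by (intro smooth_operatorD(1)[OF sm(4)] smooth_operatorD(1)[OF sm(1)] smooth_operatorD(1)[OF sm(2)] assms(1))+
  have "wirtinger_multi \<alpha> (wirtinger_bar_multi \<beta> (wirtinger j f)) x = wirtinger_multi \<alpha> (wirtinger j (wirtinger_bar_multi \<beta> f)) x"
    by (rule smooth_operatorD(2)[OF sm(3) C(2) wirtinger_bar_multi_wirtinger[OF assms(1)] assms(2)])
  also have "\<dots> = wirtinger_multi (\<alpha>(j := Suc (\<alpha> j))) (wirtinger_bar_multi \<beta> f) x"
    by (rule wirtinger_multi_wirtinger[OF C(1) assms(2)])
  finally show "wirtinger_multi \<alpha> (wirtinger_bar_multi \<beta> (wirtinger j f)) x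
      = wirtinger_multi (\<alpha>(j := Suc (\<alpha> j))) (wirtinger_bar_multi \<beta> f) x" .
  show "wirtinger_multi \<alpha> (wirtinger_bar_multi \<beta> (wirtinger_bar j f)) x
      = wirtinger_multi \<alpha> (wirtinger_bar_multi (\<beta>(j := Suc (\<beta> j))) f) x"
    by (rule smooth_operatorD(2)[OF sm(3) C(3) wirtinger_bar_multi_wirtinger_bar[OF assms(1)] assms(2)])
qed

end

lemma complex_vector_expansion:
  "w = (\<Sum>j\<in>UNIV. Re (w $ j) *\<^sub>R axis j 1 + Im (w $ j) *\<^sub>R axis j \<i> :: complex ^ 'n)"
proof (subst vec_eq_iff, rule allI)
  fix i
  have "(\<Sum>j\<in>UNIV. Re (w $ j) *\<^sub>R axis j 1 + Im (w $ j) *\<^sub>R axis j \<i> :: complex ^ 'n) $ i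
    = (\<Sum>j\<in>UNIV. if j = i then w $ j else 0)"
    unfolding sum_component
    by (rule sum.cong) (auto simp: axis_def complex_eq_iff)
  then show "w $ i = (\<Sum>j\<in>UNIV. Re (w $ j) *\<^sub>R axis j 1 + Im (w $ j) *\<^sub>R axis j \<i>) $ i" by simp
qed

text \<open>For \<open>w\<close> in the coordinate subspace, the derivative of \<open>f\<close>
  along \<open>w\<close> is the sum over \<open>j\<close> in \<open>J\<close> of
  \<open>w $ j * wirtinger j f x + cnj (w $ j) * wirtinger_bar j f x\<close>. Hence only
  multi-indices supported in \<open>J\<close> are met when the induction on \<open>s\<close>
  integrates along rays inside the subspace.\<close>

lemma bigo_on_if_wirtinger_zero:
  fixes f :: "complex ^ 'n::{finite,linorder} \<Rightarrow> complex"
  assumes "C_infinity_on f (ball 0 R)" "0 < R"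
    and "\<And>\<alpha> \<beta>. (\<forall>j. j \<notin> J \<longrightarrow> \<alpha> j = 0 \<and> \<beta> j = 0) \<Longrightarrow> (\<Sum>j\<in>UNIV. \<alpha> j + \<beta> j) < s
        \<Longrightarrow> wirtinger_multi \<alpha> (wirtinger_bar_multi \<beta> f) 0 = 0"
  shows "bigo_on {w. \<forall>j. j \<notin> J \<longrightarrow> w $ j = 0} s f"
  using assms(1,3)
proof (induction s arbitrary: f)
  case 0
  then show ?case using C_infinity_on_bigo_0 assms(2) by blast
next
  case (Suc s)
  let ?X = "{w :: complex ^ 'n::{finite,linorder}. \<forall>j. j \<notin> J \<longrightarrow> w $ j = 0}"
  have upd: "(\<Sum>i\<in>UNIV. (\<alpha>(j := Suc (\<alpha> j))) i + \<beta> i) = Suc (\<Sum>i\<in>UNIV. \<alpha> i + \<beta> i)" for \<alpha> \<beta> :: "'n \<Rightarrow> nat" and j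
  proof -
    have "(\<alpha>(j := Suc (\<alpha> j))) i + \<beta> i = (if i = j then 1 else 0) + (\<alpha> i + \<beta> i)" for i by simp
    then show ?thesis by (simp only: sum.distrib sum.delta finite UNIV_I if_True)
  qed
  have step: "wirtinger_multi \<alpha> (wirtinger_bar_multi \<beta> (wirtinger j f)) 0 = 0"
     "wirtinger_multi \<alpha> (wirtinger_bar_multi \<beta> (wirtinger_bar j f)) 0 = 0"
    if "j \<in> J" "\<forall>i. i \<notin> J \<longrightarrow> \<alpha> i = 0 \<and> \<beta> i = 0" "(\<Sum>i\<in>UNIV. \<alpha> i + \<beta> i) < s" for \<alpha> \<beta> j
  proof -
    have 0: "(0 :: complex ^ 'n::{finite,linorder}) \<in> ball 0 R" using assms(2) by simp
    have "wirtinger_multi (\<alpha>(j := Suc (\<alpha> j))) (wirtinger_bar_multi \<beta> f) 0 = 0"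
      by (rule Suc.prems(2), use that in force, use that upd[of \<alpha> j \<beta>] in simp)
    then show "wirtinger_multi \<alpha> (wirtinger_bar_multi \<beta> (wirtinger j f)) 0 = 0"
      using wirtinger_multi_bar_multi_step(1)[OF open_ball Suc.prems(1) 0] by metis
    have "wirtinger_multi \<alpha> (wirtinger_bar_multi (\<beta>(j := Suc (\<beta> j))) f) 0 = 0"
      by (rule Suc.prems(2), use that in force, use that upd[of \<beta> j \<alpha>] in \<open>simp add: add.commute\<close>)
    then show "wirtinger_multi \<alpha> (wirtinger_bar_multi \<beta> (wirtinger_bar j f)) 0 = 0"
      using wirtinger_multi_bar_multi_step(2)[OF open_ball Suc.prems(1) 0] by metis
  qed
  have C: "C_infinity_on (wirtinger j f) (ball 0 R)" "C_infinity_on (wirtinger_bar j f) (ball 0 R)" for j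
    using smooth_operator_wirtinger[OF open_ball, of 0 R j] Suc.prems(1) by (auto simp: smooth_operator_def)
  have g: "bigo_on ?X s (wirtinger j f)" "bigo_on ?X s (wirtinger_bar j f)" if "j \<in> J" for j
    using Suc.IH[OF C(1)] Suc.IH[OF C(2)] step[OF that] by blast+
  let ?g = "\<lambda>p. (if snd p then wirtinger (fst p) f else wirtinger_bar (fst p) f)"
  show ?case
  proof (rule bigo_on_Suc[OF Suc.prems(1) assms(2), where I = "J \<times> UNIV" and X = ?X and g = ?g])
    have "wirtinger_multi (\<lambda>_. 0) (wirtinger_bar_multi (\<lambda>_. 0) f) 0 = 0" using Suc.prems(2) by simp
    moreover have "foldr (\<lambda>j. F j ^^ 0) js f = f" for js and F :: "'n \<Rightarrow> (complex ^ 'n::{finite,linorder} \<Rightarrow> complex) \<Rightarrow> _"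
      by (induction js) auto
    ultimately show "f 0 = 0" by (simp add: wirtinger_multi_def wirtinger_bar_multi_def)
  next
    fix w x :: "complex ^ 'n::{finite,linorder}" assume w: "w \<in> ?X" and x: "norm x < R"
    have L: "linear (\<lambda>v. deriv_along v f x)"
      using C_infinity_on_has_derivative[OF Suc.prems(1), of x] x has_derivative_linear by auto
    have "deriv_along w f x = (\<Sum>j\<in>UNIV. Re (w $ j) *\<^sub>R deriv_along (axis j 1) f x + Im (w $ j) *\<^sub>R deriv_along (axis j \<i>) f x)"
      by (subst complex_vector_expansion[of w]) (simp add: linear_sum[OF L] linear_add[OF L] linear_scale[OF L])
    also have "\<dots> = (\<Sum>j\<in>UNIV. w $ j * wirtinger j f x + cnj (w $ j) * wirtinger_bar j f x)"
      by (rule sum.cong) (auto simp: wirtinger_conv_deriv_along complex_eq_iff field_simps)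
    also have "\<dots> = (\<Sum>j\<in>J. w $ j * wirtinger j f x + cnj (w $ j) * wirtinger_bar j f x)"
      using w by (intro sum.mono_neutral_right) auto
    also have "norm \<dots> \<le> (\<Sum>j\<in>J. norm w * (norm (wirtinger j f x) + norm (wirtinger_bar j f x)))"
    proof (rule sum_norm_le)
      fix j
      have "norm (w $ j * wirtinger j f x + cnj (w $ j) * wirtinger_bar j f x)
        \<le> norm (w $ j) * norm (wirtinger j f x) + norm (w $ j) * norm (wirtinger_bar j f x)"
        by (rule order_trans[OF norm_triangle_ineq]) (simp add: norm_mult)
      also have "\<dots> \<le> norm w * norm (wirtinger j f x) + norm w * norm (wirtinger_bar j f x)"
        by (intro add_mono mult_right_mono Finite_Cartesian_Product.norm_nth_le) auto
      finally show "norm (w $ j * wirtinger j f x + cnj (w $ j) * wirtinger_bar j f x)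
        \<le> norm w * (norm (wirtinger j f x) + norm (wirtinger_bar j f x))" by (simp add: algebra_simps)
    qed
    also have "\<dots> = norm w * (\<Sum>p\<in>J \<times> UNIV. norm (?g p x))"
      by (simp add: sum.cartesian_product' UNIV_bool sum_distrib_left add.commute)
    finally show "norm (deriv_along w f x) \<le> norm w * (\<Sum>p\<in>J \<times> UNIV. norm (?g p x))" .
  qed (use g in auto)
qed

subsection \<open>Weighted vanishing from weighted bounds\<close>

text \<open>The exponents \<open>b j\<close> will be \<open>P div m j\<close> for a common multiple
  \<open>P\<close> of the orders \<open>m j\<close>; on the box each |w_j|^(m_j) is then O(t^P),
  with integral exponents throughout.\<close>

definition coord_box :: "('n \<Rightarrow> nat) \<Rightarrow> real \<Rightarrow> real \<Rightarrow> (complex ^ 'n) set" where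
  "coord_box b A t = {w. \<forall>j. norm (w $ j) \<le> A * t ^ b j}"

lemma norm_le_sum_norm: "norm (w :: complex ^ 'n) \<le> (\<Sum>j\<in>UNIV. norm (w $ j))"
  unfolding norm_vec_def by (rule L2_set_le_sum) auto

lemma boxes_shrink_coord_box:
  fixes b :: "'n::finite \<Rightarrow> nat"
  assumes "\<And>j. 0 < b j"
  shows "boxes_shrink (coord_box b)"
  unfolding boxes_shrink_def
proof (intro allI impI)
  fix A e :: real assume A: "0 < A" and e: "0 < e"
  define N where "N = real CARD('n)"
  have N: "N > 0" by (simp add: N_def)
  have "norm w < e" if "0 < t" "t < min 1 (e / (N * A))" "w \<in> coord_box b A t" for t and w :: "complex ^ 'n"
  proof -
    have "norm (w $ j) \<le> A * t" for j
    proof -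
      have "norm (w $ j) \<le> A * t ^ b j" using that by (auto simp: coord_box_def)
      also have "\<dots> \<le> A * t ^ 1" using A that assms[of j] by (intro mult_left_mono power_decreasing) auto
      finally show ?thesis by simp
    qed
    then have "(\<Sum>j\<in>UNIV. norm (w $ j)) \<le> (\<Sum>j\<in>(UNIV :: 'n set). A * t)" by (intro sum_mono) auto
    also have "\<dots> = N * A * t" by (simp add: N_def)
    also have "\<dots> < e" using that A N by (simp add: field_simps)
    finally show ?thesis using norm_le_sum_norm[of w] by simp
  qed
  then show "\<exists>t0>0. \<forall>t. 0 < t \<longrightarrow> t < t0 \<longrightarrow> coord_box b A t \<subseteq> ball (0 :: complex ^ 'n) e"
    using A e N by (intro exI[of _ "min 1 (e/(N*A))"]) force
qed

lemma box_direction_coord_box: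
  assumes "norm c \<le> 1"
  shows "box_direction (coord_box b) (b j) (axis j c)"
  unfolding box_direction_def
proof (intro exI[of _ 1] conjI allI impI)
  fix A t s :: real and x :: "complex ^ 'a"
  assume *: "0 < A" "0 < t" "t < 1" "x \<in> coord_box b A t" "0 \<le> s" "s \<le> t ^ b j"
  have "norm ((x + s *\<^sub>R axis j c) $ i) \<le> (A + 1) * t ^ b i" for i
  proof (cases "i = j")
    case True
    have "norm ((x + s *\<^sub>R axis j c) $ i) \<le> norm (x $ i) + s * norm c"
      using norm_triangle_ineq[of "x $ i" "s *\<^sub>R c"] * True by (simp add: axis_def)
    also have "\<dots> \<le> A * t ^ b i + t ^ b i * 1"
      using * True assms by (intro add_mono mult_mono) (auto simp: coord_box_def)
    finally show ?thesis by (simp add: algebra_simps)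
  next
    case False
    have "norm (x $ i) \<le> A * t ^ b i" using * by (auto simp: coord_box_def)
    moreover have "A * t ^ b i \<le> (A + 1) * t ^ b i" using * by (intro mult_right_mono) auto
    ultimately show ?thesis using False by (simp add: axis_def)
  qed
  then show "x + s *\<^sub>R axis j c \<in> coord_box b (A + 1) t" by (simp add: coord_box_def)
qed auto

lemma box_bigo_dbl_deriv:
  assumes "C_infinity_on f (ball 0 R)" "0 < R" "boxes_shrink S" "box_direction S b u" "box_direction S b v"
    "0 < b" "b \<le> M" "box_bigo S M f"
  shows "box_bigo S (M - b) (dbl_deriv c u v f)"
  unfolding dbl_deriv_def
  by (intro box_bigo_mult box_bigo_add box_bigo_deriv_along[OF assms(1-3) _ assms(6-8)] assms(4,5))

lemma box_bigo_funpow: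
  assumes T: "smooth_operator S T" "\<And>M f. C_infinity_on f S \<Longrightarrow> b \<le> M \<Longrightarrow> box_bigo B M f \<Longrightarrow> box_bigo B (M - b) (T f)"
    and "C_infinity_on f S" "b * k \<le> M" "box_bigo B M f"
  shows "box_bigo B (M - b * k) ((T ^^ k) f)"
  using assms(4)
proof (induction k)
  case 0
  then show ?case using assms(5) by simp
next
  case (Suc k)
  have "C_infinity_on ((T ^^ k) f) S"
    using smooth_operator_funpow[OF T(1)] assms(3) by (auto simp: smooth_operator_def)
  then have "box_bigo B (M - b * k - b) (T ((T ^^ k) f))" using Suc by (intro T(2)) auto
  then show ?case by (simp add: add.commute)
qed

lemma box_bigo_foldr:
  fixes b :: "'i \<Rightarrow> nat"
  assumes T: "\<And>j. smooth_operator S (T j)"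
    "\<And>j M f. C_infinity_on f S \<Longrightarrow> b j \<le> M \<Longrightarrow> box_bigo B M f \<Longrightarrow> box_bigo B (M - b j) (T j f)"
    and "C_infinity_on f S" "box_bigo B M f" "sum_list (map (\<lambda>j. b j * \<alpha> j) js) \<le> M"
  shows "box_bigo B (M - sum_list (map (\<lambda>j. b j * \<alpha> j) js)) (foldr (\<lambda>j. T j ^^ \<alpha> j) js f)"
  using assms(5)
proof (induction js)
  case Nil
  then show ?case using assms(4) by simp
next
  case (Cons j js)
  let ?s = "sum_list (map (\<lambda>j. b j * \<alpha> j) js)"
  have "C_infinity_on (foldr (\<lambda>j. T j ^^ \<alpha> j) js f) S"
    using smooth_operator_foldr[of js S "\<lambda>j. T j ^^ \<alpha> j"] smooth_operator_funpow[OF T(1)] assms(3)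
    by (auto simp: smooth_operator_def)
  then have "box_bigo B (M - ?s - b j * \<alpha> j) ((T j ^^ \<alpha> j) (foldr (\<lambda>j. T j ^^ \<alpha> j) js f))"
    using Cons by (intro box_bigo_funpow[OF T(1)[of j] T(2)]) auto
  then show ?case by (simp add: add.commute)
qed

text \<open>Each derivative in the coordinate \<open>j\<close>, holomorphic or antiholomorphic,
  costs \<open>t ^ b j\<close>. If the total cost is below \<open>M\<close>, a positive power of
  \<open>t\<close> is left at the origin, which forces the value 0.\<close>

lemma wirtinger_multi_zero_if_box_bigo:
  fixes f :: "complex ^ 'n::{finite,linorder} \<Rightarrow> complex"
  assumes f: "C_infinity_on f (ball 0 R)" "0 < R" and b: "\<And>j. 0 < b j" and M: "box_bigo (coord_box b) M f"
    and less: "(\<Sum>j\<in>UNIV. b j * (\<alpha> j + \<beta> j)) < M"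
  shows "wirtinger_multi \<alpha> (wirtinger_bar_multi \<beta> f) 0 = 0"
proof -
  note sm = smooth_operator_wirtinger[OF open_ball[of "0 :: complex ^ 'n::{finite,linorder}" R]]
  have sl: "sum_list (map g (sorted_list_of_set UNIV)) = (\<Sum>j\<in>UNIV. g j)" for g :: "'n \<Rightarrow> nat"
    by (simp add: sum_list_distinct_conv_sum_set)
  have dir: "box_direction (coord_box b) (b j) (axis j 1)" "box_direction (coord_box b) (b j) (axis j \<i>)" for j
    by (auto intro: box_direction_coord_box)
  note step = box_bigo_dbl_deriv[OF _ f(2) boxes_shrink_coord_box[OF b] dir b]
  have less': "(\<Sum>j\<in>UNIV. b j * \<beta> j) + (\<Sum>j\<in>UNIV. b j * \<alpha> j) < M"
    using less by (simp add: algebra_simps sum.distrib)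
  have "box_bigo (coord_box b) (M - (\<Sum>j\<in>UNIV. b j * \<beta> j)) (wirtinger_bar_multi \<beta> f)"
    unfolding wirtinger_bar_multi_def sl[symmetric] using less'
    by (intro box_bigo_foldr[OF sm(2) _ f(1) M]) (auto simp: sl wirtinger_conv_dbl_deriv intro: step)
  then have "box_bigo (coord_box b) (M - (\<Sum>j\<in>UNIV. b j * \<beta> j) - (\<Sum>j\<in>UNIV. b j * \<alpha> j)) (wirtinger_multi \<alpha> (wirtinger_bar_multi \<beta> f))"
    unfolding wirtinger_multi_def sl[symmetric] using less' smooth_operator_wirtinger_multi(2)[OF open_ball[of 0 R], of \<beta>] f(1)
    by (intro box_bigo_foldr[OF sm(1)]) (auto simp: sl wirtinger_conv_dbl_deriv smooth_operator_def intro: step)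
  then show ?thesis
    using less' by (rule_tac box_bigo_zero[of _ _ _ 1]) (auto simp: coord_box_def)
qed

subsection \<open>Smoothness of holomorphic maps\<close>

text \<open>Only a complex linear derivative at each point is recorded, as in
  \<open>holomorphic_map_on\<close>; continuity and smoothness of the derivative are derived from
  Cauchy's inequality on one-dimensional discs.\<close>

definition complex_differentiable_on :: "(complex ^ 'n \<Rightarrow> complex) \<Rightarrow> (complex ^ 'n) set \<Rightarrow> bool" where
  "complex_differentiable_on f S \<longleftrightarrow>
     (\<forall>x\<in>S. \<exists>A. (f has_derivative A) (at x) \<and> (\<forall>c v. A (c *s v) = c * A v))"

lemma complex_differentiable_onD:
  assumes "complex_differentiable_on f S" "x \<in> S"
  shows "(f has_derivative (\<lambda>v. deriv_along v f x)) (at x)" "deriv_along (c *s v) f x = c * deriv_along v f x"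
proof -
  obtain A where A: "(f has_derivative A) (at x)" "\<And>c v. A (c *s v) = c * A v"
    using assms unfolding complex_differentiable_on_def by blast
  have "(\<lambda>v. deriv_along v f x) = A" using deriv_along_eq[OF A(1)] by auto
  then show "(f has_derivative (\<lambda>v. deriv_along v f x)) (at x)" "deriv_along (c *s v) f x = c * deriv_along v f x"
    using A deriv_along_eq[OF A(1)] by auto
qed

lemma complex_differentiable_on_continuous_on: "complex_differentiable_on f S \<Longrightarrow> continuous_on S f"
  by (intro continuous_at_imp_continuous_on ballI has_derivative_continuous) (rule complex_differentiable_onD(1))

lemma bounded_linear_cmul_vec: "bounded_linear (\<lambda>c. c *s (v :: complex ^ 'n))"
proof -
  have "linear (\<lambda>c. c *s (v :: complex ^ 'n))"
    by (rule linearI) (simp_all add: vec_eq_iff distrib_right)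
  then show ?thesis by (simp add: linear_conv_bounded_linear)
qed

lemma norm_cmul_vec: "norm (c *s (v :: complex ^ 'n)) = norm c * norm v"
  by (simp add: norm_vec_def norm_mult L2_set_right_distrib)

lemma cmul_vec_small:
  fixes v :: "complex ^ 'n"
  assumes "0 < e"
  obtains d where "0 < d" "\<And>\<zeta>. norm \<zeta> \<le> d \<Longrightarrow> norm (\<zeta> *s v) < e"
proof
  have nv: "norm v + 1 > 0" using norm_ge_zero[of v] by linarith
  then show d: "0 < e / (norm v + 1)" using assms by simp
  fix \<zeta> :: complex assume "norm \<zeta> \<le> e / (norm v + 1)"
  then have "norm (\<zeta> *s v) \<le> e / (norm v + 1) * norm v" unfolding norm_cmul_vec by (intro mult_right_mono) auto
  also have "\<dots> < e / (norm v + 1) * (norm v + 1)" using d by (intro mult_strict_left_mono) auto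
  also have "\<dots> = e" using nv by simp
  finally show "norm (\<zeta> *s v) < e" .
qed

lemma has_field_derivative_along:
  assumes "complex_differentiable_on f S" "x + \<zeta> *s v \<in> S"
  shows "((\<lambda>\<zeta>. f (x + \<zeta> *s v)) has_field_derivative deriv_along v f (x + \<zeta> *s v)) (at \<zeta>)"
proof -
  have "((\<lambda>\<zeta>. x + \<zeta> *s v) has_derivative (\<lambda>h. h *s v)) (at \<zeta>)"
    using bounded_linear.has_derivative[OF bounded_linear_cmul_vec has_derivative_ident]
    by (intro derivative_eq_intros) auto
  from diff_chain_at[OF this complex_differentiable_onD(1)[OF assms]]
  show ?thesis
    unfolding has_field_derivative_def o_def complex_differentiable_onD(2)[OF assms]
    by (simp add: mult_commute_abs)
qed

lemma holomorphic_along: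
  assumes "complex_differentiable_on f S" "\<And>\<zeta>. norm \<zeta> \<le> \<rho> \<Longrightarrow> x + \<zeta> *s v \<in> S"
  shows "(\<lambda>\<zeta>. f (x + \<zeta> *s v)) holomorphic_on ball 0 \<rho>" "continuous_on (cball 0 \<rho>) (\<lambda>\<zeta>. f (x + \<zeta> *s v))"
proof -
  have d: "((\<lambda>\<zeta>. f (x + \<zeta> *s v)) has_field_derivative deriv_along v f (x + \<zeta> *s v)) (at \<zeta>)" if "norm \<zeta> \<le> \<rho>" for \<zeta>
    using has_field_derivative_along[OF assms(1) assms(2)[OF that]] .
  show "(\<lambda>\<zeta>. f (x + \<zeta> *s v)) holomorphic_on ball 0 \<rho>"
    unfolding holomorphic_on_open[OF open_ball] using d by force
  show "continuous_on (cball 0 \<rho>) (\<lambda>\<zeta>. f (x + \<zeta> *s v))"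
    by (rule continuous_at_imp_continuous_on) (use d DERIV_isCont in force)
qed

lemma Cauchy_inequality_at_0:
  assumes "f holomorphic_on ball 0 \<rho>" "continuous_on (cball 0 \<rho>) f" "0 < \<rho>"
    and "\<And>\<zeta>. norm \<zeta> \<le> \<rho> \<Longrightarrow> norm (f \<zeta>) \<le> B" "(f has_field_derivative f') (at 0)"
  shows "norm f' \<le> B / \<rho>"
  using Cauchy_inequality[OF assms(1-3), of B 1] assms(4,5) DERIV_imp_deriv[OF assms(5)] by simp

text \<open>Cauchy's inequality on discs in direction \<open>v\<close> bounds the difference of the
  derivatives at \<open>x\<close> and \<open>x0\<close> by the difference of the values on the two
  discs, which is small by uniform continuity of \<open>f\<close> on a closed ball.\<close>

lemma deriv_along_continuous_on:
  assumes "complex_differentiable_on f S" "open S"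
  shows "continuous_on S (deriv_along v f)"
proof (rule continuous_at_imp_continuous_on, rule ballI)
  fix x0 assume "x0 \<in> S"
  then obtain d where d: "0 < d" "cball x0 d \<subseteq> S" using assms(2) open_contains_cball by blast
  then have "0 < d / 2" by simp
  then obtain \<rho> where \<rho>: "0 < \<rho>" "\<And>\<zeta>. norm \<zeta> \<le> \<rho> \<Longrightarrow> norm (\<zeta> *s v) < d / 2"
    using cmul_vec_small[where v = v] by blast
  have near: "x + \<zeta> *s v \<in> cball x0 d" if "dist x x0 \<le> d/2" "norm \<zeta> \<le> \<rho>" for x \<zeta>
  proof -
    have "norm ((x - x0) + \<zeta> *s v) \<le> d"
      using that(1) \<rho>(2)[OF that(2)] norm_triangle_ineq[of "x - x0" "\<zeta> *s v"] by (simp add: dist_norm)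
    then show ?thesis unfolding mem_cball dist_commute[of x0] by (simp add: dist_norm algebra_simps)
  qed
  have "uniformly_continuous_on (cball x0 d) f"
    using continuous_on_subset[OF complex_differentiable_on_continuous_on[OF assms(1)] d(2)]
    by (intro compact_uniformly_continuous) auto
  show "isCont (deriv_along v f) x0"
    unfolding continuous_at_eps_delta
  proof (intro allI impI)
    fix e :: real assume e: "0 < e"
    then have "0 < e * \<rho> / 2" using \<rho> by simp
    then obtain \<delta> where \<delta>: "0 < \<delta>" "\<And>x y. x \<in> cball x0 d \<Longrightarrow> y \<in> cball x0 d \<Longrightarrow> dist y x < \<delta> \<Longrightarrow> dist (f y) (f x) < e * \<rho> / 2"
      using \<open>uniformly_continuous_on (cball x0 d) f\<close> unfolding uniformly_continuous_on_def by metis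
    show "\<exists>\<delta>>0. \<forall>x. dist x x0 < \<delta> \<longrightarrow> dist (deriv_along v f x) (deriv_along v f x0) < e"
    proof (intro exI[of _ "min \<delta> (d/2)"] conjI allI impI)
      fix x assume x: "dist x x0 < min \<delta> (d/2)"
      have in1: "x + \<zeta> *s v \<in> S" "x0 + \<zeta> *s v \<in> S" if "norm \<zeta> \<le> \<rho>" for \<zeta>
        using near[OF _ that] x d by (auto simp: subset_iff)
      let ?g = "\<lambda>\<zeta>. f (x + \<zeta> *s v) - f (x0 + \<zeta> *s v)"
      have "norm (deriv_along v f x - deriv_along v f x0) \<le> (e * \<rho> / 2) / \<rho>"
      proof (rule Cauchy_inequality_at_0[of ?g])
        show "?g holomorphic_on ball 0 \<rho>" "continuous_on (cball 0 \<rho>) ?g"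
          using holomorphic_along[OF assms(1) in1(1)] holomorphic_along[OF assms(1) in1(2)]
          by (auto intro: holomorphic_on_diff continuous_on_diff)
        show "norm (?g \<zeta>) \<le> e * \<rho> / 2" if "norm \<zeta> \<le> \<rho>" for \<zeta>
        proof -
          have "x + \<zeta> *s v \<in> cball x0 d" "x0 + \<zeta> *s v \<in> cball x0 d" using near[OF _ that] x d by auto
          then show ?thesis using \<delta>(2)[of "x0 + \<zeta> *s v" "x + \<zeta> *s v"] x by (simp add: dist_norm)
        qed
        show "(?g has_field_derivative deriv_along v f x - deriv_along v f x0) (at 0)"
          using has_field_derivative_along[OF assms(1), of x 0 v] has_field_derivative_along[OF assms(1), of x0 0 v]
            in1[of 0] \<rho> by (intro DERIV_diff) auto
      qed (rule \<rho>)
      then show "dist (deriv_along v f x) (deriv_along v f x0) < e" using e \<rho> by (simp add: dist_norm)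
    qed (use \<delta> d in auto)
  qed
qed

text \<open>The point is uniformity in \<open>y\<close>, which makes difference quotients converge
  uniformly on a disc. The derivatives in the finitely many basis directions are uniformly
  continuous on the compact ball, and a mean value estimate along the segment from \<open>y\<close>
  to \<open>y + u\<close> concludes.\<close>

lemma uniform_linear_approximation:
  assumes "complex_differentiable_on f S" "open S" "cball x0 d \<subseteq> S" "0 < e" and True: "0 < d"
  shows "\<exists>\<delta>>0. \<forall>y u. y \<in> cball x0 (d/2) \<longrightarrow> norm u < \<delta> \<longrightarrow> norm (f (y + u) - f y - deriv_along u f y) \<le> e * norm u"
proof -
  define N where "N = real DIM(complex ^ 'a)"
  have N: "N > 0" by (simp add: N_def)
  have "\<exists>\<delta>>0. \<forall>x y. x \<in> cball x0 d \<longrightarrow> y \<in> cball x0 d \<longrightarrow> dist y x < \<delta> \<longrightarrow>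
     dist (deriv_along b f y) (deriv_along b f x) < e / N" for b
  proof -
    have "uniformly_continuous_on (cball x0 d) (deriv_along b f)"
      using continuous_on_subset[OF deriv_along_continuous_on[OF assms(1,2)] assms(3)]
      by (intro compact_uniformly_continuous) auto
    moreover have "e / N > 0" using N assms(4) by simp
    ultimately show ?thesis unfolding uniformly_continuous_on_def by blast
  qed
  then obtain \<delta> where \<delta>: "\<And>b. \<delta> b > 0" "\<And>b x y. x \<in> cball x0 d \<Longrightarrow> y \<in> cball x0 d \<Longrightarrow> dist y x < \<delta> b \<Longrightarrow>
     dist (deriv_along b f y) (deriv_along b f x) < e / N" by metis
  define \<eta> where "\<eta> = min (d/2) (Min (\<delta> ` Basis))"
  have \<eta>: "\<eta> > 0" using True \<delta>(1) by (auto simp: \<eta>_def)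
  have close: "norm (deriv_along u f y' - deriv_along u f y) \<le> e * norm u"
    if "y \<in> cball x0 d" "y' \<in> cball x0 d" "dist y' y < \<eta>" for u y y'
  proof -
    let ?A = "\<lambda>u. deriv_along u f y' - deriv_along u f y"
    have "linear (\<lambda>u. deriv_along u f z)" if "z \<in> cball x0 d" for z
      using complex_differentiable_onD(1)[OF assms(1)] has_derivative_linear that assms(3) by blast
    then have "linear ?A" using that by (intro linear_compose_sub)
    then have "norm (?A u) \<le> norm u * (\<Sum>b\<in>Basis. norm (?A b))" by (rule linear_norm_le_Basis)
    also have "\<dots> \<le> norm u * (\<Sum>b\<in>(Basis :: (complex ^ 'a) set). e / N)"
    proof (intro mult_left_mono sum_mono)
      fix b :: "complex ^ 'a" assume b: "b \<in> Basis"
      then have "\<eta> \<le> \<delta> b" by (auto simp: \<eta>_def intro: min.coboundedI2)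
      then show "norm (?A b) \<le> e / N"
        using \<delta>(2)[OF that(1,2), of b] that(3) by (simp add: dist_norm)
    qed simp
    also have "\<dots> = e * norm u" using N by (simp add: N_def)
    finally show ?thesis .
  qed
  have "norm (f (y + u) - f y - deriv_along u f y) \<le> e * norm u" if y: "y \<in> cball x0 (d/2)" and u: "norm u < \<eta>" for y u
  proof -
    have in1: "y + s *\<^sub>R u \<in> cball x0 d" "dist (y + s *\<^sub>R u) y < \<eta>" if "s \<in> {0..1}" for s
    proof -
      have "norm (s *\<^sub>R u) \<le> norm u" using that by (simp add: mult_left_le_one_le)
      then have "norm (s *\<^sub>R u) < \<eta>" using u by simp
      then show "dist (y + s *\<^sub>R u) y < \<eta>" by (simp add: dist_norm)
      have "dist x0 (y + s *\<^sub>R u) \<le> dist x0 y + dist y (y + s *\<^sub>R u)" by (rule dist_triangle)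
      also have "\<dots> \<le> d/2 + d/2" using y \<open>norm (s *\<^sub>R u) < \<eta>\<close> by (intro add_mono) (auto simp: dist_norm \<eta>_def)
      finally show "y + s *\<^sub>R u \<in> cball x0 d" by simp
    qed
    have "norm (f (y + 1 *\<^sub>R u) - f (y + 0 *\<^sub>R u) - 1 *\<^sub>R deriv_along u f y) \<le> (e * norm u) * 1"
    proof (rule vector_derivative_linear_bound[of 1 "\<lambda>s. f (y + s *\<^sub>R u)" "\<lambda>s. deriv_along u f (y + s *\<^sub>R u)"])
      fix s :: real assume s: "s \<in> {0..1}"
      have S: "y + s *\<^sub>R u \<in> S" using in1(1)[OF s] assms(3) by blast
      have "((\<lambda>s. y + s *\<^sub>R u) has_derivative (\<lambda>s. s *\<^sub>R u)) (at s)"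
        by (auto intro!: derivative_eq_intros)
      from diff_chain_at[OF this complex_differentiable_onD(1)[OF assms(1) S]]
      have "((\<lambda>s. f (y + s *\<^sub>R u)) has_derivative (\<lambda>t. deriv_along (t *\<^sub>R u) f (y + s *\<^sub>R u))) (at s)"
        by (simp add: o_def)
      then show "((\<lambda>s. f (y + s *\<^sub>R u)) has_vector_derivative deriv_along u f (y + s *\<^sub>R u)) (at s)"
        using linear_scale[OF has_derivative_linear[OF complex_differentiable_onD(1)[OF assms(1) S]]]
        by (simp add: has_vector_derivative_def)
      show "norm (deriv_along u f (y + s *\<^sub>R u) - deriv_along u f y) \<le> e * norm u"
        using in1[OF s] in1(1)[of 0] by (intro close) auto
    qed auto
    then show ?thesis by simp
  qed
  then show ?thesis using \<eta> by blast
qed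

text \<open>The difference quotients converge uniformly, so \<open>\<zeta> \<mapsto> deriv_along u f (x0 + \<zeta> v)\<close> is holomorphic;
  Cauchy's inequality in direction \<open>v\<close> then turns the first-order expansion of \<open>f\<close> into one of \<open>deriv_along v f\<close>.\<close>

lemma complex_differentiable_on_deriv_along:
  assumes "complex_differentiable_on f S" "open S"
  shows "complex_differentiable_on (deriv_along v f) S"
  unfolding complex_differentiable_on_def
proof
  fix x0 assume "x0 \<in> S"
  then obtain d where d: "0 < d" "cball x0 d \<subseteq> S" using assms(2) open_contains_cball by blast
  then have "0 < d / 4" by simp
  then obtain \<rho> where \<rho>: "0 < \<rho>" "\<And>\<zeta>. norm \<zeta> \<le> \<rho> \<Longrightarrow> norm (\<zeta> *s v) < d / 4"
    using cmul_vec_small[where v = v] by blast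
  have near: "x + \<zeta> *s v \<in> cball x0 (d/2)" if "dist x x0 \<le> d/4" "norm \<zeta> \<le> \<rho>" for x \<zeta>
  proof -
    have "norm ((x - x0) + \<zeta> *s v) \<le> d/2"
      using that(1) \<rho>(2)[OF that(2)] norm_triangle_ineq[of "x - x0" "\<zeta> *s v"] by (simp add: dist_norm)
    then show ?thesis unfolding mem_cball dist_commute[of x0] by (simp add: dist_norm algebra_simps)
  qed
  have near0: "x0 + \<zeta> *s v \<in> cball x0 (d/2)" if "norm \<zeta> \<le> \<rho>" for \<zeta> using near[OF _ that] d by simp
  have S: "x + \<zeta> *s v \<in> S" if "dist x x0 \<le> d/4" "norm \<zeta> \<le> \<rho>" for x \<zeta>
    using near[OF that] d by (auto simp: subset_iff)
  note approx = uniform_linear_approximation[OF assms d(2) _ d(1)]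
  let ?h = "\<lambda>u \<zeta>. deriv_along u f (x0 + \<zeta> *s v)"
  have hol: "continuous_on (cball 0 \<rho>) (?h u) \<and> ?h u holomorphic_on ball 0 \<rho>" for u
  proof -
    let ?q = "\<lambda>(k::nat) \<zeta>. of_nat k * (f ((x0 + (1 / of_nat k) *\<^sub>R u) + \<zeta> *s v) - f (x0 + \<zeta> *s v))"
    have small: "eventually (\<lambda>k::nat. norm ((1 / of_nat k) *\<^sub>R u) < e) sequentially" if "e > 0" for e
    proof -
      have "(\<lambda>k::nat. norm ((1 / of_nat k) *\<^sub>R u)) \<longlonglongrightarrow> norm (0 *\<^sub>R u)"
        by (intro tendsto_intros lim_1_over_n)
      then show ?thesis using order_tendstoD(2)[of _ "norm (0 *\<^sub>R u)" _ e] that by simp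
    qed
    show ?thesis
    proof (rule holomorphic_uniform_limit[where z = 0 and r = \<rho> and f = ?q and g = "?h u" and F = sequentially])
      show "\<forall>\<^sub>F k in sequentially. continuous_on (cball 0 \<rho>) (?q k) \<and> ?q k holomorphic_on ball 0 \<rho>"
        using small[of "d/4"]
      proof (rule eventually_mono)
        show "0 < d/4" using d by simp
        fix k :: nat assume k: "norm ((1 / of_nat k) *\<^sub>R u) < d/4"
        have 1: "(x0 + (1 / of_nat k) *\<^sub>R u) + \<zeta> *s v \<in> S" "x0 + \<zeta> *s v \<in> S" if "norm \<zeta> \<le> \<rho>" for \<zeta>
          using k d(1) by (intro S that; simp add: dist_norm)+
        show "continuous_on (cball 0 \<rho>) (?q k) \<and> ?q k holomorphic_on ball 0 \<rho>"
          using holomorphic_along[OF assms(1) 1(1)] holomorphic_along[OF assms(1) 1(2)]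
          by (intro conjI continuous_intros holomorphic_intros) auto
      qed
      show "uniform_limit (cball 0 \<rho>) ?q (?h u) sequentially"
        unfolding uniform_limit_iff
      proof (intro allI impI)
        fix e :: real assume e: "0 < e"
        define e' where "e' = e / (norm u + 1)"
        have nu: "norm u + 1 > 0" using norm_ge_zero[of u] by linarith
        have e': "e' > 0" "e' * norm u < e" using e nu by (auto simp: e'_def field_simps)
        obtain \<delta> where \<delta>: "\<delta> > 0" "\<And>y u. y \<in> cball x0 (d/2) \<Longrightarrow> norm u < \<delta> \<Longrightarrow> norm (f (y + u) - f y - deriv_along u f y) \<le> e' * norm u"
          using approx[OF e'(1)] by blast
        show "\<forall>\<^sub>F k in sequentially. \<forall>\<zeta>\<in>cball 0 \<rho>. dist (?q k \<zeta>) (?h u \<zeta>) < e"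
          using small[OF \<delta>(1)] eventually_gt_at_top[of 0]
        proof eventually_elim
          case (elim k)
          show ?case
          proof
            fix \<zeta> :: complex assume \<zeta>: "\<zeta> \<in> cball 0 \<rho>"
            let ?y = "x0 + \<zeta> *s v" and ?u = "(1 / of_nat k) *\<^sub>R u"
            have y: "?y \<in> cball x0 (d/2)" using near0 \<zeta> by simp
            then have "?y \<in> S" using d by (auto simp: subset_iff)
            then have lin: "deriv_along ?u f ?y = (1 / of_nat k) *\<^sub>R deriv_along u f ?y"
              using linear_scale[OF has_derivative_linear[OF complex_differentiable_onD(1)[OF assms(1)]]] by blast
            have "norm (f (?y + ?u) - f ?y - deriv_along ?u f ?y) \<le> e' * norm ?u"
              using \<delta>(2)[OF y] elim by blast
            moreover have "?q k \<zeta> - ?h u \<zeta> = of_nat k * (f (?y + ?u) - f ?y - deriv_along ?u f ?y)"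
              using elim unfolding lin by (simp add: algebra_simps scaleR_conv_of_real)
            ultimately have "norm (?q k \<zeta> - ?h u \<zeta>) \<le> real k * (e' * norm ?u)"
              by (simp only: norm_mult norm_of_nat mult_left_mono of_nat_0_le_iff)
            also have "\<dots> = e' * norm u" using elim by simp
            finally show "dist (?q k \<zeta>) (?h u \<zeta>) < e" using e'(2) by (simp add: dist_norm)
          qed
        qed
      qed
    qed auto
  qed
  \<comment> \<open>The candidate derivative of \<open>deriv_along v f\<close> is the mixed
    derivative in the exchanged order: along \<open>u\<close> first, then in \<open>\<zeta>\<close>
    along \<open>v\<close>.\<close>
  define A where "A u = deriv (?h u) 0" for u
  have A: "(?h u has_field_derivative A u) (at 0)" for u
    unfolding A_def using hol[of u] \<rho> holomorphic_derivI[OF _ open_ball, of "?h u" 0 \<rho> 0 UNIV] by auto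
  have L: "linear (\<lambda>v. deriv_along v f x)" if "x \<in> S" for x
    using complex_differentiable_onD(1)[OF assms(1) that] has_derivative_linear by blast
  have unique: "c = c'" if "(g has_field_derivative c) (at 0)" "(h has_field_derivative c') (at 0)"
    "\<And>\<zeta>. norm \<zeta> < \<rho> \<Longrightarrow> g \<zeta> = h \<zeta>" for c c' g h
  proof -
    have "(h has_field_derivative c) (at 0)"
      using that \<rho> by (intro has_field_derivative_transform_within_open[OF that(1) open_ball[of 0 \<rho>]]) auto
    then show ?thesis using that(2) DERIV_unique by blast
  qed
  have inS: "x0 + \<zeta> *s v \<in> S" if "norm \<zeta> < \<rho>" for \<zeta> using S[of x0 \<zeta>] that d by simp
  have A_add: "A (u + w) = A u + A w" for u w
    by (rule unique[OF A DERIV_add[OF A A]]) (simp add: linear_add[OF L] inS)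
  have A_scale: "A (c *s u) = c * A u" for c u
    by (rule unique[OF A DERIV_cmult[OF A]]) (simp add: complex_differentiable_onD(2)[OF assms(1)] inS)
  have A_scaleR: "A (c *\<^sub>R u) = c *\<^sub>R A u" for c u
    using A_scale[of "of_real c" u] by (simp add: scaleR_conv_of_real vector_scalar_mult_def scaleR_vec_def)
  have "linear A" by (rule linearI) (auto simp: A_add A_scaleR)
  then have bl: "bounded_linear A" by (simp add: linear_conv_bounded_linear)
  have "(deriv_along v f has_derivative A) (at x0)"
    unfolding has_derivative_at_alt
  proof (intro conjI bl allI impI)
    fix e :: real assume "0 < e"
    then have "e * \<rho> > 0" using \<rho> by simp
    then obtain \<delta> where \<delta>: "\<delta> > 0" "\<And>y u. y \<in> cball x0 (d/2) \<Longrightarrow> norm u < \<delta> \<Longrightarrow> norm (f (y + u) - f y - deriv_along u f y) \<le> e * \<rho> * norm u"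
      using approx by blast
    show "\<exists>d>0. \<forall>y. norm (y - x0) < d \<longrightarrow> norm (deriv_along v f y - deriv_along v f x0 - A (y - x0)) \<le> e * norm (y - x0)"
    proof (intro exI[of _ "min \<delta> (d/4)"] conjI allI impI)
      fix y assume y: "norm (y - x0) < min \<delta> (d/4)"
      let ?u = "y - x0"
      \<comment> \<open>The first-order error of \<open>f\<close>, transported along the disc in
        direction \<open>v\<close>; its derivative at 0 is the first-order error of
        \<open>deriv_along v f\<close>.\<close>
      let ?E = "\<lambda>\<zeta>. f (y + \<zeta> *s v) - f (x0 + \<zeta> *s v) - ?h ?u \<zeta>"
      have 1: "y + \<zeta> *s v \<in> S" "x0 + \<zeta> *s v \<in> S" if "norm \<zeta> \<le> \<rho>" for \<zeta>
        using y d(1) by (intro S that; simp add: dist_norm)+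
      have "norm (deriv_along v f y - deriv_along v f x0 - A ?u) \<le> (e * \<rho> * norm ?u) / \<rho>"
      proof (rule Cauchy_inequality_at_0[of ?E])
        show "?E holomorphic_on ball 0 \<rho>" "continuous_on (cball 0 \<rho>) ?E"
          using holomorphic_along[OF assms(1) 1(1)] holomorphic_along[OF assms(1) 1(2)] hol[of ?u]
          by (auto intro!: holomorphic_on_diff continuous_on_diff)
        show "norm (?E \<zeta>) \<le> e * \<rho> * norm ?u" if "norm \<zeta> \<le> \<rho>" for \<zeta>
          using \<delta>(2)[OF near0[OF that], of ?u] y by (simp add: algebra_simps)
        show "(?E has_field_derivative deriv_along v f y - deriv_along v f x0 - A ?u) (at 0)"
          using has_field_derivative_along[OF assms(1), of y 0 v] has_field_derivative_along[OF assms(1), of x0 0 v]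
            1[of 0] \<rho> A by (intro DERIV_diff) auto
      qed (rule \<rho>)
      then show "norm (deriv_along v f y - deriv_along v f x0 - A ?u) \<le> e * norm ?u" using \<rho> by simp
    qed (use \<delta> d in auto)
  qed
  then show "\<exists>A. (deriv_along v f has_derivative A) (at x0) \<and> (\<forall>c w. A (c *s w) = c * A w)"
    using A_scale by blast
qed

lemma complex_differentiable_on_C_infinity_on:
  assumes "complex_differentiable_on f S" "open S"
  shows "C_infinity_on f S"
  unfolding C_infinity_on_def
proof
  fix k
  show "Ck_on k f S" using assms(1)
  proof (induction k arbitrary: f)
    case 0
    then show ?case by (simp add: complex_differentiable_on_continuous_on)
  next
    case (Suc k)
    show ?case
      by (rule Ck_on_SucI[OF assms(2) complex_differentiable_onD(1)[OF Suc.prems]])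
        (use Suc.IH[OF complex_differentiable_on_deriv_along[OF Suc.prems assms(2)]] in simp_all)
  qed
qed

lemma C_infinity_on_componentwise:
  fixes F :: "'a::real_normed_vector \<Rightarrow> complex ^ 'n"
  assumes "open S" "\<And>i. C_infinity_on (\<lambda>x. F x $ i) S"
  shows "C_infinity_on F S"
proof -
  have bl: "bounded_linear (axis i :: complex \<Rightarrow> complex ^ 'n)" for i
  proof -
    have "linear (axis i :: complex \<Rightarrow> complex ^ 'n)"
      by (rule linearI) (auto simp: vec_eq_iff axis_def)
    then show ?thesis by (simp add: linear_conv_bounded_linear)
  qed
  have eq: "(\<Sum>i\<in>UNIV. axis i (F x $ i)) = F x" for x
    by (simp add: vec_eq_iff axis_def if_distrib[of "\<lambda>z. z = _"] sum.delta)
  have "C_infinity_on (\<lambda>x. \<Sum>i\<in>UNIV. axis i (F x $ i)) S"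
    by (intro C_infinity_on_sum assms C_infinity_on_bounded_linear[OF assms(1) bl])
  then show ?thesis by (simp add: eq)
qed

lemma holomorphic_map_on_component:
  fixes F :: "complex ^ 'n \<Rightarrow> complex ^ 'm"
  assumes "holomorphic_map_on F S"
  shows "complex_differentiable_on (\<lambda>x. F x $ i) S"
  unfolding complex_differentiable_on_def
proof
  fix x assume "x \<in> S"
  then obtain A where A: "(F has_derivative (\<lambda>v. A *v v)) (at x)" using assms unfolding holomorphic_map_on_def by blast
  have "((\<lambda>x. F x $ i) has_derivative (\<lambda>v. (A *v v) $ i)) (at x)"
    by (rule bounded_linear.has_derivative[OF bounded_linear_vec_nth A])
  moreover have "(A *v (c *s v)) $ i = c * (A *v v) $ i" for c v
    by (simp add: vec.scale)
  ultimately show "\<exists>A. ((\<lambda>x. F x $ i) has_derivative A) (at x) \<and> (\<forall>c v. A (c *s v) = c * A v)" by blast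
qed

lemma holomorphic_map_on_C_infinity_on:
  assumes "holomorphic_map_on F S" "open S"
  shows "C_infinity_on F S"
  by (intro C_infinity_on_componentwise complex_differentiable_on_C_infinity_on holomorphic_map_on_component assms)

lemma holomorphic_on_C_infinity_on:
  assumes "f holomorphic_on S" "open S"
  shows "C_infinity_on f S"
  unfolding C_infinity_on_def
proof
  fix k
  show "Ck_on k f S" using assms(1)
  proof (induction k arbitrary: f)
    case 0
    then show ?case by (simp add: holomorphic_on_imp_continuous_on)
  next
    case (Suc k)
    show ?case
    proof (rule Ck_on_SucI[OF assms(2)])
      show "(f has_derivative (\<lambda>v. deriv f x * v)) (at x)" if "x \<in> S" for x
        using holomorphic_derivI[OF Suc.prems assms(2) that] by (simp add: has_field_derivative_def)
      show "Ck_on k (\<lambda>x. deriv f x * v) S" for v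
        by (intro Suc.IH holomorphic_on_mult holomorphic_on_const holomorphic_deriv[OF Suc.prems assms(2)])
    qed
  qed
qed

subsection \<open>Weak linear convexity\<close>

text \<open>All values of \<open>f\<close> are logarithms of the same \<open>c\<close> and differ by
  multiples of 2 \<pi> i, so the range is discrete and connectedness makes \<open>f\<close>
  constant.\<close>

lemma exp_1_constant_on:
  fixes f :: "'a::topological_space \<Rightarrow> complex"
  assumes "connected S" "continuous_on S f" "\<And>x. x \<in> S \<Longrightarrow> exp (f x) = c"
  shows "f constant_on S"
proof (rule continuous_discrete_range_constant[OF assms(1,2)])
  fix x assume x: "x \<in> S"
  have "2 * pi \<le> norm (f y - f x)" if y: "y \<in> S" "f y \<noteq> f x" for y
  proof -
    have "exp (f y) = exp (f x)" using assms(3) x y by simp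
    then obtain n :: int where n: "f y = f x + (of_int (2 * n) * pi) * \<i>" using exp_eq by blast
    then have "n \<noteq> 0" using y(2) by auto
    then have "1 \<le> \<bar>real_of_int n\<bar>" by simp
    then have "2 * pi * 1 \<le> 2 * pi * \<bar>real_of_int n\<bar>" by (intro mult_left_mono) auto
    moreover have "norm (f y - f x) = 2 * pi * \<bar>real_of_int n\<bar>" using n by (simp add: norm_mult)
    ultimately show ?thesis by simp
  qed
  then show "\<exists>e>0. \<forall>y. y \<in> S \<and> f y \<noteq> f x \<longrightarrow> e \<le> norm (f y - f x)"
    by (intro exI[of _ "2 * pi"]) auto
qed

text \<open>A branch of the logarithm along a path from \<open>1\<close> to \<open>\<rho> \<kappa>\<^sup>*\<close> inside \<open>\<Omega> \<kappa>\<close> would depend continuously on \<open>\<kappa>\<close>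
  and provide a continuous argument on the circle.\<close>

lemma no_rotating_sections:
  fixes \<Omega> :: "complex \<Rightarrow> complex set"
  assumes \<Omega>: "\<And>\<kappa>. norm \<kappa> = 1 \<Longrightarrow> open (\<Omega> \<kappa>)" "\<And>\<kappa>. norm \<kappa> = 1 \<Longrightarrow> simply_connected (\<Omega> \<kappa>)"
      "\<And>\<kappa>. norm \<kappa> = 1 \<Longrightarrow> 0 \<notin> \<Omega> \<kappa>" "\<And>\<kappa>. norm \<kappa> = 1 \<Longrightarrow> 1 \<in> \<Omega> \<kappa>"
      "\<And>\<kappa>. norm \<kappa> = 1 \<Longrightarrow> of_real \<rho> * cnj \<kappa> \<in> \<Omega> \<kappa>"
    and \<rho>: "0 < \<rho>"
    and stable: "\<And>\<kappa>0 K. norm \<kappa>0 = 1 \<Longrightarrow> compact K \<Longrightarrow> K \<subseteq> \<Omega> \<kappa>0 \<Longrightarrow>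
       \<exists>d>0. \<forall>\<kappa>. norm \<kappa> = 1 \<longrightarrow> dist \<kappa> \<kappa>0 < d \<longrightarrow> K \<subseteq> \<Omega> \<kappa>"
  shows False
proof -
  have "\<exists>g. continuous_on (\<Omega> \<kappa>) g \<and> (\<forall>z\<in>\<Omega> \<kappa>. z = exp (g z))" if "norm \<kappa> = 1" for \<kappa>
  proof (rule continuous_logarithm_on_simply_connected[of "\<Omega> \<kappa>" "\<lambda>z. z"])
    show "simply_connected (\<Omega> \<kappa>)" "locally path_connected (\<Omega> \<kappa>)"
      using \<Omega>(1,2)[OF that] by (auto intro: open_imp_locally_path_connected)
    show "z \<noteq> 0" if "z \<in> \<Omega> \<kappa>" for z using \<Omega>(3)[OF \<open>norm \<kappa> = 1\<close>] that by auto
  qed auto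
  then obtain g where g: "\<And>\<kappa>. norm \<kappa> = 1 \<Longrightarrow> continuous_on (\<Omega> \<kappa>) (g \<kappa>)"
    "\<And>\<kappa> z. norm \<kappa> = 1 \<Longrightarrow> z \<in> \<Omega> \<kappa> \<Longrightarrow> exp (g \<kappa> z) = z" by metis
  define h where "h \<kappa> = g \<kappa> (of_real \<rho> * cnj \<kappa>) - g \<kappa> 1" for \<kappa>
  have exp_h: "exp (h \<kappa>) = of_real \<rho> * cnj \<kappa>" if "norm \<kappa> = 1" for \<kappa>
    using g(2)[OF that \<Omega>(5)[OF that]] g(2)[OF that \<Omega>(4)[OF that]] by (simp add: h_def exp_diff)
  have "continuous_on (sphere 0 1) h"
    unfolding continuous_on_eq_continuous_within
  proof
    fix \<kappa>0 :: complex assume "\<kappa>0 \<in> sphere 0 1"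
    then have \<kappa>0: "norm \<kappa>0 = 1" by simp
    let ?c = "\<lambda>\<kappa>. of_real \<rho> * cnj \<kappa>"
    have "path_connected (\<Omega> \<kappa>0)" using \<Omega>(2)[OF \<kappa>0] simply_connected_imp_path_connected by blast
    then obtain \<gamma> where \<gamma>: "path \<gamma>" "path_image \<gamma> \<subseteq> \<Omega> \<kappa>0" "pathstart \<gamma> = 1" "pathfinish \<gamma> = ?c \<kappa>0"
      using \<Omega>(4,5)[OF \<kappa>0] unfolding path_connected_def by blast
    obtain e where e: "0 < e" "cball (?c \<kappa>0) e \<subseteq> \<Omega> \<kappa>0" using \<Omega>(1)[OF \<kappa>0] \<Omega>(5)[OF \<kappa>0] open_contains_cball by blast
    \<comment> \<open>A connected compact set joining \<open>1\<close> to a whole neighbourhood of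
      \<open>?c \<kappa>0\<close>. For nearby \<open>\<kappa>\<close> it lies in
      \<open>\<Omega> \<kappa>\<close> too, so the branches \<open>g \<kappa>\<close> and
      \<open>g \<kappa>0\<close> differ on it by a constant, which cancels in
      \<open>h\<close>.\<close>
    define K where "K = path_image \<gamma> \<union> cball (?c \<kappa>0) e"
    have K: "compact K" "K \<subseteq> \<Omega> \<kappa>0" "1 \<in> K" "cball (?c \<kappa>0) e \<subseteq> K"
      using \<gamma> e pathstart_in_path_image[of \<gamma>] by (auto simp: K_def)
    have "?c \<kappa>0 \<in> path_image \<gamma> \<inter> cball (?c \<kappa>0) e" using \<gamma>(4) e(1) pathfinish_in_path_image[of \<gamma>] by auto
    then have conn: "connected K" unfolding K_def
      by (intro connected_Un connected_path_image \<gamma>(1) convex_connected convex_cball) auto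
    obtain d where d: "0 < d" "\<And>\<kappa>. norm \<kappa> = 1 \<Longrightarrow> dist \<kappa> \<kappa>0 < d \<Longrightarrow> K \<subseteq> \<Omega> \<kappa>" using stable[OF \<kappa>0 K(1,2)] by blast
    have cont: "continuous (at \<kappa>0 within sphere 0 1) (\<lambda>\<kappa>. g \<kappa>0 (?c \<kappa>) - g \<kappa>0 1)"
    proof -
      have "isCont (g \<kappa>0) (?c \<kappa>0)"
        using g(1)[OF \<kappa>0] \<Omega>(1,5)[OF \<kappa>0] continuous_on_eq_continuous_at by blast
      moreover have "isCont ?c \<kappa>0" by (intro continuous_intros)
      ultimately have "isCont (\<lambda>\<kappa>. g \<kappa>0 (?c \<kappa>)) \<kappa>0" by (rule isCont_o2[rotated])
      then have "isCont (\<lambda>\<kappa>. g \<kappa>0 (?c \<kappa>) - g \<kappa>0 1) \<kappa>0" by (intro continuous_intros)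
      then show ?thesis by (rule continuous_at_imp_continuous_at_within)
    qed
    define d' where "d' = min d (e / \<rho>)"
    have d': "0 < d'" using d(1) e(1) \<rho> by (simp add: d'_def)
    show "continuous (at \<kappa>0 within sphere 0 1) h"
    proof (rule continuous_transform_within[OF cont d'])
      fix \<kappa> :: complex assume "\<kappa> \<in> sphere 0 1" and dist: "dist \<kappa> \<kappa>0 < d'"
      then have \<kappa>: "norm \<kappa> = 1" by simp
      have K\<kappa>: "K \<subseteq> \<Omega> \<kappa>" using d(2)[OF \<kappa>] dist by (simp add: d'_def)
      have "norm (?c \<kappa>0 - ?c \<kappa>) = \<rho> * norm (\<kappa>0 - \<kappa>)"
        using \<rho> by (simp add: norm_mult flip: right_diff_distrib complex_cnj_diff)
      also have "\<dots> < e" using dist \<rho> by (simp add: d'_def dist_norm norm_minus_commute field_simps)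
      finally have cK: "?c \<kappa> \<in> K" using K(4) by (auto simp: dist_norm)
      have "(\<lambda>z. g \<kappa> z - g \<kappa>0 z) constant_on K"
      proof (rule exp_1_constant_on[OF conn, where c = 1])
        show "continuous_on K (\<lambda>z. g \<kappa> z - g \<kappa>0 z)"
          using continuous_on_subset[OF g(1)[OF \<kappa>] K\<kappa>] continuous_on_subset[OF g(1)[OF \<kappa>0] K(2)]
          by (rule continuous_on_diff)
        show "exp (g \<kappa> z - g \<kappa>0 z) = 1" if "z \<in> K" for z
        proof -
          have z: "z \<in> \<Omega> \<kappa>" "z \<in> \<Omega> \<kappa>0" using that K\<kappa> K(2) by auto
          then have "z \<noteq> 0" using \<Omega>(3)[OF \<kappa>] by auto
          then show ?thesis using g(2)[OF \<kappa> z(1)] g(2)[OF \<kappa>0 z(2)] by (simp add: exp_diff)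
        qed
      qed
      then have "g \<kappa> (?c \<kappa>) - g \<kappa>0 (?c \<kappa>) = g \<kappa> 1 - g \<kappa>0 1"
        using cK K(3) unfolding constant_on_def by force
      then show "g \<kappa>0 (?c \<kappa>) - g \<kappa>0 1 = h \<kappa>" by (simp add: h_def algebra_simps)
    qed (use \<kappa>0 in simp)
  qed
  then have "continuous_on UNIV (\<lambda>\<theta>. h (cis \<theta>))"
    by (rule continuous_on_compose2) (auto intro!: continuous_intros)
  \<comment> \<open>\<open>exp (h (cis \<theta>))\<close> is \<open>\<rho>\<close> times the
    conjugate of \<open>cis \<theta>\<close>, so multiplying by \<open>cis \<theta>\<close> leaves
    the constant \<open>\<rho>\<close>. Then \<open>h (cis \<theta>)\<close> changes by -2 \<pi> i
    over a full turn, although it depends on the point of the circle only.\<close>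
  then have "(\<lambda>\<theta>. h (cis \<theta>) + \<i> * of_real \<theta>) constant_on UNIV"
  proof (intro exp_1_constant_on[where c = "of_real \<rho>"])
    show "exp (h (cis \<theta>) + \<i> * of_real \<theta>) = of_real \<rho>" for \<theta>
      by (simp add: exp_add exp_h cis_cnj mult.assoc cis_mult flip: cis_conv_exp)
  qed (auto intro!: continuous_intros)
  then have "h (cis 0) + \<i> * of_real 0 = h (cis (2 * pi)) + \<i> * of_real (2 * pi)"
    unfolding constant_on_def by (metis UNIV_I)
  then show False by (simp add: complex_eq_iff)
qed

text \<open>The complex linear form with real part \<open>A\<close>. For \<open>A\<close> the
  derivative of \<open>r\<close> it is twice the (1,0)-part of that derivative, and its kernel is
  the complex tangent space.\<close>

definition complex_gradient_form :: "(complex ^ 'n \<Rightarrow> real) \<Rightarrow> complex ^ 'n \<Rightarrow> complex" where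
  "complex_gradient_form A v = complex_of_real (A v) - \<i> * complex_of_real (A (\<i> *s v))"

lemma complex_gradient_form_linear:
  assumes "linear A"
  shows "complex_gradient_form A (v + w) = complex_gradient_form A v + complex_gradient_form A w"
    and "complex_gradient_form A (c *s v) = c * complex_gradient_form A v"
    and "Re (complex_gradient_form A v) = A v"
proof -
  note lin = linear_add[OF assms] linear_scale[OF assms]
  show "complex_gradient_form A (v + w) = complex_gradient_form A v + complex_gradient_form A w"
    by (simp add: complex_gradient_form_def lin vec.scale_right_distrib algebra_simps)
  have "c *s v = Re c *\<^sub>R v + Im c *\<^sub>R (\<i> *s v)" "\<i> *s (c *s v) = Re c *\<^sub>R (\<i> *s v) + (- Im c) *\<^sub>R v"
    by (simp_all add: vec_eq_iff complex_eq_iff)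
  then show "complex_gradient_form A (c *s v) = c * complex_gradient_form A v"
    by (simp only: complex_gradient_form_def lin) (simp add: complex_eq_iff)
  show "Re (complex_gradient_form A v) = A v" by (simp add: complex_gradient_form_def)
qed

text \<open>Passes from a section as a subset of the line to its parameter set in the plane; a
  nonzero coordinate of \<open>u\<close> recovers the parameter.\<close>

lemma simply_connected_section:
  fixes G :: "(complex ^ 'n) set"
  assumes "simply_connected (G \<inter> complex_line p u)" "u \<noteq> 0"
  shows "simply_connected {\<zeta>. p + \<zeta> *s u \<in> G}"
proof -
  obtain j where j: "u $ j \<noteq> 0" using assms(2) by (auto simp: vec_eq_iff)
  have "homeomorphism (G \<inter> complex_line p u) {\<zeta>. p + \<zeta> *s u \<in> G} (\<lambda>y. (y $ j - p $ j) / u $ j) (\<lambda>\<zeta>. p + \<zeta> *s u)"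
    unfolding homeomorphism_def
  proof (intro conjI ballI)
    show "continuous_on (G \<inter> complex_line p u) (\<lambda>y. (y $ j - p $ j) / u $ j)"
      using j by (intro continuous_intros) auto
    show "continuous_on {\<zeta>. p + \<zeta> *s u \<in> G} (\<lambda>\<zeta>. p + \<zeta> *s u)"
      by (intro continuous_intros linear_continuous_on bounded_linear_cmul_vec)
  qed (use j in \<open>auto simp: complex_line_def image_iff intro!: bexI[of _ "p + _ *s u"]\<close>)
  then have "(G \<inter> complex_line p u) homeomorphic {\<zeta>. p + \<zeta> *s u \<in> G}"
    unfolding homeomorphic_def by blast
  then show ?thesis using assms(1) homeomorphic_simply_connected by blast
qed

text \<open>Suppose \<open>x\<close> lies on the tangent hyperplane and let \<open>N\<close> be
  transversal. The lines through \<open>p\<close> and x + \<epsilon> \<kappa> N with |\<kappa>| = 1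
  have a point of the domain at parameter 1. Near \<open>p\<close> the sign of \<open>r\<close> is
  governed by the real part of the form, and the parameter \<rho> cnj(\<kappa>) undoes the rotation:
  the form takes the value -\<rho> \<epsilon> there. So the parameter sets satisfy the hypotheses of
  \<open>no_rotating_sections\<close>, with \<open>p\<close> at the missing parameter 0.\<close>

lemma tangent_hyperplane_misses_domain:
  fixes G :: "(complex ^ 'n) set"
  assumes "open G"
    and sections: "\<And>p v. v \<noteq> 0 \<Longrightarrow> G \<inter> complex_line p v \<noteq> {} \<Longrightarrow> simply_connected (G \<inter> complex_line p v)"
    and r': "(r has_derivative r') (at p)" "r p = 0" "r' w \<noteq> 0"
    and G: "p \<notin> G" "0 < e" "\<And>y. dist y p < e \<Longrightarrow> r y < 0 \<Longrightarrow> y \<in> G"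
    and x: "x \<in> G"
  shows "complex_gradient_form r' (x - p) \<noteq> 0"
proof
  define L where "L = complex_gradient_form r'"
  define v where "v = x - p"
  have lin: "linear r'" using r'(1) has_derivative_linear by blast
  note L = complex_gradient_form_linear[OF lin, folded L_def]
  assume "complex_gradient_form r' (x - p) = 0"
  then have Lv: "L v = 0" by (simp add: L_def v_def)
  have Lw: "L w \<noteq> 0" using L(3)[of w] r'(3) by auto
  define N where "N = (- 1 / L w) *s w"
  have LN: "L N = - 1" unfolding N_def L(2) using Lw by simp
  obtain e' where e': "0 < e'" "ball x e' \<subseteq> G" using assms(1) x openE by blast
  have nN: "norm N + 1 > 0" using norm_ge_zero[of N] by linarith
  define \<epsilon> where "\<epsilon> = e' / (norm N + 1)"
  have \<epsilon>: "0 < \<epsilon>" "\<epsilon> * norm N < e'" using e' nN by (auto simp: \<epsilon>_def field_simps)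
  define m where "m = norm v + \<epsilon> * norm N + 1"
  have m: "m > 0" using norm_ge_zero[of v] norm_ge_zero[of N] \<epsilon>(1) by (simp add: m_def add_nonneg_pos)
  have "0 < \<epsilon> / (2 * m)" using \<epsilon> m by simp
  then obtain \<delta> where \<delta>: "0 < \<delta>" "\<And>y. norm (y - p) < \<delta> \<Longrightarrow> norm (r y - r p - r' (y - p)) \<le> \<epsilon> / (2 * m) * norm (y - p)"
    using r'(1) unfolding has_derivative_at_alt by blast
  \<comment> \<open>Keeps the point at parameter \<open>of_real \<rho> * cnj \<kappa>\<close> closer
    to \<open>p\<close> than \<open>\<delta>\<close> and \<open>e\<close>; the linearisation error
    is then at most half of \<open>\<rho> * \<epsilon>\<close>.\<close>
  define \<rho> where "\<rho> = min \<delta> e / (2 * m)"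
  have \<rho>: "0 < \<rho>" "\<rho> * m < \<delta>" "\<rho> * m < e" using \<delta>(1) G(2) m by (auto simp: \<rho>_def)
  define u where "u \<kappa> = v + (of_real \<epsilon> * \<kappa>) *s N" for \<kappa>
  have Lu: "L (u \<kappa>) = - (of_real \<epsilon> * \<kappa>)" for \<kappa> by (simp add: u_def L(1,2) Lv LN)
  have u0: "u \<kappa> \<noteq> 0" if "norm \<kappa> = 1" for \<kappa>
  proof
    assume "u \<kappa> = 0"
    then have "L (u \<kappa>) = 0" using L(2)[of 0 0] by simp
    then show False using Lu[of \<kappa>] \<epsilon>(1) that by auto
  qed
  define \<Omega> where "\<Omega> \<kappa> = {\<zeta>. p + \<zeta> *s u \<kappa> \<in> G}" for \<kappa>
  have cont: "continuous_on UNIV (\<lambda>\<zeta>. p + \<zeta> *s u \<kappa>)" for \<kappa>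
    by (intro continuous_intros linear_continuous_on bounded_linear_cmul_vec)
  show False
  proof (rule no_rotating_sections[of \<Omega> \<rho>])
    fix \<kappa> :: complex assume \<kappa>: "norm \<kappa> = 1"
    show "open (\<Omega> \<kappa>)" unfolding \<Omega>_def
      using open_vimage[OF assms(1) cont[of \<kappa>]] by (simp add: vimage_def)
    show 1: "1 \<in> \<Omega> \<kappa>"
    proof -
      have "norm ((of_real \<epsilon> * \<kappa>) *s N) < e'" using \<epsilon> \<kappa> by (simp add: norm_cmul_vec norm_mult)
      then have "x + (of_real \<epsilon> * \<kappa>) *s N \<in> G" using e'(2) by (auto simp: subset_iff dist_norm)
      then show ?thesis by (simp add: \<Omega>_def u_def v_def)
    qed
    have "G \<inter> complex_line p (u \<kappa>) \<noteq> {}" using 1 unfolding \<Omega>_def complex_line_def by blast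
    then show "simply_connected (\<Omega> \<kappa>)" unfolding \<Omega>_def
      by (intro simply_connected_section sections u0[OF \<kappa>])
    show "0 \<notin> \<Omega> \<kappa>" using G(1) by (simp add: \<Omega>_def)
    show "of_real \<rho> * cnj \<kappa> \<in> \<Omega> \<kappa>"
    proof -
      define y where "y = p + (of_real \<rho> * cnj \<kappa>) *s u \<kappa>"
      have "norm (u \<kappa>) \<le> norm v + \<epsilon> * norm N"
        unfolding u_def using norm_triangle_ineq[of v "(of_real \<epsilon> * \<kappa>) *s N"] \<epsilon>(1) \<kappa> by (simp add: norm_cmul_vec norm_mult)
      then have "norm (u \<kappa>) \<le> m" by (simp add: m_def)
      then have ny: "norm (y - p) \<le> \<rho> * m" using \<rho>(1) \<kappa> by (simp add: y_def norm_cmul_vec norm_mult)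
      have "L (y - p) = - of_real (\<rho> * \<epsilon>)"
        using \<kappa> complex_norm_square[of \<kappa>] by (simp add: y_def L(2) Lu mult_ac)
      then have "r' (y - p) = - (\<rho> * \<epsilon>)" using L(3)[of "y - p"] by simp
      moreover have "norm (r y - r p - r' (y - p)) \<le> \<epsilon> / (2 * m) * norm (y - p)" using ny \<rho> by (intro \<delta>(2)) auto
      moreover have "\<epsilon> / (2 * m) * norm (y - p) \<le> \<epsilon> / (2 * m) * (\<rho> * m)" using ny \<epsilon> m by (intro mult_left_mono) auto
      moreover have "\<epsilon> / (2 * m) * (\<rho> * m) = \<rho> * \<epsilon> / 2" using m by (simp add: field_simps)
      moreover have "0 < \<rho> * \<epsilon>" using \<rho> \<epsilon> by simp
      ultimately have "r y < 0" using r'(2) unfolding real_norm_def by linarith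
      moreover have "dist y p < e" using ny \<rho> by (simp add: dist_norm)
      ultimately show ?thesis using G(3) by (simp add: \<Omega>_def y_def)
    qed
  next
    fix \<kappa>0 :: complex and K assume \<kappa>0: "norm \<kappa>0 = 1" and K: "compact K" "K \<subseteq> \<Omega> \<kappa>0"
    let ?T = "(\<lambda>\<zeta>. p + \<zeta> *s u \<kappa>0) ` K"
    have "compact ?T" by (intro compact_continuous_image K(1) continuous_on_subset[OF cont]) auto
    moreover have "?T \<subseteq> G" using K(2) by (auto simp: \<Omega>_def)
    ultimately obtain d where d: "0 < d" "(\<Union>y\<in>?T. ball y d) \<subseteq> G"
      using compact_subset_open_imp_ball_epsilon_subset[OF _ assms(1)] by metis
    obtain B where B: "0 < B" "\<And>\<zeta>. \<zeta> \<in> K \<Longrightarrow> norm \<zeta> \<le> B" using compact_imp_bounded[OF K(1)] bounded_pos by metis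
    have BN: "0 < B * \<epsilon> * (norm N + 1)" using B(1) \<epsilon>(1) nN by simp
    show "\<exists>d>0. \<forall>\<kappa>. norm \<kappa> = 1 \<longrightarrow> dist \<kappa> \<kappa>0 < d \<longrightarrow> K \<subseteq> \<Omega> \<kappa>"
    proof (intro exI[of _ "d / (B * \<epsilon> * (norm N + 1))"] conjI allI impI subsetI)
      show "0 < d / (B * \<epsilon> * (norm N + 1))" using d(1) BN by simp
      fix \<kappa> \<zeta> assume \<kappa>: "dist \<kappa> \<kappa>0 < d / (B * \<epsilon> * (norm N + 1))" and \<zeta>: "\<zeta> \<in> K"
      have "p + \<zeta> *s u \<kappa> - (p + \<zeta> *s u \<kappa>0) = (\<zeta> * of_real \<epsilon> * (\<kappa> - \<kappa>0)) *s N"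
        by (simp add: u_def vec_eq_iff algebra_simps)
      then have "dist (p + \<zeta> *s u \<kappa>0) (p + \<zeta> *s u \<kappa>) = norm \<zeta> * \<epsilon> * dist \<kappa> \<kappa>0 * norm N"
        using \<epsilon>(1) by (simp only: dist_norm norm_minus_commute[of "p + \<zeta> *s u \<kappa>0"]) (simp add: norm_cmul_vec norm_mult)
      also have "\<dots> \<le> B * \<epsilon> * dist \<kappa> \<kappa>0 * (norm N + 1)"
        using B(2)[OF \<zeta>] \<epsilon>(1) B(1) by (intro mult_mono) auto
      also have "\<dots> = dist \<kappa> \<kappa>0 * (B * \<epsilon> * (norm N + 1))" by (simp add: mult_ac)
      also have "\<dots> < d" using \<kappa> BN by (simp only: pos_less_divide_eq)
      finally have "p + \<zeta> *s u \<kappa> \<in> ball (p + \<zeta> *s u \<kappa>0) d" by simp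
      then have "p + \<zeta> *s u \<kappa> \<in> G" using d(2) \<zeta> by blast
      then show "\<zeta> \<in> \<Omega> \<kappa>" by (simp add: \<Omega>_def)
    qed
  qed (rule \<rho>(1))
qed

text \<open>Split off a root \<open>z\<close>, which satisfies |z| > t: P = (X - z) Q, and the
  coefficient of index d of P is Q_(d-1) - z Q_d. Multiplied by t^d, each of the two terms is at
  most 2^(deg Q) |z Q_0|, where |z Q_0| = |P_0|. Every root thus contributes a factor 2.\<close>

lemma nonvanishing_poly_coeff_bound:
  fixes P :: "complex poly"
  assumes "0 \<le> t" "\<And>z. norm z \<le> t \<Longrightarrow> poly P z \<noteq> 0"
  shows "norm (coeff P d) * t ^ d \<le> 2 ^ degree P * norm (coeff P 0)"
  using assms(2)
proof (induction "degree P" arbitrary: P d)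
  case 0
  then show ?case
    using coeff_eq_0[of P d] by (cases d) auto
next
  case (Suc D)
  have "\<not> constant (poly P)" using Suc.hyps(2) by (simp add: constant_degree)
  then obtain z where z: "poly P z = 0" using fundamental_theorem_of_algebra by blast
  then obtain Q where P: "P = [:- z, 1:] * Q" using poly_eq_0_iff_dvd by blast
  have Q0: "Q \<noteq> 0" using P Suc.hyps(2) by auto
  have "degree P = Suc (degree Q)" unfolding P using Q0 by (subst degree_mult_eq) auto
  then have D: "D = degree Q" using Suc.hyps(2) by simp
  have zt: "t < norm z" using Suc.prems[of z] z by force
  have Q: "poly Q w \<noteq> 0" if "norm w \<le> t" for w using Suc.prems[OF that] by (auto simp: P)
  have IH: "norm (coeff Q e) * t ^ e \<le> 2 ^ D * norm (coeff Q 0)" for e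
    using Suc.hyps(1)[OF D Q] D by simp
  have c0: "coeff P 0 = - z * coeff Q 0" by (simp add: P)
  have b: "norm (z * coeff Q e) * t ^ e \<le> 2 ^ D * norm (coeff P 0)" for e
    using mult_left_mono[OF IH[of e] norm_ge_zero[of z]] by (simp add: c0 norm_mult mult_ac)
  show ?case
  proof (cases d)
    case 0
    have "(1::real) \<le> 2 ^ degree P" by simp
    from mult_right_mono[OF this norm_ge_zero[of "coeff P 0"]] show ?thesis by (simp add: 0)
  next
    case (Suc e)
    have "norm (coeff P d) * t ^ d \<le> (norm (z * coeff Q d) + norm (coeff Q e)) * t ^ d"
      using assms(1) norm_triangle_ineq[of "- (z * coeff Q d)" "coeff Q e"]
      by (intro mult_right_mono) (auto simp: P Suc coeff_pCons)
    also have "\<dots> = norm (z * coeff Q d) * t ^ d + t * (norm (coeff Q e) * t ^ e)" by (simp add: Suc algebra_simps)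
    also have "\<dots> \<le> 2 ^ D * norm (coeff P 0) + norm z * (2 ^ D * norm (coeff Q 0))"
      using zt assms(1) by (intro add_mono b mult_mono IH) auto
    also have "\<dots> = 2 ^ degree P * norm (coeff P 0)"
      by (simp add: c0 norm_mult D flip: Suc.hyps(2))
    finally show ?thesis .
  qed
qed

lemma C_infinity_on_Lipschitz:
  fixes f :: "'a::euclidean_space \<Rightarrow> 'b::real_normed_vector"
  assumes "C_infinity_on f (ball 0 R)" "0 < R"
  shows "\<exists>B e. 0 \<le> B \<and> 0 < e \<and> e \<le> R \<and> (\<forall>x y. norm x < e \<longrightarrow> norm y < e \<longrightarrow> norm (f x - f y) \<le> B * norm (x - y))"
proof -
  have "bigo_on UNIV 0 (\<lambda>x. \<Sum>b\<in>Basis. norm (deriv_along b f x))"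
    by (intro bigo_on_sum_norm C_infinity_on_bigo_0[OF _ assms(2)] C_infinity_on_deriv_along assms(1)) auto
  then obtain B e where B: "0 \<le> B" "0 < e" "\<And>x. norm x < e \<Longrightarrow> norm (\<Sum>b\<in>Basis. norm (deriv_along b f x)) \<le> B"
    unfolding bigo_on_def by auto
  have "norm (f x - f y) \<le> B * norm (x - y)" if "norm x < min e R" "norm y < min e R" for x y
  proof (rule differentiable_bound[of "ball 0 (min e R)" f "\<lambda>x v. deriv_along v f x"])
    fix x :: 'a assume x: "x \<in> ball 0 (min e R)"
    then have d: "(f has_derivative (\<lambda>v. deriv_along v f x)) (at x)"
      using C_infinity_on_has_derivative[OF assms(1)] by auto
    then show "(f has_derivative (\<lambda>v. deriv_along v f x)) (at x within ball 0 (min e R))"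
      by (rule has_derivative_at_withinI)
    have L: "linear (\<lambda>v. deriv_along v f x)" using d has_derivative_linear by blast
    show "onorm (\<lambda>v. deriv_along v f x) \<le> B"
    proof (rule onorm_le)
      fix w
      have "norm (deriv_along w f x) \<le> norm w * (\<Sum>b\<in>Basis. norm (deriv_along b f x))"
        by (rule linear_norm_le_Basis[OF L])
      also have "\<dots> \<le> norm w * B" using B(3)[of x] x by (intro mult_left_mono) auto
      finally show "norm (deriv_along w f x) \<le> B * norm w" by (simp add: mult.commute)
    qed
  qed (use that in auto)
  then show ?thesis using B assms(2) by (intro exI[of _ B] exI[of _ "min e R"]) auto
qed

subsection \<open>Local geometry of a weakly linearly convex boundary point\<close>

text \<open>The boundary point is moved to the origin, and the domain enters only as the set where
  \<open>r\<close> is negative in the ball. \<open>wlc\<close> says that the complex tangent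
  hyperplane at each nearby boundary point misses this set.\<close>

locale weakly_linearly_convex_germ =
  fixes r :: "complex ^ 'n::finite \<Rightarrow> real" and R :: real
  assumes R: "0 < R" and smooth: "C_infinity_on r (ball 0 R)" and r0: "r 0 = 0"
    and nondegenerate: "\<exists>w. deriv_along w r 0 \<noteq> 0"
    and wlc: "\<And>p x. norm p < R \<Longrightarrow> norm x < R \<Longrightarrow> r p = 0 \<Longrightarrow> r x < 0 \<Longrightarrow>
       complex_gradient_form (\<lambda>v. deriv_along v r p) (x - p) \<noteq> 0"
begin

definition L :: "complex ^ 'n \<Rightarrow> complex ^ 'n \<Rightarrow> complex" where
  "L p = complex_gradient_form (\<lambda>v. deriv_along v r p)"

lemma L_linear:
  assumes "norm p < R"
  shows "L p (v + w) = L p v + L p w" "L p (c *s v) = c * L p v" "Re (L p v) = deriv_along v r p"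
proof -
  have "linear (\<lambda>v. deriv_along v r p)"
    using C_infinity_on_has_derivative[OF smooth, of p] assms has_derivative_linear by auto
  from complex_gradient_form_linear[OF this]
  show "L p (v + w) = L p v + L p w" "L p (c *s v) = c * L p v" "Re (L p v) = deriv_along v r p"
    unfolding L_def by auto
qed

lemma L_sum:
  assumes "norm p < R"
  shows "L p (\<Sum>i\<in>I. v i) = (\<Sum>i\<in>I. L p (v i))"
proof -
  have "L p 0 = 0" using L_linear(2)[OF assms, of 0 0] by simp
  then show ?thesis by (induction I rule: infinite_finite_induct) (auto simp: L_linear(1)[OF assms])
qed

text \<open>This is \<open>wlc\<close> at the boundary point 0 itself, the source of the lower
  bounds for \<open>r\<close>.\<close>

lemma tangential_nonneg: "L 0 v = 0 \<Longrightarrow> norm v < R \<Longrightarrow> 0 \<le> r v"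
  using wlc[of 0 v] R r0 by (force simp: L_def)

text \<open>\<open>N\<close> is scaled to have derivative -1 at 0, so the derivative along it stays
  between -3/2 and -1/2 nearby. The first inequality on \<open>r\<close> pushes points with small
  \<open>r\<close> into the domain; the second one returns from a point of the domain to an upper
  bound for \<open>r\<close>.\<close>

lemma inner_normal:
  "\<exists>N R1. 0 < R1 \<and> R1 \<le> R \<and> (\<forall>x e. norm x < R1 \<longrightarrow> 0 \<le> e \<longrightarrow> e < R1 \<longrightarrow>
     norm (x + e *\<^sub>R N) < R \<and> r (x + e *\<^sub>R N) \<le> r x - e / 2 \<and> r x \<le> r (x + e *\<^sub>R N) + 3 / 2 * e)"
proof -
  obtain w where w: "deriv_along w r 0 \<noteq> 0" using nondegenerate by blast
  define N where "N = (- 1 / deriv_along w r 0) *\<^sub>R w"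
  have N: "deriv_along N r 0 = - 1"
    using linear_scale[OF has_derivative_linear[OF C_infinity_on_has_derivative[OF smooth]], of 0 "- 1 / deriv_along w r 0" w] w R
    by (simp add: N_def)
  have "isCont (deriv_along N r) 0"
    using C_infinity_on_continuous_on[OF C_infinity_on_deriv_along[OF smooth]] R
      continuous_on_eq_continuous_at[of "ball 0 R" "deriv_along N r"] by auto
  moreover have "(1/2 :: real) > 0" by simp
  ultimately obtain d where d: "d > 0" "\<And>y. dist y 0 < d \<Longrightarrow> dist (deriv_along N r y) (- 1) < 1/2"
    unfolding continuous_at_eps_delta N by blast
  have nN: "norm N + 1 > 0" using norm_ge_zero[of N] by linarith
  define R1 where "R1 = min R (min d R / (2 * (norm N + 1)))"
  have R1: "0 < R1" "R1 \<le> R" "R1 * (2 * (norm N + 1)) \<le> min d R"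
  proof -
    show "0 < R1" using R d(1) nN by (simp add: R1_def)
    have "R1 \<le> min d R / (2 * (norm N + 1))" by (simp add: R1_def)
    then show "R1 * (2 * (norm N + 1)) \<le> min d R" using nN by (simp only: pos_le_divide_eq[OF mult_pos_pos[OF zero_less_numeral nN]])
  qed (simp add: R1_def)
  have "norm (x + e *\<^sub>R N) < R \<and> r (x + e *\<^sub>R N) \<le> r x - e / 2 \<and> r x \<le> r (x + e *\<^sub>R N) + 3 / 2 * e" if x: "norm x < R1" "0 \<le> e" "e < R1" for x e
  proof -
    have near: "norm (x + s *\<^sub>R N) < min d R" if "0 \<le> s" "s \<le> e" for s
    proof -
      have "norm (x + s *\<^sub>R N) \<le> norm x + s * norm N" using norm_triangle_ineq[of x "s *\<^sub>R N"] that by simp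
      also have "\<dots> < R1 + R1 * norm N" using that x by (intro add_less_le_mono mult_right_mono) auto
      also have "\<dots> = R1 * (norm N + 1)" by (simp add: algebra_simps)
      also have "\<dots> \<le> R1 * (2 * (norm N + 1))" using R1(1) nN by (intro mult_left_mono) auto
      finally show ?thesis using R1(3) by linarith
    qed
    have "norm (r (x + e *\<^sub>R N) - r (x + 0 *\<^sub>R N) - e *\<^sub>R (- 1)) \<le> 1/2 * e"
    proof (rule vector_derivative_linear_bound[of e "\<lambda>s. r (x + s *\<^sub>R N)" "\<lambda>s. deriv_along N r (x + s *\<^sub>R N)"])
      fix s assume s: "s \<in> {0..e}"
      show "((\<lambda>s. r (x + s *\<^sub>R N)) has_vector_derivative deriv_along N r (x + s *\<^sub>R N)) (at s)"
        using near[of s] s by (intro has_vector_derivative_along[OF smooth]) auto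
      show "norm (deriv_along N r (x + s *\<^sub>R N) - - 1) \<le> 1/2"
        using d(2)[of "x + s *\<^sub>R N"] near[of s] s by (auto simp: dist_norm)
    qed (use x in auto)
    then have "\<bar>r (x + e *\<^sub>R N) - r x + e\<bar> \<le> e / 2" by simp
    then have "r (x + e *\<^sub>R N) - r x + e \<le> e / 2" "- (r (x + e *\<^sub>R N) - r x + e) \<le> e / 2" by (simp_all only: abs_le_iff)
    moreover have "norm (x + e *\<^sub>R N) < R" using near[of e] x by simp
    ultimately show ?thesis by (intro conjI; linarith)
  qed
  then show ?thesis using R1 by (intro exI[of _ N] exI[of _ R1]) auto
qed

text \<open>If \<open>q + z\<close> is outside, the segment from \<open>q\<close> to it meets the
  boundary at p = q + t z. The complex tangent hyperplane at \<open>p\<close> misses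
  \<open>q\<close> and all \<open>q + y\<close>, so with \<open>M = L p\<close> and
  \<open>A = L p (q - p)\<close> the affine form \<open>A + M y\<close> has no zero on
  \<open>Y\<close>. But A = -t M z with t \<le> 1, contrary to \<open>forms\<close>. The hypothesis
  \<open>forms\<close> is thus a dual description of a linearly convex hull of
  \<open>Y\<close>.\<close>

lemma hull:
  assumes "norm q < R" "r q < 0" "\<And>y. y \<in> Y \<Longrightarrow> norm (q + y) < R \<and> r (q + y) < 0"
    and z: "\<And>t. 0 \<le> t \<Longrightarrow> t \<le> 1 \<Longrightarrow> norm (q + t *\<^sub>R z) < R"
    and forms: "\<And>M A. A \<noteq> 0 \<Longrightarrow> (\<And>v w. M (v + w) = M v + M w) \<Longrightarrow> (\<And>c v. M (c *s v) = c * M v) \<Longrightarrow>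
        (\<And>y. y \<in> Y \<Longrightarrow> A + M y \<noteq> 0) \<Longrightarrow> norm (M z) < norm A"
  shows "r (q + z) < 0"
proof (rule ccontr)
  assume "\<not> r (q + z) < 0"
  then have "0 \<le> r (q + 1 *\<^sub>R z)" by simp
  moreover have "r (q + 0 *\<^sub>R z) \<le> 0" using assms(2) by simp
  moreover have "continuous_on {0..1} (\<lambda>t. r (q + t *\<^sub>R z))"
    by (rule continuous_on_compose2[OF C_infinity_on_continuous_on[OF smooth]])
      (use z in \<open>auto intro!: continuous_intros\<close>)
  ultimately obtain t where t: "0 \<le> t" "t \<le> 1" "r (q + t *\<^sub>R z) = 0"
    using IVT'[of "\<lambda>t. r (q + t *\<^sub>R z)" 0 0 1] by auto
  define p where "p = q + t *\<^sub>R z"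
  have p: "norm p < R" "r p = 0" using z t by (auto simp: p_def)
  note lin = L_linear[OF p(1)]
  have diff: "L p (v - w) = L p v - L p w" for v w using lin(1)[of "v - w" w] by simp
  have "norm (L p z) < norm (L p (q - p))"
  proof (rule forms)
    show "L p (q - p) \<noteq> 0" using wlc[OF p(1) assms(1) p(2) assms(2)] by (simp add: L_def)
    show "L p (q - p) + L p y \<noteq> 0" if "y \<in> Y" for y
      using wlc[OF p(1) _ p(2), of "q + y"] assms(3)[OF that] lin(1)[of "q - p" y] by (simp add: L_def algebra_simps)
  qed (use lin in auto)
  moreover have "norm (L p (q - p)) \<le> norm (L p z)"
  proof -
    have "q - p = of_real (- t) *s z" by (simp add: p_def vec_eq_iff) (simp add: scaleR_conv_of_real)
    then have "norm (L p (q - p)) = t * norm (L p z)" using t by (simp add: lin(2) norm_mult del: of_real_minus)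
    also have "\<dots> \<le> norm (L p z)" using t by (simp add: mult_left_le_one_le)
    finally show ?thesis .
  qed
  ultimately show False by simp
qed

text \<open>\<open>V m\<close> collects the directions in which the complex line through the origin has order of contact at least \<open>m\<close>.\<close>

definition V :: "nat \<Rightarrow> (complex ^ 'n) set" where
  "V m = {v. bigo_on UNIV m (\<lambda>\<eta>. r (\<eta> *s v))}"

lemma V_antimono: "m \<le> m' \<Longrightarrow> V m' \<subseteq> V m"
  unfolding V_def using bigo_on_mono by blast

lemma line_smooth: "\<exists>e>0. C_infinity_on (\<lambda>\<eta>. r (\<eta> *s v)) (ball 0 e)"
proof -
  obtain e where e: "0 < e" "\<And>\<eta>. norm \<eta> \<le> e \<Longrightarrow> norm (\<eta> *s v) < R"
    using cmul_vec_small[OF R, of v] by blast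
  have "C_infinity_on (r \<circ> (\<lambda>\<eta>. 0 + \<eta> *s v)) (ball 0 e)"
    by (rule C_infinity_on_compose[OF open_ball open_ball _ C_infinity_on_affine smooth])
      (use e(2) in \<open>auto intro: bounded_linear_cmul_vec\<close>)
  then show ?thesis using e(1) by (auto simp: o_def)
qed

lemma V_1: "v \<in> V 1"
proof -
  obtain e where e: "e > 0" "C_infinity_on (\<lambda>\<eta>. r (\<eta> *s v)) (ball 0 e)" using line_smooth by blast
  show ?thesis unfolding V_def mem_Collect_eq bigo_on_iff_iterated_derivative[OF e(2,1)] using r0 by auto
qed

text \<open>Order at least 2 makes the derivatives at 0 along \<open>v\<close> and
  \<open>\<i> *s v\<close> vanish, and these are, up to sign, the real and imaginary parts of
  \<open>L 0 v\<close>.\<close>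

lemma V_tangential:
  assumes "v \<in> V m" "2 \<le> m"
  shows "L 0 v = 0"
proof -
  obtain e where e: "e > 0" "C_infinity_on (\<lambda>\<eta>. r (\<eta> *s v)) (ball 0 e)" using line_smooth by blast
  have "\<forall>vs. length vs < m \<longrightarrow> iterated_derivative (\<lambda>\<eta>. r (\<eta> *s v)) vs 0 = 0"
    using assms(1) unfolding V_def mem_Collect_eq bigo_on_iff_iterated_derivative[OF e(2,1)] .
  from this[rule_format, of "[_]"]
  have z: "deriv_along h (\<lambda>\<eta>. r (\<eta> *s v)) 0 = 0" for h using assms(2) by (simp add: deriv_along_def)
  have "((\<lambda>\<eta>. \<eta> *s v) has_derivative (\<lambda>h. h *s v)) (at 0)"
    using bounded_linear.has_derivative[OF bounded_linear_cmul_vec has_derivative_ident] .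
  from diff_chain_at[OF this, of r "\<lambda>w. deriv_along w r 0"]
  have "((\<lambda>\<eta>. r (\<eta> *s v)) has_derivative (\<lambda>h. deriv_along (h *s v) r 0)) (at 0)"
    using C_infinity_on_has_derivative[OF smooth, of 0] R by (simp add: o_def)
  from deriv_along_eq[OF this] z have "deriv_along (h *s v) r 0 = 0" for h by metis
  from this[of 1] this[of \<i>] show ?thesis by (simp add: L_def complex_gradient_form_def)
qed

text \<open>An upper bound alone suffices, since \<open>r\<close> is nonnegative in complex tangential directions.\<close>

lemma V_SucI:
  assumes "0 < d" "l * d < s" "0 < c" "0 < t0"
    and bd: "\<And>t \<eta>. 0 < t \<Longrightarrow> t < t0 \<Longrightarrow> norm \<eta> \<le> c * t ^ d \<Longrightarrow> r (\<eta> *s v) \<le> C * t ^ s"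
  shows "v \<in> V (Suc l)"
proof (cases "l = 0")
  case True
  then show ?thesis using V_1 by simp
next
  case False
  then have ds: "Suc d \<le> s" using assms(2) by (cases l) auto
  obtain e where e: "e > 0" "C_infinity_on (\<lambda>\<eta>. r (\<eta> *s v)) (ball 0 e)" using line_smooth by blast
  define C' where "C' = max C 0"
  have bd': "r (\<eta> *s v) \<le> C' * t ^ s" if "0 < t" "t < t0" "norm \<eta> \<le> c * t ^ d" for t \<eta>
  proof -
    have "C * t ^ s \<le> C' * t ^ s" using that by (intro mult_right_mono) (auto simp: C'_def)
    then show ?thesis using bd[OF that] by linarith
  qed
  have C': "C' \<ge> 0" by (simp add: C'_def)
  \<comment> \<open>If \<open>v\<close> were transversal, a rotation of the parameter would make
    \<open>r\<close> grow at least linearly. At |\<eta>| = c t^d this gives a lower bound of order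
    t^d, against the upper bound of order t^s with \<open>s \<ge> Suc d\<close>.\<close>
  have tang: "L 0 v = 0"
  proof (rule ccontr)
    assume Lv: "L 0 v \<noteq> 0"
    define u where "u = cnj (L 0 v) / norm (L 0 v)"
    have u: "norm u = 1" using Lv by (simp add: u_def norm_divide)
    define w where "w = u *s v"
    define k where "k = norm (L 0 v)"
    have k: "k > 0" using Lv by (simp add: k_def)
    have "L 0 w = of_real k"
      using Lv complex_norm_square[of "L 0 v"] R by (simp add: w_def k_def u_def L_linear(2) field_simps power2_eq_square)
    then have Dw: "deriv_along w r 0 = k" using L_linear(3)[of 0 w] R by simp
    have "(r has_derivative (\<lambda>v. deriv_along v r 0)) (at 0)" using C_infinity_on_has_derivative[OF smooth, of 0] R by simp
    moreover have nw: "norm w + 1 > 0" using norm_ge_zero[of w] by linarith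
    then have "k / (2 * (norm w + 1)) > 0" using k by simp
    ultimately obtain \<delta> where \<delta>: "0 < \<delta>" "\<And>y. norm y < \<delta> \<Longrightarrow> norm (r y - deriv_along y r 0) \<le> k / (2 * (norm w + 1)) * norm y"
      unfolding has_derivative_at_alt using r0 by fastforce
    have lower: "\<tau> * (k / 2) \<le> r ((of_real \<tau> * u) *s v)" if "0 < \<tau>" "\<tau> * (norm w + 1) < \<delta>" for \<tau>
    proof -
      have eq: "(of_real \<tau> * u) *s v = \<tau> *\<^sub>R w" by (simp add: w_def vec_eq_iff) (simp add: scaleR_conv_of_real mult.assoc)
      have n: "norm (\<tau> *\<^sub>R w) \<le> \<tau> * (norm w + 1)" using that by (simp add: mult_left_mono)
      then have "norm (r (\<tau> *\<^sub>R w) - deriv_along (\<tau> *\<^sub>R w) r 0) \<le> k / (2 * (norm w + 1)) * norm (\<tau> *\<^sub>R w)"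
        using that n by (intro \<delta>(2)) linarith
      also have "\<dots> \<le> k / (2 * (norm w + 1)) * (\<tau> * (norm w + 1))" using n k nw by (intro mult_left_mono) auto
      also have "\<dots> = \<tau> * (k / 2)" using nw by (simp add: nonzero_divide_eq_eq)
      finally have "norm (r (\<tau> *\<^sub>R w) - deriv_along (\<tau> *\<^sub>R w) r 0) \<le> \<tau> * (k / 2)" .
      moreover have "deriv_along (\<tau> *\<^sub>R w) r 0 = \<tau> * k"
        using linear_scale[OF has_derivative_linear[OF C_infinity_on_has_derivative[OF smooth]], of 0 \<tau> w] Dw R by simp
      ultimately show ?thesis unfolding eq by (simp only: real_norm_def abs_le_iff) argo
    qed
    \<comment> \<open>Small enough for the linearisation at radius \<open>c * t ^ d\<close>, and for
      \<open>C' * t\<close> to be at most a quarter of \<open>c * k\<close>.\<close>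
    define t where "t = min (t0 / 2) (min (1/2) (min (\<delta> / (2 * c * (norm w + 1))) (c * k / (4 * (C' + 1)))))"
    have t: "0 < t" "t < t0" "t < 1" using assms(3,4) \<delta>(1) nw k C' by (auto simp: t_def)
    have "t \<le> \<delta> / (2 * c * (norm w + 1))" by (simp add: t_def)
    then have t1: "t * (c * (norm w + 1)) \<le> \<delta> / 2"
      using pos_le_divide_eq[of "2 * c * (norm w + 1)" t \<delta>] assms(3) nw by (simp add: mult_ac)
    have "t \<le> c * k / (4 * (C' + 1))" by (simp add: t_def)
    then have t2: "t * (4 * (C' + 1)) \<le> c * k" using C' by (subst (asm) pos_le_divide_eq) auto
    have td: "t ^ d \<le> t ^ 1" using t assms(1) by (intro power_decreasing) auto
    have "c * t ^ d * (norm w + 1) \<le> t * (c * (norm w + 1))"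
      using mult_right_mono[OF td, of "c * (norm w + 1)"] assms(3) nw by (simp add: mult_ac)
    then have small: "c * t ^ d * (norm w + 1) < \<delta>" using t1 \<delta>(1) by linarith
    have "c * t ^ d * (k / 2) \<le> r ((of_real (c * t ^ d) * u) *s v)"
      using small t assms(3) by (intro lower) auto
    also have "\<dots> \<le> C' * t ^ s"
      using t assms(3) u by (intro bd') (auto simp: norm_mult norm_power)
    also have "\<dots> \<le> C' * t ^ Suc d" using t C' ds by (intro mult_left_mono power_decreasing) auto
    finally have "t ^ d * (c * k / 2) \<le> t ^ d * (C' * t)" by (simp add: mult_ac)
    then have "c * k / 2 \<le> C' * t" using t by simp
    moreover have "C' * t \<le> (c * k) / 4" using t2 t by (simp add: algebra_simps)
    moreover have "c * k > 0" using assms(3) k by simp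
    ultimately show False by linarith
  qed
  have bb: "box_bigo (norm_box d) s (\<lambda>\<eta>. r (\<eta> *s v))"
    unfolding box_bigo_def
  proof (intro allI impI)
    fix A :: real assume A: "0 < A"
    \<comment> \<open>A box with arbitrary constant \<open>A\<close> is covered by the hypothesis at
      the larger scale \<open>\<kappa> * t\<close>, at the price of a factor
      \<open>\<kappa> ^ s\<close>.\<close>
    define \<kappa> where "\<kappa> = max 1 (A / c)"
    have \<kappa>: "1 \<le> \<kappa>" "A \<le> c * \<kappa> ^ d"
    proof -
      show 1: "1 \<le> \<kappa>" by (simp add: \<kappa>_def)
      have "A / c \<le> \<kappa> ^ 1" by (simp add: \<kappa>_def)
      also have "\<dots> \<le> \<kappa> ^ d" using 1 assms(1) by (intro power_increasing) auto
      finally show "A \<le> c * \<kappa> ^ d" using assms(3) by (simp add: field_simps)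
    qed
    obtain d1 where d1: "0 < d1" "\<And>\<eta>. norm \<eta> \<le> d1 \<Longrightarrow> norm (\<eta> *s v) < R"
      using cmul_vec_small[OF R, of v] by blast
    obtain t1 where t1: "t1 > 0" "\<forall>t. 0 < t \<longrightarrow> t < t1 \<longrightarrow> norm_box d A t \<subseteq> ball (0::complex) d1"
      using boxes_shrink_norm_box[OF assms(1), where 'a = complex] A d1(1) unfolding boxes_shrink_def by blast
    have "norm (r (\<eta> *s v)) \<le> C' * \<kappa> ^ s * t ^ s"
      if "0 < t" "t < min t1 (t0 / \<kappa>)" "\<eta> \<in> norm_box d A t" for t \<eta>
    proof -
      have "\<eta> \<in> ball 0 d1" using t1(2)[rule_format, of t] that by (auto dest: subsetD)
      then have "norm (\<eta> *s v) < R" by (intro d1(2)) simp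
      then have "0 \<le> r (\<eta> *s v)" using tang R by (intro tangential_nonneg) (auto simp: L_linear(2))
      moreover have "r (\<eta> *s v) \<le> C' * (\<kappa> * t) ^ s"
      proof (rule bd')
        show "0 < \<kappa> * t" "\<kappa> * t < t0" using that \<kappa>(1) by (auto simp: field_simps)
        have "norm \<eta> \<le> A * t ^ d" using that by (simp add: norm_box_def)
        also have "\<dots> \<le> (c * \<kappa> ^ d) * t ^ d" using that \<kappa> by (intro mult_right_mono) auto
        finally show "norm \<eta> \<le> c * (\<kappa> * t) ^ d" by (simp add: power_mult_distrib mult_ac)
      qed
      ultimately show ?thesis by (simp add: power_mult_distrib mult_ac)
    qed
    then show "\<exists>C t0. 0 < t0 \<and> (\<forall>t x. 0 < t \<longrightarrow> t < t0 \<longrightarrow> x \<in> norm_box d A t \<longrightarrow> norm (r (x *s v)) \<le> C * t ^ s)"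
      using t1(1) assms(4) \<kappa>(1) by (intro exI[of _ "C' * \<kappa> ^ s"] exI[of _ "min t1 (t0 / \<kappa>)"]) auto
  qed
  have "iterated_derivative (\<lambda>\<eta>. r (\<eta> *s v)) vs 0 = 0" if "length vs < Suc l" for vs
  proof -
    have "d * length vs \<le> d * l" using that by simp
    also have "\<dots> < s" using assms(2) by (simp only: mult.commute)
    finally show ?thesis by (rule box_bigo_iterated_derivative_zero[OF e(2,1) assms(1) bb])
  qed
  then show ?thesis unfolding V_def mem_Collect_eq bigo_on_iff_iterated_derivative[OF e(2,1)] by blast
qed

end

section \<open>Estimates for combinations of directions and along curves\<close>

context weakly_linearly_convex_germ
begin

text \<open>After a push by \<epsilon> N the discs of radius k |c_j| in the directions
  \<open>e j\<close> lie in the domain. An affine form with value \<open>A\<close> at 0 and no zeros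
  on these discs satisfies k |M (c_j e_j)| \<le> |A| for each j; as \<open>k\<close> exceeds the
  number of directions, |M z| < |A| for the combination \<open>z\<close>, and \<open>hull\<close>
  places it in the domain after the same push.\<close>

lemma weighted_upper_bound:
  fixes m :: "'i \<Rightarrow> nat"
  assumes I: "finite I" and e: "\<And>j. j \<in> I \<Longrightarrow> e j \<in> V (m j)" "\<And>j. j \<in> I \<Longrightarrow> 1 \<le> m j"
  shows "\<exists>C \<delta>. 0 \<le> C \<and> 0 < \<delta> \<and> (\<forall>c. (\<forall>j\<in>I. norm (c j) < \<delta>) \<longrightarrow>
      norm (\<Sum>j\<in>I. c j *s e j) < R \<and> r (\<Sum>j\<in>I. c j *s e j) \<le> C * (\<Sum>j\<in>I. norm (c j) ^ m j))"
proof -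
  obtain N R1 where R1: "0 < R1" "R1 \<le> R" and
    N: "\<And>x \<epsilon>. norm x < R1 \<Longrightarrow> 0 \<le> \<epsilon> \<Longrightarrow> \<epsilon> < R1 \<Longrightarrow> norm (x + \<epsilon> *\<^sub>R N) < R \<and> r (x + \<epsilon> *\<^sub>R N) \<le> r x - \<epsilon> / 2 \<and> r x \<le> r (x + \<epsilon> *\<^sub>R N) + 3 / 2 * \<epsilon>"
    using inner_normal by blast
  have "\<forall>j\<in>I. \<exists>C d. 0 \<le> C \<and> 0 < d \<and> (\<forall>\<zeta>. norm \<zeta> < d \<longrightarrow> norm (r (\<zeta> *s e j)) \<le> C * norm \<zeta> ^ m j)"
    using e(1) unfolding V_def bigo_on_def by blast
  then obtain Cj dj where Cd: "\<And>j. j \<in> I \<Longrightarrow> 0 \<le> Cj j" "\<And>j. j \<in> I \<Longrightarrow> 0 < dj j"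
    "\<And>j \<zeta>. j \<in> I \<Longrightarrow> norm \<zeta> < dj j \<Longrightarrow> norm (r (\<zeta> *s e j)) \<le> Cj j * norm \<zeta> ^ m j" by metis
  define C where "C = 1 + (\<Sum>j\<in>I. Cj j)"
  have C: "1 \<le> C" using Cd(1) by (simp add: C_def sum_nonneg)
  have CjC: "Cj j \<le> C" if "j \<in> I" for j
    using member_le_sum[OF that, of Cj] Cd(1) I by (auto simp: C_def)
  define d where "d = Min (insert 1 (insert R1 (dj ` I)))"
  have d: "0 < d" "d \<le> 1" "d \<le> R1" "\<And>j. j \<in> I \<Longrightarrow> d \<le> dj j"   proof -
    show "0 < d" using I Cd(2) R1(1) by (simp add: d_def del: Min_insert)
    show "d \<le> 1" "d \<le> R1" "\<And>j. j \<in> I \<Longrightarrow> d \<le> dj j" unfolding d_def by (rule Min_le; use I in auto)+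
  qed
  define k where "k = real (card I) + 1"
  have k: "1 \<le> k" "real (card I) \<le> k" by (auto simp: k_def)
  define E where "E = 1 + (\<Sum>j\<in>I. norm (e j))"
  have E: "1 \<le> E" by (simp add: E_def sum_nonneg)
  have eE: "norm (e j) \<le> E" if "j \<in> I" for j
    using member_le_sum[OF that, of "\<lambda>j. norm (e j)"] I by (auto simp: E_def)
  \<comment> \<open>One constant for all smallness requirements: the numbers
    \<open>k * norm (c j)\<close> stay below \<open>d\<close>, and the points of the discs, the
    combination \<open>z\<close> and the push \<open>\<epsilon>\<close> stay below
    \<open>R1\<close>.\<close>
  define P where "P = 4 * C * k * k * E"
  have P: "1 \<le> P" "k \<le> P" "k * E \<le> P" "E \<le> P" "4 * C * k * k \<le> P"
  proof -
    have kE: "1 \<le> k * E" "E \<le> k * E" "k \<le> k * E" using k E by (auto simp: mult_ge1_I mult_le_cancel_right1 mult_le_cancel_left1)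
    have 4: "1 \<le> 4 * C * k" using C k mult_mono[of 1 "4 * C" 1 k] by simp
    have "1 * (k * E) \<le> (4 * C * k) * (k * E)" using 4 kE by (intro mult_right_mono) auto
    then show "k * E \<le> P" by (simp add: P_def mult_ac)
    then show "1 \<le> P" "k \<le> P" "E \<le> P" using kE by auto
    have "4 * C * k * k * 1 \<le> 4 * C * k * k * E" using E C k by (intro mult_left_mono) auto
    then show "4 * C * k * k \<le> P" by (simp add: P_def)
  qed
  \<comment> \<open>The factor 6 is 3/2 times 4: returning along the normal costs
    \<open>3 / 2 * \<epsilon>\<close>, and \<open>\<epsilon>\<close> carries the factor 4.\<close>
  define D where "D = 6 * C * (\<Sum>j\<in>I. k ^ m j)"
  have D: "0 \<le> D" using C k by (simp add: D_def sum_nonneg)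
  have "norm (\<Sum>j\<in>I. c j *s e j) < R \<and> r (\<Sum>j\<in>I. c j *s e j) \<le> D * (\<Sum>j\<in>I. norm (c j) ^ m j)"
    if c: "\<forall>j\<in>I. norm (c j) < d / P" for c :: "'i \<Rightarrow> complex"
  proof (cases "\<forall>j\<in>I. c j = 0")
    case True
    then have "(\<Sum>j\<in>I. c j *s e j) = 0" by simp
    then show ?thesis using R r0 D by (simp add: sum_nonneg)
  next
    case False
    then obtain j0 where j0: "j0 \<in> I" "c j0 \<noteq> 0" by blast
    define z where "z = (\<Sum>j\<in>I. c j *s e j)"
    have P0: "P > 0" using P(1) by linarith
    have cP: "norm (c j) * P < d" if "j \<in> I" for j using c that P0 by (auto simp: pos_less_divide_eq)
    have ck: "k * norm (c j) < d" if "j \<in> I" for j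
      using cP[OF that] mult_left_mono[OF P(2) norm_ge_zero[of "c j"]] by (simp add: mult.commute)
    have card1: "1 \<le> real (card I)" using j0(1) I by (simp add: Suc_le_eq card_gt_0_iff) blast
    have nz: "norm z < R1"
    proof -
      have "norm z \<le> (\<Sum>j\<in>I. norm (c j) * norm (e j))" unfolding z_def
        by (rule order_trans[OF norm_sum]) (simp add: norm_cmul_vec)
      also have "\<dots> \<le> (\<Sum>j\<in>I. d / P * norm (e j))" using c by (intro sum_mono mult_right_mono) (auto intro: less_imp_le)
      also have "\<dots> = d / P * (\<Sum>j\<in>I. norm (e j))" by (simp add: sum_distrib_left)
      also have "\<dots> < d / P * P" using P(4) d(1) P0 by (intro mult_strict_left_mono) (auto simp: E_def)
      also have "\<dots> = d" using P0 by simp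
      finally show ?thesis using d(3) by simp
    qed
    \<comment> \<open>Chosen so that \<open>r \<le> \<epsilon> / 4\<close> on the discs, less than
      the gain \<open>\<epsilon> / 2\<close> of the push.\<close>
    define \<epsilon> where "\<epsilon> = 4 * C * (\<Sum>j\<in>I. (k * norm (c j)) ^ m j)"
    have "0 < (k * norm (c j0)) ^ m j0" using j0 k by simp
    also have "\<dots> \<le> (\<Sum>j\<in>I. (k * norm (c j)) ^ m j)"
      using k by (intro member_le_sum j0 I) auto
    finally have \<epsilon>0: "0 < \<epsilon>" using C by (simp add: \<epsilon>_def)
    have "(\<Sum>j\<in>I. (k * norm (c j)) ^ m j) \<le> (\<Sum>j\<in>I. k * norm (c j))"
    proof (rule sum_mono)
      fix j assume j: "j \<in> I"
      have "(k * norm (c j)) ^ m j \<le> (k * norm (c j)) ^ 1"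
        using ck[OF j] d(2) k(1) e(2)[OF j] by (intro power_decreasing) auto
      then show "(k * norm (c j)) ^ m j \<le> k * norm (c j)" by simp
    qed
    also have "\<dots> \<le> (\<Sum>j\<in>I. k * (d / P))" using c k by (intro sum_mono mult_left_mono) (auto intro: less_imp_le)
    also have "\<dots> = real (card I) * (k * (d / P))" by simp
    finally have "\<epsilon> \<le> 4 * C * (real (card I) * (k * (d / P)))"
      unfolding \<epsilon>_def using C by (intro mult_left_mono) auto
    also have "\<dots> = (4 * C * real (card I) * k) * (d / P)" by (simp add: mult_ac)
    also have "\<dots> < (4 * C * k * k) * (d / P)" using C k d(1) P0 by (intro mult_strict_right_mono) (auto simp: k_def)
    also have "\<dots> \<le> P * (d / P)" using P(5) d(1) P0 by (intro mult_right_mono) auto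
    also have "\<dots> = d" using P0 by simp
    finally have \<epsilon>1: "\<epsilon> < R1" using d(3) by simp
    define q where "q = \<epsilon> *\<^sub>R N"
    have "r (q + z) < 0"
    proof (rule hull[where Y = "{\<zeta> *s ((of_real k * c j) *s e j) |\<zeta> j. j \<in> I \<and> norm \<zeta> \<le> 1}"])
      have "norm (0 + q) < R \<and> r (0 + q) \<le> r 0 - \<epsilon> / 2 \<and> r 0 \<le> r (0 + q) + 3 / 2 * \<epsilon>"
        unfolding q_def using \<epsilon>0 \<epsilon>1 R1(1) by (intro N) auto
      then show "norm q < R" "r q < 0" using r0 \<epsilon>0 by auto
      show "norm (q + t *\<^sub>R z) < R" if "0 \<le> t" "t \<le> 1" for t
      proof -
        have "norm (t *\<^sub>R z) \<le> norm z" using that by (simp add: mult_left_le_one_le)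
        then show ?thesis using N[of "t *\<^sub>R z" \<epsilon>] nz \<epsilon>0 \<epsilon>1 by (simp add: q_def add.commute)
      qed
    next
      fix y assume "y \<in> {\<zeta> *s ((of_real k * c j) *s e j) |\<zeta> j. j \<in> I \<and> norm \<zeta> \<le> 1}"
      then obtain \<zeta> j where y: "y = (\<zeta> * (of_real k * c j)) *s e j" "j \<in> I" "norm \<zeta> \<le> 1" by auto
      let ?\<xi> = "\<zeta> * (of_real k * c j)"
      have n\<xi>: "norm ?\<xi> \<le> k * norm (c j)" using y(3) k by (simp add: norm_mult mult_left_le_one_le)
      have "norm y \<le> (k * norm (c j)) * E" unfolding y(1) norm_cmul_vec using n\<xi> eE[OF y(2)] k by (intro mult_mono) auto
      also have "\<dots> = norm (c j) * (k * E)" by simp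
      also have "\<dots> \<le> norm (c j) * P" using P(3) by (intro mult_left_mono) auto
      finally have ny: "norm y < R1" using cP[OF y(2)] d(3) by linarith
      have "r y \<le> Cj j * norm ?\<xi> ^ m j"
        using Cd(3)[OF y(2), of ?\<xi>] n\<xi> ck[OF y(2)] d(4)[OF y(2)] by (auto simp: y(1))
      also have "\<dots> \<le> C * (k * norm (c j)) ^ m j"
        using CjC[OF y(2)] Cd(1)[OF y(2)] n\<xi> C by (intro mult_mono power_mono) auto
      also have "\<dots> \<le> C * (\<Sum>j\<in>I. (k * norm (c j)) ^ m j)"
        using C k y(2) by (intro mult_left_mono member_le_sum I) auto
      also have "\<dots> = \<epsilon> / 4" by (simp add: \<epsilon>_def)
      finally show "norm (q + y) < R \<and> r (q + y) < 0"
        using N[OF ny, of \<epsilon>] \<epsilon>0 \<epsilon>1 by (auto simp: q_def add.commute)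
    next
      fix M :: "complex ^ 'n \<Rightarrow> complex" and A :: complex
      assume A: "A \<noteq> 0" and add: "\<And>v w. M (v + w) = M v + M w" and scale: "\<And>c v. M (c *s v) = c * M v"
        and nz: "\<And>y. y \<in> {\<zeta> *s ((of_real k * c j) *s e j) |\<zeta> j. j \<in> I \<and> norm \<zeta> \<le> 1} \<Longrightarrow> A + M y \<noteq> 0"
      have M0: "M 0 = 0" using scale[of 0 0] by simp
      have sum: "M (\<Sum>j\<in>J. f j) = (\<Sum>j\<in>J. M (f j))" for J and f :: "'i \<Rightarrow> complex ^ 'n"
        by (induction J rule: infinite_finite_induct) (auto simp: add M0)
      \<comment> \<open>Otherwise \<open>- A / ?w\<close> has modulus at most 1, and the affine form
        vanishes at this parameter of the disc.\<close>
      have b: "k * norm (M (c j *s e j)) \<le> norm A" if j: "j \<in> I" for j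
      proof (rule ccontr)
        let ?w = "M ((of_real k * c j) *s e j)"
        assume "\<not> ?thesis"
        then have w: "norm A < norm ?w" using k by (simp add: scale norm_mult mult.assoc)
        then have w0: "?w \<noteq> 0" by auto
        have "A + M ((- A / ?w) *s ((of_real k * c j) *s e j)) = 0" unfolding scale[of "- A / ?w"] using w0 by simp
        moreover have "norm (- A / ?w) \<le> 1" using w by (simp add: norm_divide divide_le_eq)
        ultimately show False using nz j by blast
      qed
      have "k * norm (M z) \<le> (\<Sum>j\<in>I. k * norm (M (c j *s e j)))"
        unfolding z_def sum sum_distrib_left[symmetric] using k by (intro mult_left_mono norm_sum) auto
      also have "\<dots> \<le> (\<Sum>j\<in>I. norm A)" using b by (intro sum_mono) auto
      also have "\<dots> < k * norm A" using A by (simp add: k_def)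
      finally show "norm (M z) < norm A" using k by simp
    qed
    then have "r z \<le> 3 / 2 * \<epsilon>" using N[OF nz, of \<epsilon>] \<epsilon>0 \<epsilon>1 by (auto simp: q_def add.commute)
    also have "\<dots> = 6 * C * (\<Sum>j\<in>I. k ^ m j * norm (c j) ^ m j)" by (simp add: \<epsilon>_def power_mult_distrib)
    also have "\<dots> \<le> 6 * C * (\<Sum>j\<in>I. (\<Sum>i\<in>I. k ^ m i) * norm (c j) ^ m j)"
      using C k by (intro mult_left_mono sum_mono mult_right_mono member_le_sum[of _ _ "\<lambda>i. k ^ m i"] I) auto
    also have "\<dots> = D * (\<Sum>j\<in>I. norm (c j) ^ m j)" by (simp only: D_def sum_distrib_left[symmetric] mult.assoc)
    finally show ?thesis using nz R1(2) by (simp add: z_def)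
  qed
  then show ?thesis using D d(1) P(1) by (intro exI[of _ D] exI[of _ "d / P"]) auto
qed

text \<open>Sums are the nontrivial point: \<open>weighted_upper_bound\<close> for the directions
  \<open>v\<close> and \<open>w\<close> with equal coefficients bounds \<open>r\<close> from above
  on the line of \<open>v + w\<close>, and this line is tangential, so \<open>r\<close> is
  nonnegative on it. The case \<open>m \<le> 1\<close> is treated apart because vectors of
  \<open>V 1\<close> may be transversal.\<close>

lemma V_subspace: "vec.subspace (V m)"
proof (cases "m \<le> 1")
  case True
  then have "V m = UNIV" using V_1 V_antimono[of m 1] by auto
  then show ?thesis by simp
next
  case False
  have lin0: "L 0 (v + w) = L 0 v + L 0 w" "L 0 (c *s v) = c * L 0 v" for v w c
    using L_linear[of 0] R by auto
  show ?thesis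
  proof (rule vec.subspaceI)
    have "bigo_on UNIV m (\<lambda>\<eta>::complex. r (\<eta> *s 0))"
      by (rule bigo_onI[of 1 _ _ 0]) (auto simp: r0)
    then show "0 \<in> V m" by (simp add: V_def)
  next
    fix v w assume v: "v \<in> V m" and w: "w \<in> V m"
    have "\<exists>C \<delta>. 0 \<le> C \<and> 0 < \<delta> \<and> (\<forall>c. (\<forall>j\<in>UNIV. norm (c j) < \<delta>) \<longrightarrow>
      norm (\<Sum>j\<in>UNIV. c j *s (if j then v else w)) < R \<and>
      r (\<Sum>j\<in>UNIV. c j *s (if j then v else w)) \<le> C * (\<Sum>j\<in>UNIV. norm (c j) ^ m))"
      by (rule weighted_upper_bound) (use v w False in auto)
    then obtain C \<delta> where C: "0 \<le> C" "0 < \<delta>" "\<And>c. (\<forall>j\<in>UNIV. norm (c j) < \<delta>) \<Longrightarrow>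
      norm (\<Sum>j\<in>UNIV. c j *s (if j then v else w)) < R \<and>
      r (\<Sum>j\<in>UNIV. c j *s (if j then v else w)) \<le> C * (\<Sum>j\<in>UNIV. norm (c j) ^ m)"
      by blast
    have "bigo_on UNIV m (\<lambda>\<eta>. r (\<eta> *s (v + w)))"
    proof (rule bigo_onI[OF C(2), of _ _ "2 * C"])
      fix \<eta> :: complex assume \<eta>: "norm \<eta> < \<delta>"
      have eq: "(\<Sum>j\<in>UNIV. \<eta> *s (if j then v else w)) = \<eta> *s (v + w)"
        by (simp add: UNIV_bool vec.scale_right_distrib add.commute)
      have b: "norm (\<eta> *s (v + w)) < R" "r (\<eta> *s (v + w)) \<le> C * (2 * norm \<eta> ^ m)"
        using C(3)[of "\<lambda>_. \<eta>"] \<eta> unfolding eq by (auto simp: UNIV_bool)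
      have "L 0 (\<eta> *s (v + w)) = 0" using V_tangential[OF v] V_tangential[OF w] False by (simp add: lin0)
      then have "0 \<le> r (\<eta> *s (v + w))" using b(1) by (rule tangential_nonneg)
      then show "norm (r (\<eta> *s (v + w))) \<le> 2 * C * norm \<eta> ^ m" using b(2) by simp
    qed
    then show "v + w \<in> V m" by (simp add: V_def)
  next
    fix c :: complex and v assume "v \<in> V m"
    then obtain C e where C: "0 \<le> C" "0 < e" "\<And>\<eta>. norm \<eta> < e \<Longrightarrow> norm (r (\<eta> *s v)) \<le> C * norm \<eta> ^ m"
      unfolding V_def bigo_on_def by blast
    have nc: "norm c + 1 > 0" using norm_ge_zero[of c] by linarith
    have "bigo_on UNIV m (\<lambda>\<eta>. r (\<eta> *s (c *s v)))"
    proof (rule bigo_onI[of "e / (norm c + 1)" _ _ "C * norm c ^ m"])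
      fix \<eta> :: complex assume "norm \<eta> < e / (norm c + 1)"
      then have "norm \<eta> * (norm c + 1) < e" using nc by (simp only: pos_less_divide_eq)
      moreover have "norm \<eta> * norm c \<le> norm \<eta> * (norm c + 1)" by (intro mult_left_mono) auto
      ultimately have "norm (\<eta> * c) < e" by (simp add: norm_mult)
      from C(3)[OF this] show "norm (r (\<eta> *s (c *s v))) \<le> C * norm c ^ m * norm \<eta> ^ m"
        by (simp add: norm_mult power_mult_distrib mult_ac)
    qed (use C nc in auto)
    then show "c *s v \<in> V m" by (simp add: V_def)
  qed
qed

text \<open>For the lower bound the transversal \<open>e j\<close> are dropped. They have
  \<open>m j = 1\<close> by \<open>V_tangential\<close>, so dropping them changes \<open>r\<close>
  by at most a constant times the sum of the corresponding |c_j|; the remaining combination is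
  tangential and \<open>r\<close> is nonnegative there.\<close>

lemma weighted_bound:
  fixes m :: "'i \<Rightarrow> nat"
  assumes I: "finite I" and e: "\<And>j. j \<in> I \<Longrightarrow> e j \<in> V (m j)" "\<And>j. j \<in> I \<Longrightarrow> 1 \<le> m j"
  shows "\<exists>C \<delta>. 0 \<le> C \<and> 0 < \<delta> \<and> (\<forall>c. (\<forall>j\<in>I. norm (c j) < \<delta>) \<longrightarrow>
      \<bar>r (\<Sum>j\<in>I. c j *s e j)\<bar> \<le> C * (\<Sum>j\<in>I. norm (c j) ^ m j))"
proof -
  obtain C \<delta> where C: "0 \<le> C" "0 < \<delta>" "\<And>c. (\<forall>j\<in>I. norm (c j) < \<delta>) \<Longrightarrow>
      r (\<Sum>j\<in>I. c j *s e j) \<le> C * (\<Sum>j\<in>I. norm (c j) ^ m j)"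
    using weighted_upper_bound[of I e m] assms by blast
  obtain B \<epsilon> where B: "0 \<le> B" "0 < \<epsilon>" "\<epsilon> \<le> R" "\<And>x y. norm x < \<epsilon> \<Longrightarrow> norm y < \<epsilon> \<Longrightarrow> norm (r x - r y) \<le> B * norm (x - y)"
    using C_infinity_on_Lipschitz[OF smooth R] by blast
  define E where "E = 1 + (\<Sum>j\<in>I. norm (e j))"
  have E: "1 \<le> E" by (simp add: E_def sum_nonneg)
  have eE: "norm (e j) \<le> E" if "j \<in> I" for j
    using member_le_sum[OF that, of "\<lambda>j. norm (e j)"] I by (auto simp: E_def)
  define \<delta>' where "\<delta>' = min \<delta> (\<epsilon> / E)"
  have \<delta>': "0 < \<delta>'" using C B E by (simp add: \<delta>'_def)
  have small: "norm (\<Sum>j\<in>J. c j *s e j) < \<epsilon>" if "J \<subseteq> I" "\<forall>j\<in>I. norm (c j) < \<delta>'" for J c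
  proof -
    have "norm (\<Sum>j\<in>J. c j *s e j) \<le> (\<Sum>j\<in>J. norm (c j) * norm (e j))"
      by (rule order_trans[OF norm_sum]) (simp add: norm_cmul_vec)
    also have "\<dots> \<le> (\<Sum>j\<in>I. norm (c j) * norm (e j))" using that I by (intro sum_mono2) auto
    also have "\<dots> \<le> (\<Sum>j\<in>I. \<delta>' * norm (e j))" using that by (intro sum_mono mult_right_mono) (auto intro: less_imp_le)
    also have "\<dots> = \<delta>' * (\<Sum>j\<in>I. norm (e j))" by (simp add: sum_distrib_left)
    also have "\<dots> < \<delta>' * E" using \<delta>' by (intro mult_strict_left_mono) (auto simp: E_def)
    also have "\<dots> \<le> \<epsilon> / E * E" using E by (intro mult_right_mono) (auto simp: \<delta>'_def)
    also have "\<dots> = \<epsilon>" using E by simp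
    finally show ?thesis .
  qed
  define J where "J = {j \<in> I. L 0 (e j) = 0}"
  have J: "J \<subseteq> I" "finite J" using I by (auto simp: J_def)
  have m1: "m j = 1" if "j \<in> I - J" for j
    using that e[of j] V_tangential[of "e j" "m j"] by (force simp: J_def)
  define D where "D = C + B * E"
  have "\<bar>r (\<Sum>j\<in>I. c j *s e j)\<bar> \<le> D * (\<Sum>j\<in>I. norm (c j) ^ m j)" if c: "\<forall>j\<in>I. norm (c j) < \<delta>'" for c
  proof -
    let ?S = "\<Sum>j\<in>I. norm (c j) ^ m j"
    have S: "0 \<le> ?S" by (simp add: sum_nonneg)
    define z where "z = (\<Sum>j\<in>I. c j *s e j)"
    define z' where "z' = (\<Sum>j\<in>J. c j *s e j)"
    have "L 0 z' = 0" using R by (simp add: z'_def L_sum L_linear(2) J_def)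
    then have "0 \<le> r z'" using small[OF J(1) c] B(3) by (intro tangential_nonneg) (auto simp: z'_def)
    have "norm (z - z') \<le> E * ?S"
    proof -
      have "z = (\<Sum>j\<in>I - J. c j *s e j) + z'" unfolding z_def z'_def using sum.subset_diff[OF J(1) I] .
      then have "z - z' = (\<Sum>j\<in>I - J. c j *s e j)" by simp
      also have "norm \<dots> \<le> (\<Sum>j\<in>I - J. norm (c j) * norm (e j))"
        by (rule order_trans[OF norm_sum]) (simp add: norm_cmul_vec)
      also have "\<dots> \<le> (\<Sum>j\<in>I - J. norm (c j) ^ m j * E)" using eE m1 by (intro sum_mono) (auto intro: mult_left_mono)
      also have "\<dots> \<le> (\<Sum>j\<in>I. norm (c j) ^ m j * E)" using I E by (intro sum_mono2) auto
      also have "\<dots> = E * ?S" by (simp add: sum_distrib_left mult.commute)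
      finally show ?thesis .
    qed
    then have "norm (r z - r z') \<le> B * (E * ?S)"
      using B(4)[of z z'] small[OF J(1) c] small[OF order_refl c] mult_left_mono[OF _ B(1)] by (force simp: z_def z'_def)
    then have "- (B * E * ?S) \<le> r z" using \<open>0 \<le> r z'\<close> by (simp add: abs_le_iff mult.assoc)
    moreover have "r z \<le> C * ?S" using C(3)[of c] c by (auto simp: z_def \<delta>'_def)
    moreover have "0 \<le> C * ?S" "0 \<le> B * E * ?S" using C(1) B(1) E S by simp_all
    ultimately show ?thesis unfolding z_def D_def by (simp add: abs_le_iff distrib_right)
  qed
  then show ?thesis using C(1) B(1) E \<delta>' by (intro exI[of _ D] exI[of _ \<delta>']) (auto simp: D_def)
qed

text \<open>Every Taylor coefficient is covered, not only the leading one: contact of order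
  \<open>s\<close> along the curve gives order at least s / d on the line of the coefficient of
  index \<open>d\<close>. The expansion is cut at a degree \<open>K\<close> with
  \<open>s \<le> Suc K\<close>: the coefficient bound needs a polynomial, and the rest is
  O(|\<zeta>|^s), harmless because \<open>r\<close> is Lipschitz.\<close>

lemma curve_coefficient:
  fixes \<phi> :: "complex \<Rightarrow> complex ^ 'n" and a :: "nat \<Rightarrow> complex ^ 'n"
  assumes a0: "a 0 = 0" and exp: "\<And>\<zeta>. norm \<zeta> < e \<Longrightarrow> norm (\<phi> \<zeta> - (\<Sum>i\<le>K. \<zeta> ^ i *s a i)) \<le> C1 * norm \<zeta> ^ Suc K"
    and e: "0 < e" and s: "s \<le> Suc K" and bigo: "bigo_on UNIV s (r \<circ> \<phi>)"
    and d: "1 \<le> d" "d \<le> K" "l * d < s"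
  shows "a d \<in> V (Suc l)"
proof -
  obtain N R1 where R1: "0 < R1" "R1 \<le> R" and
    N: "\<And>x \<epsilon>. norm x < R1 \<Longrightarrow> 0 \<le> \<epsilon> \<Longrightarrow> \<epsilon> < R1 \<Longrightarrow> norm (x + \<epsilon> *\<^sub>R N) < R \<and> r (x + \<epsilon> *\<^sub>R N) \<le> r x - \<epsilon> / 2 \<and> r x \<le> r (x + \<epsilon> *\<^sub>R N) + 3 / 2 * \<epsilon>"
    using inner_normal by blast
  obtain B \<epsilon>1 where B: "0 \<le> B" "0 < \<epsilon>1" "\<epsilon>1 \<le> R" "\<And>x y. norm x < \<epsilon>1 \<Longrightarrow> norm y < \<epsilon>1 \<Longrightarrow> norm (r x - r y) \<le> B * norm (x - y)"
    using C_infinity_on_Lipschitz[OF smooth R] by blast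
  obtain C2 e2 where C2: "0 \<le> C2" "0 < e2" "\<And>\<zeta>. norm \<zeta> < e2 \<Longrightarrow> \<bar>r (\<phi> \<zeta>)\<bar> \<le> C2 * norm \<zeta> ^ s"
    using bigo unfolding bigo_on_def by auto
  define x where "x \<zeta> = (\<Sum>i\<le>K. \<zeta> ^ i *s a i)" for \<zeta>
  define C1' where "C1' = max C1 0"
  have exp': "norm (\<phi> \<zeta> - x \<zeta>) \<le> C1' * norm \<zeta> ^ Suc K" if "norm \<zeta> < e" for \<zeta>
  proof -
    have "C1 * norm \<zeta> ^ Suc K \<le> C1' * norm \<zeta> ^ Suc K" by (intro mult_right_mono) (auto simp: C1'_def)
    then show ?thesis using exp[OF that] by (simp add: x_def)
  qed
  define A where "A = (\<Sum>i\<le>K. norm (a i)) + C1' + 1"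
  have A: "1 \<le> A" by (simp add: A_def C1'_def sum_nonneg)
  have x_small: "norm (x \<zeta>) \<le> (\<Sum>i\<le>K. norm (a i)) * norm \<zeta>" if "norm \<zeta> \<le> 1" for \<zeta>
  proof -
    have "norm (x \<zeta>) \<le> (\<Sum>i\<le>K. norm \<zeta> ^ i * norm (a i))" unfolding x_def
      by (rule order_trans[OF norm_sum]) (simp add: norm_cmul_vec norm_power)
    also have "\<dots> \<le> (\<Sum>i\<le>K. norm \<zeta> * norm (a i))"
    proof (rule sum_mono)
      fix i
      show "norm \<zeta> ^ i * norm (a i) \<le> norm \<zeta> * norm (a i)"
      proof (cases i)
        case (Suc i')
        have "norm \<zeta> ^ i \<le> norm \<zeta> ^ 1" using that Suc by (intro power_decreasing) auto
        then show ?thesis by (simp add: mult_right_mono)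
      qed (simp add: a0)
    qed
    finally show ?thesis by (simp add: sum_distrib_left mult.commute)
  qed
  have phi_small: "norm (\<phi> \<zeta>) \<le> A * norm \<zeta>" if "norm \<zeta> \<le> 1" "norm \<zeta> < e" for \<zeta>
  proof -
    have "norm \<zeta> ^ Suc K \<le> norm \<zeta> ^ 1" using that by (intro power_decreasing) auto
    then have "norm (\<phi> \<zeta> - x \<zeta>) \<le> C1' * norm \<zeta>"
      using exp'[OF that(2)] mult_left_mono[of "norm \<zeta> ^ Suc K" "norm \<zeta>" C1'] by (simp add: C1'_def)
    then have "norm (\<phi> \<zeta>) \<le> C1' * norm \<zeta> + (\<Sum>i\<le>K. norm (a i)) * norm \<zeta>"
      using x_small[OF that(1)] norm_triangle_ineq[of "\<phi> \<zeta> - x \<zeta>" "x \<zeta>"] by simp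
    also have "\<dots> \<le> A * norm \<zeta>" by (simp add: A_def algebra_simps)
    finally show ?thesis .
  qed
  \<comment> \<open>The constant for \<open>r\<close> on the polynomial disc: \<open>C2\<close>
    comes from the curve, \<open>B * C1'\<close> from replacing the curve by its Taylor
    polynomial.\<close>
  define C where "C = C2 + B * C1' + 1"
  have C: "1 \<le> C" using C2(1) B(1) by (simp add: C_def C1'_def)
  define t0 where "t0 = min (min 1 (min e e2)) (min (min \<epsilon>1 R1 / A) (R1 / (4 * C)))"
  have t0: "0 < t0" using e C2 B R1 A C by (simp add: t0_def)
  have rx: "r (x \<zeta>) \<le> C * norm \<zeta> ^ s" if "norm \<zeta> < t0" for \<zeta>
  proof -
    have z: "norm \<zeta> < 1" "norm \<zeta> < e" "norm \<zeta> < e2" "norm \<zeta> < min \<epsilon>1 R1 / A" using that by (auto simp: t0_def)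
    have zA: "A * norm \<zeta> < \<epsilon>1" using z(4) A by (simp add: pos_less_divide_eq mult.commute)
    have "norm (x \<zeta>) \<le> A * norm \<zeta>"
      using x_small[of \<zeta>] z(1) mult_right_mono[of "\<Sum>i\<le>K. norm (a i)" A "norm \<zeta>"] by (simp add: A_def C1'_def)
    then have "norm (r (x \<zeta>) - r (\<phi> \<zeta>)) \<le> B * norm (x \<zeta> - \<phi> \<zeta>)"
      using phi_small[of \<zeta>] z zA by (intro B(4)) auto
    also have "\<dots> \<le> B * (C1' * norm \<zeta> ^ Suc K)"
      using exp'[OF z(2)] B(1) by (intro mult_left_mono) (auto simp: norm_minus_commute)
    also have "\<dots> \<le> B * (C1' * norm \<zeta> ^ s)"
      using z(1) s B(1) by (intro mult_left_mono power_decreasing) (auto simp: C1'_def)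
    finally have "r (x \<zeta>) \<le> C2 * norm \<zeta> ^ s + B * (C1' * norm \<zeta> ^ s)"
      using C2(3)[OF z(3)] by (simp add: abs_le_iff)
    also have "\<dots> \<le> C * norm \<zeta> ^ s" by (simp add: C_def algebra_simps)
    finally show ?thesis .
  qed
  have s1: "1 \<le> s" using d by auto
  show ?thesis
  \<comment> \<open>The factor \<open>1 / 2 ^ Suc K\<close> compensates the
    \<open>2 ^ degree P\<close> of the coefficient bound, with a factor 2 to spare for
    strictness.\<close>
  proof (rule V_SucI[of d l s "1 / 2 ^ Suc K" t0])
    fix t :: real and \<eta> :: complex assume t: "0 < t" "t < t0" and \<eta>: "norm \<eta> \<le> 1 / 2 ^ Suc K * t ^ d"
    have t': "t < 1" "t < R1 / A" "t < R1 / (4 * C)" 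
    proof -
      have "min \<epsilon>1 R1 / A \<le> R1 / A" using A by (intro divide_right_mono) auto
      then show "t < 1" "t < R1 / A" "t < R1 / (4 * C)" using t by (auto simp: t0_def)
    qed
    \<comment> \<open>On the polynomial disc over |\<zeta>| \<le> t this gives
      \<open>r \<le> \<epsilon> / 4\<close>, half the gain of the push.\<close>
    define \<epsilon> where "\<epsilon> = 4 * C * t ^ s"
    have \<epsilon>0: "0 < \<epsilon>" using C t by (simp add: \<epsilon>_def)
    have "t ^ s \<le> t ^ 1" using t t' s1 by (intro power_decreasing) auto
    then have "\<epsilon> \<le> 4 * C * t" using C by (simp add: \<epsilon>_def)
    then have \<epsilon>1: "\<epsilon> < R1" using t'(3) C by (simp add: pos_less_divide_eq mult.commute)
    define q where "q = \<epsilon> *\<^sub>R N"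
    have \<eta>1: "2 ^ K * norm \<eta> < t ^ d"
    proof -
      have "2 ^ K * norm \<eta> \<le> 2 ^ K * (1 / 2 ^ Suc K * t ^ d)" using \<eta> by (intro mult_left_mono) auto
      also have "\<dots> < t ^ d" using t by simp
      finally show ?thesis .
    qed
    have tA: "A * t < R1" using t'(2) A by (simp add: pos_less_divide_eq mult.commute)
    have n\<eta>: "norm (\<eta> *s a d) < R1"
    proof -
      have td: "t ^ d \<le> t ^ 1" using t t' d by (intro power_decreasing) auto
      have "norm \<eta> \<le> 2 ^ K * norm \<eta>" using mult_right_mono[of 1 "2 ^ K" "norm \<eta>"] by simp
      then have "norm \<eta> \<le> t" using \<eta>1 td by simp
      moreover have "norm (a d) \<le> A" using member_le_sum[of d "{..K}" "\<lambda>i. norm (a i)"] d by (simp add: A_def C1'_def)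
      ultimately have "norm \<eta> * norm (a d) \<le> t * A" using A t by (intro mult_mono) auto
      then show ?thesis using tA by (simp add: norm_cmul_vec mult.commute)
    qed
    have "r (q + \<eta> *s a d) < 0"
    proof (rule hull[where Y = "x ` cball 0 t"])
      have "norm (0 + q) < R \<and> r (0 + q) \<le> r 0 - \<epsilon> / 2 \<and> r 0 \<le> r (0 + q) + 3 / 2 * \<epsilon>"
        unfolding q_def using \<epsilon>0 \<epsilon>1 R1(1) by (intro N) auto
      then show "norm q < R" "r q < 0" using r0 \<epsilon>0 by auto
      show "norm (q + \<tau> *\<^sub>R (\<eta> *s a d)) < R" if "0 \<le> \<tau>" "\<tau> \<le> 1" for \<tau>
      proof -
        have "norm (\<tau> *\<^sub>R (\<eta> *s a d)) \<le> norm (\<eta> *s a d)" using that by (simp add: mult_left_le_one_le)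
        then show ?thesis using N[of "\<tau> *\<^sub>R (\<eta> *s a d)" \<epsilon>] n\<eta> \<epsilon>0 \<epsilon>1 by (simp add: q_def add.commute)
      qed
    next
      fix y assume "y \<in> x ` cball 0 t"
      then obtain \<zeta> where \<zeta>: "y = x \<zeta>" "norm \<zeta> \<le> t" by auto
      have "norm y \<le> A * t"
      proof -
        have "norm y \<le> (\<Sum>i\<le>K. norm (a i)) * norm \<zeta>" using x_small[of \<zeta>] \<zeta> t' by simp
        also have "\<dots> \<le> A * t" using \<zeta>(2) A by (intro mult_mono) (auto simp: A_def C1'_def)
        finally show ?thesis .
      qed
      then have ny: "norm y < R1" using tA by simp
      have "r y \<le> C * norm \<zeta> ^ s" using rx[of \<zeta>] \<zeta> t by simp
      also have "\<dots> \<le> C * t ^ s" using \<zeta> C by (intro mult_left_mono power_mono) auto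
      also have "\<dots> = \<epsilon> / 4" by (simp add: \<epsilon>_def)
      finally show "norm (q + y) < R \<and> r (q + y) < 0"
        using N[OF ny, of \<epsilon>] \<epsilon>0 \<epsilon>1 by (auto simp: q_def add.commute)
    next
      fix M :: "complex ^ 'n \<Rightarrow> complex" and A :: complex
      assume A: "A \<noteq> 0" and add: "\<And>v w. M (v + w) = M v + M w" and scale: "\<And>c v. M (c *s v) = c * M v"
        and nz: "\<And>y. y \<in> x ` cball 0 t \<Longrightarrow> A + M y \<noteq> 0"
      have M0: "M 0 = 0" using scale[of 0 0] by simp
      have sum: "M (\<Sum>j\<in>J. f j) = (\<Sum>j\<in>J. M (f j))" for J and f :: "nat \<Rightarrow> complex ^ 'n"
        by (induction J rule: infinite_finite_induct) (auto simp: add M0)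
      \<comment> \<open>The affine form along the disc as a polynomial in \<open>\<zeta>\<close>.
        Its constant coefficient is \<open>A\<close> because \<open>a 0 = 0\<close>, and its
        coefficient of index \<open>d\<close> is \<open>M (a d)\<close>.\<close>
      define P where "P = [:A:] + (\<Sum>i\<le>K. monom (M (a i)) i)"
      have "poly P \<zeta> = A + M (x \<zeta>)" for \<zeta>
        by (simp add: P_def x_def sum scale poly_sum poly_monom mult.commute)
      then have nzP: "poly P \<zeta> \<noteq> 0" if "norm \<zeta> \<le> t" for \<zeta> using nz[of "x \<zeta>"] that by auto
      have co: "coeff P i = (if i = 0 then A else if i \<le> K then M (a i) else 0)" for i
        by (cases i) (auto simp: P_def coeff_sum coeff_monom coeff_pCons a0 M0)
      have deg: "degree P \<le> K" by (rule degree_le) (auto simp: co)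
      have "norm (M (a d)) * t ^ d \<le> 2 ^ degree P * norm A"
        using nonvanishing_poly_coeff_bound[of t P d] nzP t d by (simp add: co)
      also have "\<dots> \<le> 2 ^ K * norm A" using deg by (intro mult_right_mono power_increasing) auto
      finally have le: "norm (M (a d)) * t ^ d \<le> 2 ^ K * norm A" .
      show "norm (M (\<eta> *s a d)) < norm A"
      proof (cases "\<eta> = 0")
        case True
        then show ?thesis using A M0 by simp
      next
        case False
        have "norm (M (\<eta> *s a d)) * t ^ d = norm \<eta> * (norm (M (a d)) * t ^ d)" by (simp add: scale norm_mult)
        also have "\<dots> \<le> norm \<eta> * (2 ^ K * norm A)" using le by (intro mult_left_mono) auto
        also have "\<dots> = (2 ^ K * norm \<eta>) * norm A" by simp
        also have "\<dots> < t ^ d * norm A" using \<eta>1 A by (intro mult_strict_right_mono) auto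
        finally have "t ^ d * norm (M (\<eta> *s a d)) < t ^ d * norm A" by (simp only: mult.commute)
        then show ?thesis using t by (simp only: mult_less_cancel_left_pos zero_less_power)
      qed
    qed
    then have "r (\<eta> *s a d) \<le> 3 / 2 * \<epsilon>" using N[OF n\<eta>, of \<epsilon>] \<epsilon>0 \<epsilon>1 by (auto simp: q_def add.commute)
    then show "r (\<eta> *s a d) \<le> (6 * C) * t ^ s" by (simp add: \<epsilon>_def)
  qed (use d t0 in auto)
qed

end

subsection \<open>Linear algebra\<close>

lemma subspace_Int_nontrivial:
  fixes S T :: "('a::field ^ 'n) set"
  assumes "vec.subspace S" "vec.subspace T" "CARD('n) < vec.dim S + vec.dim T"
  shows "\<exists>v\<in>S \<inter> T. v \<noteq> 0"
proof (rule ccontr)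
  assume "\<not> ?thesis"
  then have "S \<inter> T \<subseteq> {0}" by blast
  then have "vec.dim (S \<inter> T) = 0" by simp
  with vec.dim_sums_Int[OF assms(1,2)] assms(3) dim_subset_UNIV_cart_gen[of "{x + y |x y. x \<in> S \<and> y \<in> T}"]
  show False by linarith
qed

text \<open>The subspace is spanned by \<open>k\<close> of the vectors that extend a basis of
  \<open>T\<close> to a basis of the whole space.\<close>

lemma subspace_complement:
  fixes T :: "('a::field ^ 'n) set"
  assumes "vec.subspace T" "k + vec.dim T \<le> CARD('n)"
  shows "\<exists>S. vec.subspace S \<and> vec.dim S = k \<and> S \<inter> T \<subseteq> {0}"
proof -
  obtain B where B: "B \<subseteq> T" "vec.independent B" "T \<subseteq> vec.span B" "card B = vec.dim T"
    by (rule vec.basis_exists)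
  obtain C where C: "B \<subseteq> C" "vec.independent C" "UNIV \<subseteq> vec.span C"
    by (rule vec.maximal_independent_subset_extend[OF subset_UNIV B(2)]) (rule that; assumption)
  have fC: "finite C" using C(2) by (rule vec.finiteI_independent)
  have "card C = CARD('n)" using vec.basis_card_eq_dim[OF subset_UNIV C(3,2)] by (simp only: vec_dim_card)
  then have "k \<le> card (C - B)" using assms(2) B(4) C(1) fC by (simp add: card_Diff_subset finite_subset)
  then obtain K where K: "K \<subseteq> C - B" "card K = k" by (rule obtain_subset_with_card_n)
  have fin: "finite K" "finite B" using fC K(1) C(1) finite_subset by blast+
  have sub: "K \<subseteq> C" "K \<union> B \<subseteq> C" using C(1) K(1) by auto
  note iK = vec.independent_mono[OF C(2) sub(1)] vec.independent_mono[OF C(2) sub(2)]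
  have T: "vec.span B = T" by (rule subset_antisym[OF vec.span_minimal[OF B(1) assms(1)] B(3)])
  have dK: "vec.dim (vec.span K) = k" using iK(1) K(2) by (simp add: vec.dim_eq_card_independent)
  have "vec.dim {x + y |x y. x \<in> vec.span K \<and> y \<in> vec.span B} = card (K \<union> B)"
    unfolding vec.span_Un[symmetric] using iK(2) by (simp add: vec.dim_eq_card_independent)
  also have "\<dots> = k + vec.dim T" using K B(4) fin by (subst card_Un_disjoint) auto
  finally have "vec.dim (vec.span K \<inter> T) = 0"
    using vec.dim_sums_Int[OF vec.subspace_span[of K] vec.subspace_span[of B]] dK by (simp add: T)
  then show ?thesis using dK by (intro exI[of _ "vec.span K"]) auto
qed

text \<open>The vectors are chosen from the largest index downwards. At \<open>k\<close> only
  \<open>card {k<..}\<close> choices have been made, and the hypothesis says that \<open>W k\<close>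
  has larger dimension, so it is not contained in the span of these.\<close>

lemma adapted_basis_exists:
  fixes W :: "'n::{finite,linorder} \<Rightarrow> ('a::field ^ 'n::{finite,linorder}) set"
  assumes "\<And>k. CARD('n) < card {..k} + vec.dim (W k)"
  shows "\<exists>e. \<forall>k. e k \<in> W k \<and> e k \<notin> vec.span (e ` {k<..})"
proof (rule dependent_wf_choice)
  show "wf (inv_image less_than (\<lambda>k :: 'n. card {k<..}))" by simp
  have lt: "(y, x) \<in> inv_image less_than (\<lambda>k :: 'n. card {k<..})" if "x < y" for x y
    using that by (auto intro!: psubset_card_mono)
  show "(r \<in> W x \<and> r \<notin> vec.span (f ` {x<..})) = (r \<in> W x \<and> r \<notin> vec.span (g ` {x<..}))"
    if "\<And>z. (z, x) \<in> inv_image less_than (\<lambda>k :: 'n. card {k<..}) \<Longrightarrow> f z = g z" for f g x r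
  proof -
    have "f ` {x<..} = g ` {x<..}" using that lt by (intro image_cong) auto
    then show ?thesis by simp
  qed
  fix x :: 'n and f :: "'n \<Rightarrow> 'a ^ 'n::{finite,linorder}"
  show "\<exists>r. r \<in> W x \<and> r \<notin> vec.span (f ` {x<..})"
  proof (rule ccontr)
    assume "\<not> ?thesis"
    then have "vec.dim (W x) \<le> card (f ` {x<..})" by (intro vec.dim_le_card) auto
    also have "\<dots> \<le> card {x<..}" by (rule card_image_le) simp
    finally have "vec.dim (W x) + card {..x} \<le> card ({x<..} \<union> {..x})" by (subst card_Un_disjoint) auto
    also have "\<dots> \<le> CARD('n)" by (rule card_mono) auto
    finally show False using assms[of x] by simp
  qed
qed

lemma matrix_inv_eq:
  fixes A B :: "'a::field ^ 'n ^ 'n"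
  assumes "A ** B = mat 1"
  shows "matrix_inv A = B"
proof -
  have "B ** A = mat 1" using assms matrix_left_right_inverse by blast
  then have "A ** matrix_inv A = mat 1 \<and> matrix_inv A ** A = mat 1"
    unfolding matrix_inv_def using assms by (intro someI[of "\<lambda>C. A ** C = mat 1 \<and> C ** A = mat 1"]) auto
  then have "matrix_inv A = (B ** A) ** matrix_inv A" "B = B ** (A ** matrix_inv A)"
    using \<open>B ** A = mat 1\<close> by (simp_all add: matrix_mul_lid matrix_mul_rid)
  then show ?thesis by (simp add: matrix_mul_assoc)
qed

subsection \<open>Taylor coefficients of holomorphic discs\<close>

definition taylor_coeff :: "(complex \<Rightarrow> complex ^ 'n) \<Rightarrow> nat \<Rightarrow> complex ^ 'n" where
  "taylor_coeff \<phi> i = (\<chi> j. (deriv ^^ i) (\<lambda>\<zeta>. \<phi> \<zeta> $ j) 0 / fact i)"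

lemma taylor_coeff_0: "taylor_coeff \<phi> 0 = \<phi> 0"
  by (simp add: taylor_coeff_def vec_eq_iff)

lemma taylor_coeff_expansion:
  fixes \<phi> :: "complex \<Rightarrow> complex ^ 'n"
  assumes "\<And>j. (\<lambda>\<zeta>. \<phi> \<zeta> $ j) holomorphic_on ball 0 e" "0 < e"
  shows "\<exists>C. 0 \<le> C \<and> (\<forall>\<zeta>. norm \<zeta> < e / 2 \<longrightarrow> norm (\<phi> \<zeta> - (\<Sum>i\<le>K. \<zeta> ^ i *s taylor_coeff \<phi> i)) \<le> C * norm \<zeta> ^ Suc K)"
proof -
  let ?f = "\<lambda>j i. (deriv ^^ i) (\<lambda>\<zeta>. \<phi> \<zeta> $ j)"
  have hol: "?f j i holomorphic_on ball 0 e" for j i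
    using assms(1)[of j] by (rule holomorphic_higher_deriv) simp
  have "\<exists>B. \<forall>\<zeta>\<in>cball 0 (e/2). norm (?f j (Suc K) \<zeta>) \<le> B" for j
  proof -
    have "continuous_on (cball 0 (e/2)) (?f j (Suc K))"
      by (rule continuous_on_subset[OF holomorphic_on_imp_continuous_on[OF hol]]) (use assms(2) in auto)
    then have "bounded (?f j (Suc K) ` cball 0 (e/2))"
      by (intro compact_imp_bounded compact_continuous_image) auto
    then show ?thesis unfolding bounded_iff by auto
  qed
  then obtain B where B: "\<And>j \<zeta>. \<zeta> \<in> cball 0 (e/2) \<Longrightarrow> norm (?f j (Suc K) \<zeta>) \<le> B j" by metis
  have comp: "norm (\<phi> \<zeta> $ j - (\<Sum>i\<le>K. \<zeta> ^ i * taylor_coeff \<phi> i $ j)) \<le> B j / fact K * norm \<zeta> ^ Suc K"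
    if "norm \<zeta> < e / 2" for j \<zeta>
  proof -
    have "cmod (?f j 0 \<zeta> - (\<Sum>i\<le>K. ?f j i 0 * (\<zeta> - 0) ^ i / fact i)) \<le> B j * cmod (\<zeta> - 0) ^ Suc K / fact K"
    proof (rule complex_Taylor[of "cball 0 (e/2)"])
      show "(?f j i has_field_derivative ?f j (Suc i) x) (at x within cball 0 (e/2))" if "x \<in> cball 0 (e/2)" for i x
        using holomorphic_derivI[OF hol[where j = j and i = i] open_ball, of x] that assms(2)
        by (auto intro: has_field_derivative_at_within)
    qed (use B that assms(2) in auto)
    then show ?thesis by (simp add: taylor_coeff_def mult.commute)
  qed
  have B0: "0 \<le> B j" for j 
    by (rule order_trans[OF norm_ge_zero B[of 0 j]]) (use assms(2) in simp)
  have "norm (\<phi> \<zeta> - (\<Sum>i\<le>K. \<zeta> ^ i *s taylor_coeff \<phi> i)) \<le> (\<Sum>j\<in>UNIV. B j / fact K) * norm \<zeta> ^ Suc K"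
    if "norm \<zeta> < e / 2" for \<zeta>
  proof -
    have "norm (\<phi> \<zeta> - (\<Sum>i\<le>K. \<zeta> ^ i *s taylor_coeff \<phi> i)) \<le> (\<Sum>j\<in>UNIV. norm ((\<phi> \<zeta> - (\<Sum>i\<le>K. \<zeta> ^ i *s taylor_coeff \<phi> i)) $ j))"
      by (rule norm_le_sum_norm)
    also have "\<dots> \<le> (\<Sum>j\<in>UNIV. B j / fact K * norm \<zeta> ^ Suc K)"
      using comp[OF that] by (intro sum_mono) (simp add: sum_component)
    finally show ?thesis by (simp only: sum_distrib_right)
  qed
  then show ?thesis using B0 by (intro exI[of _ "\<Sum>j\<in>UNIV. B j / fact K"]) (simp add: sum_nonneg)
qed

text \<open>If all coefficients of positive index vanished, the components would be constant by the
  identity theorem; \<open>d\<close> is the least index with a nonzero coefficient.\<close>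

lemma nonconstant_disc_order:
  fixes \<phi> :: "complex \<Rightarrow> complex ^ 'n"
  assumes hol: "\<And>j. (\<lambda>\<zeta>. \<phi> \<zeta> $ j) holomorphic_on ball 0 e" and e: "0 < e"
    and 0: "\<phi> 0 = 0" and nonconst: "\<not> \<phi> constant_on ball 0 e"
  obtains d C where "1 \<le> d" "taylor_coeff \<phi> d \<noteq> 0" "0 \<le> C"
    "\<And>\<zeta>. norm \<zeta> < e / 2 \<Longrightarrow> norm (\<phi> \<zeta> - \<zeta> ^ d *s taylor_coeff \<phi> d) \<le> C * norm \<zeta> ^ Suc d"
proof -
  have "\<exists>d. 1 \<le> d \<and> taylor_coeff \<phi> d \<noteq> 0"
  proof (rule ccontr)
    assume "\<not> ?thesis"
    then have "taylor_coeff \<phi> n $ j = 0" if "0 < n" for n j using that by simp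
    then have z: "(deriv ^^ n) (\<lambda>\<zeta>. \<phi> \<zeta> $ j) 0 = 0" if "0 < n" for n j
      using that by (simp add: taylor_coeff_def)
    have "\<phi> \<zeta> $ j = \<phi> 0 $ j" if "\<zeta> \<in> ball 0 e" for \<zeta> j
      by (rule holomorphic_fun_eq_const_on_connected[OF hol open_ball connected_ball z _ that]) (use e in auto)
    then show False using nonconst unfolding constant_on_def vec_eq_iff by blast
  qed
  define d where "d = (LEAST d. 1 \<le> d \<and> taylor_coeff \<phi> d \<noteq> 0)"
  have d: "1 \<le> d" "taylor_coeff \<phi> d \<noteq> 0"
    using LeastI_ex[OF \<open>\<exists>d. 1 \<le> d \<and> taylor_coeff \<phi> d \<noteq> 0\<close>] by (auto simp: d_def)
  have low: "taylor_coeff \<phi> i = 0" if "i < d" for i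
    using not_less_Least[of i "\<lambda>d. 1 \<le> d \<and> taylor_coeff \<phi> d \<noteq> 0"] that 0 taylor_coeff_0[of \<phi>]
    by (cases "i = 0") (auto simp: d_def)
  have sum: "(\<Sum>i\<le>d. \<zeta> ^ i *s taylor_coeff \<phi> i) = \<zeta> ^ d *s taylor_coeff \<phi> d" for \<zeta>
  proof -
    have "(\<Sum>i\<le>d. \<zeta> ^ i *s taylor_coeff \<phi> i) = (\<Sum>i\<in>{d}. \<zeta> ^ i *s taylor_coeff \<phi> i)"
      using low by (intro sum.mono_neutral_right) auto
    then show ?thesis by simp
  qed
  obtain C where "0 \<le> C" "\<And>\<zeta>. norm \<zeta> < e / 2 \<Longrightarrow> norm (\<phi> \<zeta> - (\<Sum>i\<le>d. \<zeta> ^ i *s taylor_coeff \<phi> i)) \<le> C * norm \<zeta> ^ Suc d"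
    using taylor_coeff_expansion[OF hol e, of d] by blast
  then show thesis using that[of d C] d unfolding sum by blast
qed

lemma vanishing_order_disc:
  fixes \<phi> :: "complex \<Rightarrow> complex ^ 'n"
  assumes hol: "\<And>j. (\<lambda>\<zeta>. \<phi> \<zeta> $ j) holomorphic_on ball 0 e" and e: "0 < e"
    and v: "v \<noteq> 0" "0 \<le> C" and exp: "\<And>\<zeta>. norm \<zeta> < e / 2 \<Longrightarrow> norm (\<phi> \<zeta> - \<zeta> ^ d *s v) \<le> C * norm \<zeta> ^ Suc d"
  shows "vanishing_order \<phi> 0 = ereal (real d)"
proof (rule vanishing_order_eq[OF _ e])
  show "C_infinity_on \<phi> (ball 0 e)"
    by (intro C_infinity_on_componentwise holomorphic_on_C_infinity_on hol open_ball)
  show "bigo_on UNIV d \<phi>"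
  proof (rule bigo_onI[of "min 1 (e/2)" _ _ "norm v + C"])
    fix \<zeta> :: complex assume \<zeta>: "norm \<zeta> < min 1 (e/2)"
    have "norm (\<phi> \<zeta>) \<le> norm (\<phi> \<zeta> - \<zeta> ^ d *s v) + norm (\<zeta> ^ d *s v)" 
      using norm_triangle_ineq[of "\<phi> \<zeta> - \<zeta> ^ d *s v" "\<zeta> ^ d *s v"] by simp
    also have "\<dots> \<le> C * norm \<zeta> ^ d + norm \<zeta> ^ d * norm v"
    proof (rule add_mono)
      have "norm (\<phi> \<zeta> - \<zeta> ^ d *s v) \<le> C * norm \<zeta> ^ Suc d" using exp \<zeta> by simp
      also have "\<dots> \<le> C * norm \<zeta> ^ d" using \<zeta> v(2) by (intro mult_left_mono power_decreasing) auto
      finally show "norm (\<phi> \<zeta> - \<zeta> ^ d *s v) \<le> C * norm \<zeta> ^ d" .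
    qed (simp add: norm_cmul_vec norm_power)
    finally show "norm (\<phi> \<zeta>) \<le> (norm v + C) * norm \<zeta> ^ d" by (simp add: algebra_simps)
  qed (use e in auto)
  show "\<not> bigo_on UNIV (Suc d) \<phi>"
  proof
    assume "bigo_on UNIV (Suc d) \<phi>"
    then obtain C' e' where C': "0 \<le> C'" "0 < e'" "\<And>\<zeta>. norm \<zeta> < e' \<Longrightarrow> norm (\<phi> \<zeta>) \<le> C' * norm \<zeta> ^ Suc d"
      unfolding bigo_on_def by auto
    define t where "t = min (min (e'/2) (e/4)) (norm v / (2 * (C + C' + 1)))"
    have CC: "0 < C + C' + 1" using v C' by simp
    have t: "0 < t" "t < e'" "t < e / 2" using C' e v CC by (auto simp: t_def)
    have "t \<le> norm v / (2 * (C + C' + 1))" by (simp add: t_def)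
    then have tv: "t * (2 * (C + C' + 1)) \<le> norm v" using CC by (subst (asm) pos_le_divide_eq) auto
    have nt: "norm (complex_of_real t) = t" using t by simp
    have "t ^ d * norm v = norm (complex_of_real t ^ d *s v)" using t by (simp add: norm_cmul_vec norm_power)
    also have "\<dots> = norm (\<phi> t - (\<phi> t - complex_of_real t ^ d *s v))" by simp
    also have "\<dots> \<le> norm (\<phi> t) + norm (\<phi> t - complex_of_real t ^ d *s v)" by (rule norm_triangle_ineq4)
    also have "\<dots> \<le> C' * t ^ Suc d + C * t ^ Suc d"
      using C'(3)[of "complex_of_real t"] exp[of "complex_of_real t"] t unfolding nt by (intro add_mono) auto
    also have "\<dots> = t ^ d * (t * (C + C'))" by (simp add: algebra_simps)
    finally have "norm v \<le> t * (C + C')" using t by simp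
    moreover have "t * (C + C') < t * (2 * (C + C' + 1))" using t CC v(2) C'(1) by (intro mult_strict_left_mono) auto
    ultimately show False using tv by linarith
  qed
qed

text \<open>\<open>v\<close> is the limit of \<phi>(t) / t^d as t decreases to 0, and
  \<open>S\<close>, being also a real subspace, is closed.\<close>

lemma leading_coeff_in_subspace:
  fixes \<phi> :: "complex \<Rightarrow> complex ^ 'n"
  assumes S: "vec.subspace S" and e: "0 < e" and \<phi>: "\<And>\<zeta>. norm \<zeta> < e \<Longrightarrow> \<phi> \<zeta> \<in> S"
    and C: "0 \<le> C" and exp: "\<And>\<zeta>. norm \<zeta> < e / 2 \<Longrightarrow> norm (\<phi> \<zeta> - \<zeta> ^ d *s v) \<le> C * norm \<zeta> ^ Suc d"
  shows "v \<in> S"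
proof -
  have scaleR: "c *\<^sub>R x = complex_of_real c *s x" for c and x :: "complex ^ 'n"
    by (simp add: vec_eq_iff) (simp add: scaleR_conv_of_real)
  have "subspace S" unfolding subspace_def scaleR using S unfolding vec.subspace_def by blast
  then have cl: "closed S" by (rule closed_subspace)
  have "v \<in> closure S"
    unfolding closure_approachable
  proof (intro allI impI)
    fix \<epsilon> :: real assume \<epsilon>: "0 < \<epsilon>"
    define t where "t = min (e / 4) (\<epsilon> / (2 * (C + 1)))"
    have t: "0 < t" "t < e / 2" "t < e" using e \<epsilon> C by (auto simp: t_def)
    have "t \<le> \<epsilon> / (2 * (C + 1))" by (simp add: t_def)
    then have t\<epsilon>: "t * (2 * (C + 1)) \<le> \<epsilon>" using C by (subst (asm) pos_le_divide_eq) auto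
    let ?t = "complex_of_real t"
    let ?y = "(1 / ?t ^ d) *s \<phi> ?t"
    have "?y \<in> S" using \<phi>[of ?t] t S by (simp add: vec.subspace_scale)
    have "?y - v = (1 / ?t ^ d) *s (\<phi> ?t - ?t ^ d *s v)"
      using t by (simp add: vec.scale_right_diff_distrib)
    then have "norm (?y - v) = norm (1 / ?t ^ d) * norm (\<phi> ?t - ?t ^ d *s v)" by (simp only: norm_cmul_vec)
    then have "norm (?y - v) = norm (\<phi> ?t - ?t ^ d *s v) / t ^ d"
      using t by (simp add: norm_divide norm_power)
    also have "\<dots> \<le> C * t ^ Suc d / t ^ d" using exp[of ?t] t by (intro divide_right_mono) auto
    also have "\<dots> = C * t" using t by simp
    also have "\<dots> < t * (2 * (C + 1))" using t C by (simp add: mult.commute[of C] mult_less_cancel_left_pos)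
    finally show "\<exists>y\<in>S. dist y v < \<epsilon>" using t\<epsilon> \<open>?y \<in> S\<close> by (intro bexI[of _ ?y]) (auto simp: dist_norm)
  qed
  then show ?thesis using cl by (simp add: closure_closed)
qed

subsection \<open>The three multitypes\<close>

locale weakly_linearly_convex_point = weakly_linearly_convex_germ "\<lambda>x. \<rho> (a + x)" R
  for \<rho> :: "complex ^ 'n::{finite,linorder} \<Rightarrow> real" and a :: "complex ^ 'n::{finite,linorder}" and R :: real
begin

text \<open>The jumps of the flag \<open>V\<close>: \<open>contact k\<close> is the largest \<open>m\<close> such that \<open>V m\<close> has codimension less than
  \<open>card {..k}\<close>.\<close>

definition contact :: "'n \<Rightarrow> ereal" where
  "contact k = (SUP m \<in> {m. CARD('n) < card {..k} + vec.dim (V m)}. ereal (real m))"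

lemma V_small: "m \<le> 1 \<Longrightarrow> V m = UNIV"
  using V_1 V_antimono[of m 1] by auto

lemma card_atMost_bounds: "1 \<le> card {..k :: 'n}" "card {..k :: 'n} \<le> CARD('n)"
proof -
  have "card {k} \<le> card {..k}" by (rule card_mono) auto
  then show "1 \<le> card {..k}" by simp
qed (rule card_mono; simp)

text \<open>The flag decreases, so the admissible \<open>m\<close> form an initial segment of the
  naturals, and a natural number below the supremum is itself admissible.\<close>

lemma le_contact_iff: "ereal (real m) \<le> contact k \<longleftrightarrow> CARD('n) < card {..k} + vec.dim (V m)"
proof
  assume "CARD('n) < card {..k} + vec.dim (V m)"
  then show "ereal (real m) \<le> contact k" unfolding contact_def by (intro SUP_upper) simp
next
  assume le: "ereal (real m) \<le> contact k"
  show "CARD('n) < card {..k} + vec.dim (V m)"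
  proof (rule ccontr)
    assume not: "\<not> ?thesis"
    \<comment> \<open>\<open>V 0\<close> and \<open>V 1\<close> are the whole space, so 0 and 1 are
      always admissible; hence \<open>m - 1\<close> below is a true predecessor.\<close>
    have "\<not> m \<le> 1"
    proof
      assume "m \<le> 1"
      then show False using not V_small[of m] card_atMost_bounds(1)[of k] by (simp only: vec_dim_card)
    qed
    have "contact k \<le> ereal (real (m - 1))"
      unfolding contact_def
    proof (rule SUP_least)
      fix m' assume "m' \<in> {m. CARD('n) < card {..k} + vec.dim (V m)}"
      then have "CARD('n) < card {..k} + vec.dim (V m')" by simp
      then have "m' < m" using not vec.dim_subset[OF V_antimono[of m m']] by (cases "m \<le> m'") auto
      then show "ereal (real m') \<le> ereal (real (m - 1))" by simp
    qed
    then have "ereal (real m) \<le> ereal (real (m - 1))" using le by (rule order_trans[rotated])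
    then show False using \<open>\<not> m \<le> 1\<close> by simp
  qed
qed

lemma contact_cases:
  obtains "contact k = \<infinity>" | l where "1 \<le> l" "contact k = ereal (real l)"
proof (cases "\<forall>m. ereal (real m) \<le> contact k")
  case True
  have "contact k = \<infinity>"
  proof (rule ereal_top)
    fix B
    obtain m where "B \<le> real m" using real_arch_simple by blast
    then show "ereal B \<le> contact k" using True order_trans[of "ereal B" "ereal (real m)"] by simp
  qed
  then show ?thesis using that(1) by blast
next
  case False
  define m where "m = (LEAST m. \<not> ereal (real m) \<le> contact k)"
  have m: "\<not> ereal (real m) \<le> contact k" using LeastI_ex[of "\<lambda>m. \<not> ereal (real m) \<le> contact k"] False by (simp add: m_def)
  have small: "ereal (real i) \<le> contact k" if "i \<le> 1" for i
    unfolding le_contact_iff V_small[OF that] vec_dim_card using card_atMost_bounds(1)[of k] by simp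
  then have m2: "2 \<le> m" using m by (cases "m \<le> 1") auto
  have lo: "ereal (real (m - 1)) \<le> contact k"
    using not_less_Least[of "m - 1" "\<lambda>m. \<not> ereal (real m) \<le> contact k"] m2 by (auto simp: m_def[symmetric])
  have "contact k \<le> ereal (real (m - 1))"
    unfolding contact_def
  proof (rule SUP_least)
    fix m' assume "m' \<in> {m. CARD('n) < card {..k} + vec.dim (V m)}"
    then have "ereal (real m') \<le> contact k" by (simp add: le_contact_iff)
    then have "m' < m" using m order_trans[of "ereal (real m)" "ereal (real m')"] by (cases "m \<le> m'") auto
    then show "ereal (real m') \<le> ereal (real (m - 1))" by simp
  qed
  then have "contact k = ereal (real (m - 1))" using lo by (rule antisym)
  then show ?thesis using that(2)[of "m - 1"] m2 by simp
qed

lemma contact_finite_dim: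
  assumes "contact k = ereal (real l)"
  shows "card {..k} + vec.dim (V (Suc l)) \<le> CARD('n)"
  using le_contact_iff[of "Suc l" k] assms by auto

text \<open>Finite entries are positive integers, so the condition on sums holds with the single
  term \<open>l / l\<close> at position \<open>k\<close>.\<close>

lemma contact_weights: "contact \<in> weights"
proof -
  have "1 \<le> contact k" for k by (rule contact_cases[of k]) (auto simp: one_ereal_def)
  moreover have "mono contact"
  proof (rule monoI)
    fix k k' :: 'n assume "k \<le> k'"
    then have "card {..k} \<le> card {..k'}" by (intro card_mono) auto
    then show "contact k \<le> contact k'" unfolding contact_def by (intro SUP_subset_mono) auto
  qed
  moreover have "contact k = \<infinity> \<or> (\<exists>m :: 'n \<Rightarrow> nat. m k > 0 \<and> (\<Sum>j\<in>{..k}. ereal (real (m j)) / contact j) = 1)" for k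
  proof (rule contact_cases[of k])
    fix l assume l: "1 \<le> l" "contact k = ereal (real l)"
    let ?m = "\<lambda>j. if j = k then l else 0"
    have "(\<Sum>j\<in>{..k}. ereal (real (?m j)) / contact j) = (\<Sum>j\<in>{k}. ereal (real (?m j)) / contact j)"
      by (rule sum.mono_neutral_right) (auto simp flip: zero_ereal_def)
    also have "\<dots> = 1" using l by (simp add: one_ereal_def)
    finally show ?thesis using l(1) by (intro disjI2 exI[of _ ?m]) auto
  qed simp
  ultimately show ?thesis unfolding weights_def by blast
qed

text \<open>For an infinite entry, \<open>e k\<close> has to lie in all \<open>V m\<close> at once.
  Among the admissible \<open>m\<close> one with \<open>V m\<close> of least dimension is taken;
  since the flag decreases, this space is contained in all other admissible ones, which settles
  finite and infinite entries alike.\<close>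

lemma adapted_basis:
  "\<exists>e. (\<forall>k m. ereal (real m) \<le> contact k \<longrightarrow> e k \<in> V m) \<and> (\<forall>k. e k \<notin> vec.span (e ` {k<..}))"
proof -
  have ex: "\<exists>m0. CARD('n) < card {..k} + vec.dim (V m0) \<and> (\<forall>m. CARD('n) < card {..k} + vec.dim (V m) \<longrightarrow> V m0 \<subseteq> V m)" for k :: 'n
  proof -
    let ?S = "\<lambda>m. CARD('n) < card {..k} + vec.dim (V m)"
    have S1: "?S 1" using V_small[of 1] card_atMost_bounds(1)[of k] by (simp add: vec_dim_card del: vec.dim_UNIV)
    define m0 where "m0 = (ARG_MIN (\<lambda>m. vec.dim (V m)) m. ?S m)"
    have m0: "?S m0" "\<And>m. ?S m \<Longrightarrow> vec.dim (V m0) \<le> vec.dim (V m)"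
      unfolding m0_def using arg_min_nat_lemma[of ?S 1 "\<lambda>m. vec.dim (V m)", OF S1] by auto
    have "V m0 \<subseteq> V m" if "?S m" for m
    proof (cases "m \<le> m0")
      case True
      then show ?thesis by (rule V_antimono)
    next
      case False
      then have "V m \<subseteq> V m0" by (intro V_antimono) auto
      then have "V m = V m0" by (rule vec.subspace_dim_equal[OF V_subspace V_subspace _ m0(2)[OF that]])
      then show ?thesis by simp
    qed
    then show ?thesis using m0(1) by blast
  qed
  define m0 where "m0 k = (SOME m0. CARD('n) < card {..k} + vec.dim (V m0) \<and>
    (\<forall>m. CARD('n) < card {..k} + vec.dim (V m) \<longrightarrow> V m0 \<subseteq> V m))" for k :: 'n
  have m0: "CARD('n) < card {..k} + vec.dim (V (m0 k))"
    "CARD('n) < card {..k} + vec.dim (V m) \<Longrightarrow> V (m0 k) \<subseteq> V m" for k m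
    using someI_ex[OF ex[of k]] unfolding m0_def by simp_all
  obtain e where e: "\<forall>k. e k \<in> V (m0 k) \<and> e k \<notin> vec.span (e ` {k<..})"
    using adapted_basis_exists[of "\<lambda>k. V (m0 k)"] m0(1) by blast
  have "e k \<in> V m" if "ereal (real m) \<le> contact k" for k m
    using e m0(2)[of k m] that unfolding le_contact_iff by blast
  then show ?thesis using e by blast
qed

text \<open>In coordinates with respect to the adapted basis, \<open>weighted_bound\<close> bounds
  the defining function by a multiple of the sum of the |w_j|^(m_j). On boxes with sides t^(P / m_j)
  this is O(t^P), while derivatives of weight below 1 cost less than t^P, so they vanish at
  0.\<close>

lemma contact_linearly_distinguished: "contact \<in> linearly_distinguished \<rho> a"
proof -
  obtain e where e: "\<And>k m. ereal (real m) \<le> contact k \<Longrightarrow> e k \<in> V m" "\<And>k. e k \<notin> vec.span (e ` {k<..})"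
    using adapted_basis by blast
  define E :: "complex ^ 'n::{finite,linorder} ^ 'n::{finite,linorder}" where "E = (\<chi> i j. e j $ i)"
  have E: "E *v w = (\<Sum>j\<in>UNIV. w $ j *s e j)" for w
    unfolding matrix_mult_sum by (rule sum.cong) (auto simp: E_def column_def vec_eq_iff)
  have "w = 0" if "E *v w = 0" for w
  proof (rule ccontr)
    assume "w \<noteq> 0"
    then have ne: "{j. w $ j \<noteq> 0} \<noteq> {}" by (auto simp: vec_eq_iff)
    \<comment> \<open>With the least index of a nonzero coordinate, the relation would express
      \<open>e k\<close> through vectors of larger index.\<close>
    define k where "k = Min {j. w $ j \<noteq> 0}"
    have k: "w $ k \<noteq> 0" "\<And>j. j < k \<Longrightarrow> w $ j = 0"
    proof -
      show "w $ k \<noteq> 0" using Min_in[OF _ ne] by (simp add: k_def)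
      show "w $ j = 0" if "j < k" for j
      proof (rule ccontr)
        assume "w $ j \<noteq> 0"
        then have "k \<le> j" unfolding k_def by (intro Min_le) auto
        then show False using that by simp
      qed
    qed
    have "0 = (\<Sum>j\<in>UNIV. w $ j *s e j)" using that E by simp
    also have "\<dots> = (\<Sum>j\<in>{k..}. w $ j *s e j)" using k(2) by (intro sum.mono_neutral_right) (auto simp: not_le)
    also have "{k..} = insert k {k<..}" by auto
    finally have "w $ k *s e k = - (\<Sum>j\<in>{k<..}. w $ j *s e j)" by (simp add: eq_neg_iff_add_eq_0)
    moreover have "(\<Sum>j\<in>{k<..}. w $ j *s e j) \<in> vec.span (e ` {k<..})"
      by (intro vec.span_sum vec.span_scale vec.span_base) auto
    ultimately have "w $ k *s e k \<in> vec.span (e ` {k<..})" by (simp add: vec.span_neg)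
    from vec.span_scale[OF this, of "1 / w $ k"] show False using e(2)[of k] k(1) by simp
  qed
  then obtain B where B: "B ** E = mat 1" using matrix_left_invertible_ker by blast
  then have invB: "invertible B" "matrix_inv B = E"
    using invertible_right_inverse matrix_inv_eq by blast+
  let ?\<psi> = "\<lambda>w. a + matrix_inv B *v w"
  have coords: "affine_coordinates a (\<lambda>x. B *v (x - a)) ?\<psi>"
    unfolding affine_coordinates_def using invB(1) by blast
  let ?f = "\<lambda>w. complex_of_real ((\<rho> \<circ> ?\<psi>) w)"
  have f_eq: "?f w = complex_of_real (\<rho> (a + (\<Sum>j\<in>UNIV. w $ j *s e j)))" for w by (simp add: invB E)
  have blE: "bounded_linear ((*v) E)"
    using matrix_vector_mul_bounded_linear by blast
  obtain R' where R': "0 < R'" "C_infinity_on ?f (ball 0 R')"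
  proof -
    have "isCont ((*v) E) 0" using blE linear_continuous_at by blast
    then obtain R' where R': "R' > 0" "\<And>w. dist w 0 < R' \<Longrightarrow> dist (E *v w) (E *v 0) < R"
      using R unfolding continuous_at_eps_delta by blast
    have "C_infinity_on ((\<lambda>x. \<rho> (a + x)) \<circ> (\<lambda>w. 0 + E *v w)) (ball 0 R')"
      by (rule C_infinity_on_compose[OF open_ball open_ball _ C_infinity_on_affine[OF open_ball blE] smooth])
        (use R'(2) in auto)
    then have "C_infinity_on (\<lambda>w. complex_of_real (((\<lambda>x. \<rho> (a + x)) \<circ> (\<lambda>w. 0 + E *v w)) w)) (ball 0 R')"
      by (intro C_infinity_on_bounded_linear[OF open_ball bounded_linear_of_real])
    then show ?thesis using that R'(1) by (simp add: o_def invB)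
  qed
  have "vanishes_to_weight (\<rho> \<circ> ?\<psi>) contact"
    unfolding vanishes_to_weight_def
  proof (intro allI impI)
    fix \<alpha> \<beta> :: "'n \<Rightarrow> nat"
    assume less: "(\<Sum>j\<in>UNIV. ereal (real (\<alpha> j + \<beta> j)) / contact j) < 1"
    let ?w = "\<lambda>j. real (\<alpha> j + \<beta> j)"
    have "\<exists>l. 1 \<le> l \<and> (contact j = \<infinity> \<or> contact j = ereal (real l))" for j
      by (rule contact_cases[of j]) auto
    then obtain l where l: "\<And>j. 1 \<le> l j" "\<And>j. contact j = \<infinity> \<or> contact j = ereal (real (l j))" by metis
    define s where "s = (\<Sum>j | contact j \<noteq> \<infinity>. ?w j / real (l j))"
    have "(\<Sum>j\<in>UNIV. ereal (?w j) / contact j) = (\<Sum>j | contact j \<noteq> \<infinity>. ereal (?w j) / contact j)"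
      by (rule sum.mono_neutral_right) auto
    also have "\<dots> = (\<Sum>j | contact j \<noteq> \<infinity>. ereal (?w j / real (l j)))"
    proof (rule sum.cong)
      fix j assume "j \<in> {j. contact j \<noteq> \<infinity>}"
      then have "contact j = ereal (real (l j))" using l(2)[of j] by simp
      then show "ereal (?w j) / contact j = ereal (?w j / real (l j))" using l(1)[of j] by simp
    qed simp
    also have "\<dots> = ereal s" by (simp add: s_def)
    finally have s: "s < 1" using less by (simp add: one_ereal_def)
    \<comment> \<open>\<open>M\<close> stands in for the infinite entries. It is so large that the
      total weight stays below 1 even when all the (\<alpha>_j + \<beta>_j) / M are added to
      \<open>s\<close>.\<close>
    obtain M :: nat where M: "(\<Sum>j\<in>UNIV. ?w j) / (1 - s) < real M" using reals_Archimedean2 by blast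
    have M0: "0 < real M" using M s by (smt (verit) divide_nonneg_pos of_nat_0_le_iff sum_nonneg)
    then have M1: "1 \<le> M" by simp
    define m where "m j = (if contact j = \<infinity> then M else l j)" for j
    have m: "1 \<le> m j" "ereal (real (m j)) \<le> contact j" for j
      using l(1)[of j] l(2)[of j] M1 by (auto simp: m_def)
    have "(\<Sum>j\<in>UNIV. ?w j / real (m j)) = s + (\<Sum>j | contact j = \<infinity>. ?w j / real M)"
    proof -
      have "(\<Sum>j\<in>UNIV. ?w j / real (m j)) = (\<Sum>j\<in>{j. contact j \<noteq> \<infinity>} \<union> {j. contact j = \<infinity>}. ?w j / real (m j))"
        by (rule sum.cong) auto
      also have "\<dots> = (\<Sum>j | contact j \<noteq> \<infinity>. ?w j / real (m j)) + (\<Sum>j | contact j = \<infinity>. ?w j / real (m j))"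
        by (rule sum.union_disjoint) auto
      finally show ?thesis by (simp add: s_def m_def)
    qed
    also have "\<dots> \<le> s + (\<Sum>j\<in>UNIV. ?w j / real M)"
      using M0 by (intro add_left_mono sum_mono2) auto
    also have "\<dots> = s + (\<Sum>j\<in>UNIV. ?w j) / real M" by (simp only: sum_divide_distrib)
    also have "\<dots> < 1"
    proof -
      have "(\<Sum>j\<in>UNIV. ?w j) < real M * (1 - s)" using M s by (simp only: pos_divide_less_eq[of "1 - s"] diff_gt_0_iff_gt)
      then have "(\<Sum>j\<in>UNIV. ?w j) / real M < 1 - s" using M0 by (simp only: pos_divide_less_eq mult.commute)
      then show ?thesis by simp
    qed
    finally have sum_less: "(\<Sum>j\<in>UNIV. ?w j / real (m j)) < 1" .
    \<comment> \<open>A common multiple of the \<open>m j\<close>, so that the box exponents are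
      integers with \<open>b j * m j = P\<close>.\<close>
    define P where "P = (\<Prod>j\<in>UNIV. m j)"
    define b where "b j = P div m j" for j
    have bm: "b j * m j = P" for j by (simp add: b_def P_def dvd_div_mult_self dvd_prodI)
    have P: "0 < P" using m(1) by (simp add: P_def Suc_le_eq)
    have b: "0 < b j" for j using bm[of j] P by (cases "b j = 0") auto
    have "real (\<Sum>j\<in>UNIV. b j * (\<alpha> j + \<beta> j)) = real P * (\<Sum>j\<in>UNIV. ?w j / real (m j))"
    proof -
      have "real (b j) = real P / real (m j)" for j using bm[of j] m(1)[of j] by (simp add: field_simps flip: of_nat_mult)
      then show ?thesis by (simp add: sum_distrib_left)
    qed
    also have "\<dots> < real P * 1" using sum_less P by (intro mult_strict_left_mono) auto
    finally have wt: "(\<Sum>j\<in>UNIV. b j * (\<alpha> j + \<beta> j)) < P" by (simp only: mult_1_right of_nat_less_iff)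
    obtain C \<delta> where C: "0 \<le> C" "0 < \<delta>" "\<And>c. (\<forall>j\<in>UNIV. norm (c j) < \<delta>) \<Longrightarrow>
      \<bar>\<rho> (a + (\<Sum>j\<in>UNIV. c j *s e j))\<bar> \<le> C * (\<Sum>j\<in>UNIV. norm (c j) ^ m j)"
      using weighted_bound[of UNIV e m] e(1)[OF m(2)] m(1) by auto
    have "box_bigo (coord_box b) P ?f"
      unfolding box_bigo_def
    proof (intro allI impI)
      fix A :: real assume A: "0 < A"
      obtain t0 where t0: "t0 > 0" "\<forall>t. 0 < t \<longrightarrow> t < t0 \<longrightarrow> coord_box b A t \<subseteq> ball (0 :: complex ^ 'n::{finite,linorder}) \<delta>"
        using boxes_shrink_coord_box[of b, OF b] A C(2) unfolding boxes_shrink_def by blast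
      have "norm (?f w) \<le> (C * (\<Sum>j\<in>UNIV. A ^ m j)) * t ^ P" if t: "0 < t" "t < t0" and w: "w \<in> coord_box b A t" for t w
      proof -
        have "norm w < \<delta>" using t0(2)[rule_format, OF t] w by (auto dest: subsetD)
        then have "\<forall>j\<in>UNIV. norm (w $ j) < \<delta>" using Finite_Cartesian_Product.norm_nth_le order_le_less_trans by blast
        then have "norm (?f w) \<le> C * (\<Sum>j\<in>UNIV. norm (w $ j) ^ m j)" unfolding f_eq norm_of_real by (rule C(3))
        also have "\<dots> \<le> C * (\<Sum>j\<in>UNIV. (A * t ^ b j) ^ m j)"
          using w C(1) by (intro mult_left_mono sum_mono power_mono) (auto simp: coord_box_def)
        also have "\<dots> = C * (\<Sum>j\<in>UNIV. A ^ m j * t ^ P)" by (simp add: power_mult_distrib bm flip: power_mult)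
        also have "\<dots> = (C * (\<Sum>j\<in>UNIV. A ^ m j)) * t ^ P" by (simp add: sum_distrib_right mult.assoc)
        finally show ?thesis .
      qed
      then show "\<exists>C t0. 0 < t0 \<and> (\<forall>t x. 0 < t \<longrightarrow> t < t0 \<longrightarrow> x \<in> coord_box b A t \<longrightarrow> norm (?f x) \<le> C * t ^ P)"
        using t0(1) by blast
    qed
    then show "wirtinger_multi \<alpha> (wirtinger_bar_multi \<beta> ?f) 0 = 0"
      by (rule wirtinger_multi_zero_if_box_bigo[OF R'(2,1) b _ wt])
  qed
  then show ?thesis unfolding linearly_distinguished_def using contact_weights coords by blast
qed

text \<open>A subspace of dimension \<open>card {..k}\<close> meets every admissible
  \<open>V m\<close> in a nonzero vector, whose line has order at least \<open>m\<close>; this is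
  the lower bound. If the entry is a finite \<open>l\<close>, some subspace of this dimension meets
  \<open>V (Suc l)\<close> trivially. A disc of order \<open>d\<close> in it has leading coefficient
  outside \<open>V (Suc l)\<close>, so by \<open>curve_coefficient\<close> its order of contact is
  at most \<open>l * d\<close>.\<close>

lemma dangelo_multitype_eq_contact: "dangelo_multitype \<rho> a = contact"
proof
  fix k :: 'n
  \<comment> \<open>Position \<open>k\<close> carries the \<open>q\<close>-type with
    \<open>q = n + 1 - card {..k}\<close>, whose test subspaces have dimension n - q + 1.\<close>
  have dim: "CARD('n) - (CARD('n) + 1 - card {..k}) + 1 = card {..k}"
    using card_atMost_bounds[of k] by simp
  let ?\<Delta> = "\<lambda>S. SUP \<phi> \<in> holomorphic_discs a S. vanishing_order (\<rho> \<circ> \<phi>) 0 / vanishing_order (\<lambda>\<zeta>. \<phi> \<zeta> - a) 0"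
  have D: "dangelo_multitype \<rho> a k = (INF S \<in> complex_affine_subspaces a (card {..k}). ?\<Delta> S)"
    unfolding dangelo_multitype_def dangelo_type_def dim ..
  have "contact k \<le> dangelo_multitype \<rho> a k"
    unfolding D
  proof (rule INF_greatest)
    fix S assume "S \<in> complex_affine_subspaces a (card {..k})"
    then obtain W where W: "S = (\<lambda>v. a + v) ` W" "vec.subspace W" "vec.dim W = card {..k}"
      unfolding complex_affine_subspaces_def by blast
    show "contact k \<le> ?\<Delta> S"
      unfolding contact_def
    proof (rule SUP_least)
      fix m assume "m \<in> {m. CARD('n) < card {..k} + vec.dim (V m)}"
      then have "CARD('n) < vec.dim W + vec.dim (V m)" using W(3) by simp
      then obtain v where v: "v \<in> W" "v \<in> V m" "v \<noteq> 0" using subspace_Int_nontrivial[OF W(2) V_subspace] by blast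
      let ?\<phi> = "\<lambda>\<zeta>. a + \<zeta> *s v"
      have disc: "?\<phi> \<in> holomorphic_discs a S"
        unfolding holomorphic_discs_def mem_Collect_eq
      proof (intro conjI exI[of _ 1] allI)
        show "(\<lambda>\<zeta>. ?\<phi> \<zeta> $ j) holomorphic_on ball 0 1" for j by (auto intro!: holomorphic_intros)
        show "?\<phi> ` ball 0 1 \<subseteq> S" unfolding W(1) using vec.subspace_scale[OF W(2) v(1)] by blast
        show "\<not> ?\<phi> constant_on ball 0 1"
        proof
          assume "?\<phi> constant_on ball 0 1"
          then obtain y where y: "\<forall>\<zeta>\<in>ball 0 1. ?\<phi> \<zeta> = y" unfolding constant_on_def by blast
          have "?\<phi> (1/2) = ?\<phi> 0" using bspec[OF y, of "1/2"] bspec[OF y, of 0] by (simp del: vec.scale_eq_0_iff)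
          then show False using v(3) by simp
        qed
      qed auto
      have 1: "vanishing_order (\<lambda>\<zeta>. ?\<phi> \<zeta> - a) 0 = ereal (real 1)"
        by (rule vanishing_order_disc[of _ 1 v 0]) (use v(3) in \<open>auto intro!: holomorphic_intros\<close>)
      obtain e where e: "e > 0" "C_infinity_on (\<lambda>\<eta>. \<rho> (a + \<eta> *s v)) (ball 0 e)" using line_smooth by blast
      have "ereal (real m) \<le> vanishing_order (\<lambda>\<eta>. \<rho> (a + \<eta> *s v)) 0"
        using le_vanishing_order_iff[OF e(2,1)] v(2) unfolding V_def by blast
      then have "ereal (real m) \<le> vanishing_order (\<rho> \<circ> ?\<phi>) 0 / vanishing_order (\<lambda>\<zeta>. ?\<phi> \<zeta> - a) 0"
        unfolding 1 by (simp add: o_def flip: one_ereal_def)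
      also have "\<dots> \<le> ?\<Delta> S" by (rule SUP_upper[OF disc])
      finally show "ereal (real m) \<le> ?\<Delta> S" .
    qed
  qed
  moreover have "dangelo_multitype \<rho> a k \<le> contact k"
  proof (rule contact_cases[of k])
    fix l assume l: "1 \<le> l" "contact k = ereal (real l)"
    obtain W where W: "vec.subspace W" "vec.dim W = card {..k}" "W \<inter> V (Suc l) \<subseteq> {0}"
      using subspace_complement[OF V_subspace contact_finite_dim[OF l(2)]] by blast
    let ?S = "(\<lambda>v. a + v) ` W"
    have "?S \<in> complex_affine_subspaces a (card {..k})"
      unfolding complex_affine_subspaces_def using W by blast
    then have "dangelo_multitype \<rho> a k \<le> ?\<Delta> ?S" unfolding D by (rule INF_lower)
    also have "\<dots> \<le> ereal (real l)"
    proof (rule SUP_least)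
      fix \<phi> assume "\<phi> \<in> holomorphic_discs a ?S"
      then obtain e where \<phi>0: "\<phi> 0 = a" and e: "0 < e" "\<And>j. (\<lambda>\<zeta>. \<phi> \<zeta> $ j) holomorphic_on ball 0 e"
        "\<phi> ` ball 0 e \<subseteq> ?S" "\<not> \<phi> constant_on ball 0 e" unfolding holomorphic_discs_def by blast
      define \<theta> where "\<theta> \<zeta> = \<phi> \<zeta> - a" for \<zeta>
      have hol: "(\<lambda>\<zeta>. \<theta> \<zeta> $ j) holomorphic_on ball 0 e" for j
        unfolding \<theta>_def vector_minus_component by (intro holomorphic_on_diff e(2) holomorphic_on_const)
      have W\<theta>: "\<theta> \<zeta> \<in> W" if "norm \<zeta> < e" for \<zeta>
      proof -
        have "\<phi> \<zeta> \<in> ?S" using e(3) that by auto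
        then show ?thesis by (auto simp: \<theta>_def)
      qed
      have "\<not> \<theta> constant_on ball 0 e"
      proof
        assume "\<theta> constant_on ball 0 e"
        then obtain y where "\<forall>\<zeta>\<in>ball 0 e. \<theta> \<zeta> = y" unfolding constant_on_def by blast
        then have "\<forall>\<zeta>\<in>ball 0 e. \<phi> \<zeta> = y + a" by (auto simp: \<theta>_def algebra_simps)
        then show False using e(4) unfolding constant_on_def by blast
      qed
      moreover have \<theta>0: "\<theta> 0 = 0" by (simp add: \<theta>_def \<phi>0)
      ultimately obtain d C where d: "1 \<le> d" "taylor_coeff \<theta> d \<noteq> 0" "0 \<le> C"
        "\<And>\<zeta>. norm \<zeta> < e / 2 \<Longrightarrow> norm (\<theta> \<zeta> - \<zeta> ^ d *s taylor_coeff \<theta> d) \<le> C * norm \<zeta> ^ Suc d"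
        using nonconstant_disc_order[OF hol e(1)] by blast
      have ord: "vanishing_order (\<lambda>\<zeta>. \<phi> \<zeta> - a) 0 = ereal (real d)"
        using vanishing_order_disc[OF hol e(1) d(2,3,4)] by (simp add: \<theta>_def[abs_def])
      have inW: "taylor_coeff \<theta> d \<in> W" by (rule leading_coeff_in_subspace[OF W(1) e(1) W\<theta> d(3,4)])
      obtain e' where e': "0 < e'" "C_infinity_on ((\<lambda>x. \<rho> (a + x)) \<circ> \<theta>) (ball 0 e')"
      proof -
        have C\<theta>: "C_infinity_on \<theta> (ball 0 e)"
          by (intro C_infinity_on_componentwise holomorphic_on_C_infinity_on hol open_ball)
        have "isCont \<theta> 0"
          using C_infinity_on_continuous_on[OF C\<theta>] e(1) continuous_on_eq_continuous_at[of "ball 0 e" \<theta>] by auto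
        then obtain \<delta> where \<delta>: "\<delta> > 0" "\<And>\<zeta>. dist \<zeta> 0 < \<delta> \<Longrightarrow> dist (\<theta> \<zeta>) (\<theta> 0) < R"
          using R unfolding continuous_at_eps_delta by blast
        have "C_infinity_on ((\<lambda>x. \<rho> (a + x)) \<circ> \<theta>) (ball 0 (min e \<delta>))"
          by (rule C_infinity_on_compose[OF open_ball open_ball _ C_infinity_on_subset[OF C\<theta>] smooth])
            (use \<delta>(2) \<theta>0 in auto)
        then show ?thesis using that[of "min e \<delta>"] \<delta>(1) e(1) by simp
      qed
      have comp: "(\<lambda>x. \<rho> (a + x)) \<circ> \<theta> = \<rho> \<circ> \<phi>" by (simp add: fun_eq_iff \<theta>_def)
      have "\<not> bigo_on UNIV (Suc (l * d)) ((\<lambda>x. \<rho> (a + x)) \<circ> \<theta>)"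
      proof
        assume bigo: "bigo_on UNIV (Suc (l * d)) ((\<lambda>x. \<rho> (a + x)) \<circ> \<theta>)"
        obtain C' where C': "\<And>\<zeta>. norm \<zeta> < e / 2 \<Longrightarrow>
            norm (\<theta> \<zeta> - (\<Sum>i\<le>l * d. \<zeta> ^ i *s taylor_coeff \<theta> i)) \<le> C' * norm \<zeta> ^ Suc (l * d)"
          using taylor_coeff_expansion[OF hol e(1), of "l * d"] by blast
        \<comment> \<open>The contact order is assumed to be at least \<open>Suc (l * d)\<close>,
          just above \<open>l * d\<close>; the expansion up to degree \<open>l * d\<close> contains
          index \<open>d\<close> because \<open>l \<ge> 1\<close>.\<close>
        have "taylor_coeff \<theta> d \<in> V (Suc l)"
          by (rule curve_coefficient[where e = "e / 2", OF _ C' _ _ bigo]) (use e(1) d(1) l(1) \<theta>0 taylor_coeff_0[of \<theta>] in auto)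
        then show False using W(3) inW d(2) by blast
      qed
      then obtain vs where vs: "length vs < Suc (l * d)" "iterated_derivative (\<rho> \<circ> \<phi>) vs 0 \<noteq> 0"
        using bigo_on_iff_iterated_derivative[OF e'(2,1), of "Suc (l * d)"] unfolding comp by blast
      then have "vanishing_order (\<rho> \<circ> \<phi>) 0 \<le> ereal (real (length vs))"
        unfolding vanishing_order_def by (intro Inf_lower) auto
      also have "\<dots> \<le> ereal (real d) * ereal (real l)" using vs(1) by (simp add: mult.commute flip: of_nat_mult)
      finally show "vanishing_order (\<rho> \<circ> \<phi>) 0 / vanishing_order (\<lambda>\<zeta>. \<phi> \<zeta> - a) 0 \<le> ereal (real l)"
        unfolding ord using d(1) by (subst ereal_divide_le_pos) auto
    qed
    finally show ?thesis by (simp add: l(2))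
  qed simp
  ultimately show "dangelo_multitype \<rho> a k = contact k" by (rule antisym[rotated])
qed

text \<open>It is enough to exclude an index \<open>k\<close> with
  \<open>contact k < \<Lambda> k\<close>. If \<open>contact k = l\<close>, the weights of the
  coordinates from \<open>k\<close> on exceed \<open>l\<close>, so the defining function is
  O(|w|^(l+1)) on the coordinate subspace \<open>?X\<close>. Lines of \<open>?X\<close> become
  curves with tangent vector \<open>A *v w\<close> and contact of order at least
  \<open>l + 1\<close>, so \<open>curve_coefficient\<close> with index 1 puts these vectors into
  \<open>V (Suc l)\<close>. Since \<open>A\<close> is injective, this space is then too large for
  \<open>contact k = l\<close>.\<close>

lemma distinguished_lex_le_contact:
  assumes "\<Lambda> \<in> distinguished \<rho> a"
  shows "lex_le \<Lambda> contact"
proof (rule ccontr)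
  assume not: "\<not> lex_le \<Lambda> contact"
  have "less_fun \<Lambda> contact \<or> \<Lambda> = contact \<or> less_fun contact \<Lambda>" by (rule less_fun_trichotomy) simp
  then obtain k where k: "contact k < \<Lambda> k" using not unfolding lex_le_def less_fun_def by blast
  from assms obtain z \<psi> where \<Lambda>: "\<Lambda> \<in> weights" and "local_holomorphic_coordinates a z \<psi>"
    and van: "vanishes_to_weight (\<rho> \<circ> \<psi>) \<Lambda>" unfolding distinguished_def by blast
  then obtain U W where UW: "open U" "a \<in> U" "open W" "homeomorphism U W z \<psi>"
    "holomorphic_map_on z U" "holomorphic_map_on \<psi> W" and z0: "z a = 0"
    unfolding local_holomorphic_coordinates_def by blast
  have W0: "0 \<in> W" using homeomorphism_image1[OF UW(4)] UW(2) z0 by force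
  have \<psi>0: "\<psi> 0 = a" using homeomorphism_apply1[OF UW(4,2)] z0 by simp
  obtain l where l: "1 \<le> l" "contact k = ereal (real l)" by (rule contact_cases[of k]) (use k in auto)
  obtain A where A: "(\<psi> has_derivative (\<lambda>v. A *v v)) (at 0)" using UW(6) W0 unfolding holomorphic_map_on_def by blast
  obtain A' where A': "(z has_derivative (\<lambda>v. A' *v v)) (at a)" using UW(5,2) unfolding holomorphic_map_on_def by blast
  have AA: "A' *v (A *v v) = v" for v
  proof -
    have "(z \<circ> \<psi> has_derivative (\<lambda>v. A' *v v) \<circ> (\<lambda>v. A *v v)) (at 0)" using diff_chain_at[OF A] A' \<psi>0 by simp
    then have "((\<lambda>x. x) has_derivative (\<lambda>v. A' *v v) \<circ> (\<lambda>v. A *v v)) (at 0)"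
      by (rule has_derivative_transform_within_open[OF _ UW(3) W0]) (simp add: homeomorphism_apply2[OF UW(4)])
    then have "(\<lambda>v. A' *v v) \<circ> (\<lambda>v. A *v v) = (\<lambda>x. x)" using has_derivative_unique[OF _ has_derivative_ident] by blast
    then show ?thesis by (metis o_apply)
  qed
  obtain e0 where e0: "0 < e0" "ball 0 e0 \<subseteq> W" using UW(3) W0 openE by blast
  have C\<psi>: "C_infinity_on \<psi> (ball 0 e0)"
    by (rule C_infinity_on_subset[OF holomorphic_map_on_C_infinity_on[OF UW(6,3)] e0(2)])
  have "isCont \<psi> 0"
    using C_infinity_on_continuous_on[OF C\<psi>] e0(1) continuous_on_eq_continuous_at[of "ball 0 e0" \<psi>] by auto
  then obtain e1 where e1: "e1 > 0" "\<And>w. dist w 0 < e1 \<Longrightarrow> dist (\<psi> w) (\<psi> 0) < R"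
    using R unfolding continuous_at_eps_delta by blast
  define e where "e = min e0 e1"
  have e: "0 < e" "ball 0 e \<subseteq> W" using e0 e1 by (auto simp: e_def)
  let ?f = "\<lambda>w. complex_of_real ((\<rho> \<circ> \<psi>) w)"
  have Cf: "C_infinity_on ?f (ball 0 e)"
  proof -
    have "C_infinity_on (\<lambda>w. - a + \<psi> w) (ball 0 e)"
      by (intro C_infinity_on_add open_ball C_infinity_on_subset[OF C\<psi>])
        (auto simp: e_def C_infinity_on_def Ck_on_const)
    moreover have "- a + \<psi> w \<in> ball 0 R" if "w \<in> ball 0 e" for w
      using e1(2)[of w] that by (simp add: e_def dist_norm \<psi>0 norm_minus_commute)
    then have "(\<lambda>w. - a + \<psi> w) ` ball 0 e \<subseteq> ball 0 R" by blast
    ultimately have "C_infinity_on ((\<lambda>x. \<rho> (a + x)) \<circ> (\<lambda>w. - a + \<psi> w)) (ball 0 e)"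
      using C_infinity_on_compose[OF open_ball open_ball _ _ smooth] by blast
    from C_infinity_on_bounded_linear[OF open_ball bounded_linear_of_real this] show ?thesis by (simp add: o_def)
  qed
  let ?X = "{w :: complex ^ 'n::{finite,linorder}. \<forall>j. j \<notin> {k..} \<longrightarrow> w $ j = 0}"
  \<comment> \<open>A multi-index of total order at most \<open>l\<close> in the coordinates from
    \<open>k\<close> on has weight at most l / \<Lambda>_k < 1, since \<open>\<Lambda>\<close> is
    nondecreasing.\<close>
  have bigo_X: "bigo_on ?X (Suc l) ?f"
  proof (rule bigo_on_if_wirtinger_zero[OF Cf e(1)])
    fix \<alpha> \<beta> :: "'n \<Rightarrow> nat"
    assume supp: "\<forall>j. j \<notin> {k..} \<longrightarrow> \<alpha> j = 0 \<and> \<beta> j = 0" and less: "(\<Sum>j\<in>UNIV. \<alpha> j + \<beta> j) < Suc l"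
    have \<Lambda>pos: "0 < \<Lambda> j" for j using \<Lambda> unfolding weights_def by (auto intro: less_le_trans[of 0 1])
    have "(\<Sum>j\<in>UNIV. ereal (real (\<alpha> j + \<beta> j)) / \<Lambda> j) \<le> (\<Sum>j\<in>UNIV. ereal (real (\<alpha> j + \<beta> j)) / \<Lambda> k)"
    proof (rule sum_mono)
      fix j
      show "ereal (real (\<alpha> j + \<beta> j)) / \<Lambda> j \<le> ereal (real (\<alpha> j + \<beta> j)) / \<Lambda> k"
      proof (cases "\<alpha> j + \<beta> j = 0")
        case True
        then show ?thesis by (simp flip: zero_ereal_def)
      next
        case False
        then have "k \<le> j" using supp by (metis add_0 atLeast_iff)
        then have "\<Lambda> k \<le> \<Lambda> j" using \<Lambda> unfolding weights_def mono_def by blast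
        then show ?thesis using False \<Lambda>pos[of k] \<Lambda>pos[of j]
          by (intro ereal_divide_left_mono) (auto simp: ereal_zero_less_0_iff)
      qed
    qed
    also have "\<dots> < 1"
    proof (cases "\<Lambda> k")
      case (real x)
      then have x: "real l < x" using k l(2) by simp
      have "(\<Sum>j\<in>UNIV. ereal (real (\<alpha> j + \<beta> j)) / \<Lambda> k) = ereal (\<Sum>j\<in>UNIV. real (\<alpha> j + \<beta> j) / x)"
        using x l(1) real by simp
      also have "(\<Sum>j\<in>UNIV. real (\<alpha> j + \<beta> j) / x) = real (\<Sum>j\<in>UNIV. \<alpha> j + \<beta> j) / x"
        by (simp only: sum_divide_distrib of_nat_sum)
      also have "ereal \<dots> < 1"
      proof -
        have "real (\<Sum>j\<in>UNIV. \<alpha> j + \<beta> j) \<le> real l" using less by (simp only: of_nat_le_iff less_Suc_eq_le)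
        then have "real (\<Sum>j\<in>UNIV. \<alpha> j + \<beta> j) < x" using x by simp
        then show ?thesis using x l(1) by (simp add: one_ereal_def)
      qed
      finally show ?thesis .
    qed (use \<Lambda>pos[of k] in auto)
    finally show "wirtinger_multi \<alpha> (wirtinger_bar_multi \<beta> ?f) 0 = 0"
      using van unfolding vanishes_to_weight_def by blast
  qed
  have "A *v w \<in> V (Suc l)" if w: "w \<in> ?X" for w
  proof -
    define \<theta> where "\<theta> \<eta> = \<psi> (0 + \<eta> *s w) - a" for \<eta> :: complex
    obtain d where d: "0 < d" and small: "\<And>\<eta>. norm \<eta> \<le> d \<Longrightarrow> norm (\<eta> *s w) < e"
      using cmul_vec_small[OF e(1), of w] by blast
    have inW: "0 + \<eta> *s w \<in> W" if "norm \<eta> \<le> d" for \<eta> using small[OF that] e(2) by auto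
    have hol: "(\<lambda>\<eta>. \<theta> \<eta> $ j) holomorphic_on ball 0 d" for j
      unfolding \<theta>_def vector_minus_component
      by (intro holomorphic_on_diff holomorphic_on_const holomorphic_along(1)[OF holomorphic_map_on_component[OF UW(6)]] inW)
    have c1: "taylor_coeff \<theta> 1 = A *v w"
    proof (subst vec_eq_iff, rule allI)
      fix j
      have "((\<lambda>\<eta>. \<psi> (0 + \<eta> *s w) $ j) has_field_derivative deriv_along w (\<lambda>x. \<psi> x $ j) (0 + 0 *s w)) (at 0)"
        by (rule has_field_derivative_along[OF holomorphic_map_on_component[OF UW(6)] inW]) (use d in simp)
      moreover have "deriv_along w (\<lambda>x. \<psi> x $ j) 0 = (A *v w) $ j"
        by (rule deriv_along_eq[OF bounded_linear.has_derivative[OF bounded_linear_vec_nth A]])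
      ultimately have "((\<lambda>\<eta>. \<psi> (0 + \<eta> *s w) $ j - a $ j) has_field_derivative (A *v w) $ j - 0) (at 0)"
        by (intro DERIV_diff DERIV_const) simp
      then show "taylor_coeff \<theta> 1 $ j = (A *v w) $ j" by (simp add: taylor_coeff_def \<theta>_def DERIV_imp_deriv)
    qed
    obtain C e2 where C: "0 \<le> C" "0 < e2" "\<forall>x\<in>?X. norm x < e2 \<longrightarrow> norm (?f x) \<le> C * norm x ^ Suc l"
      using bigo_X unfolding bigo_on_def by blast
    obtain d2 where d2: "0 < d2" "\<And>\<eta>. norm \<eta> \<le> d2 \<Longrightarrow> norm (\<eta> *s w) < e2"
      using cmul_vec_small[OF C(2), of w] by blast
    have bigo: "bigo_on UNIV (Suc l) ((\<lambda>x. \<rho> (a + x)) \<circ> \<theta>)"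
    proof (rule bigo_onI[of d2 _ _ "C * norm w ^ Suc l"])
      fix \<eta> :: complex assume "norm \<eta> < d2"
      then have "norm (\<eta> *s w) < e2" by (intro d2(2)) simp
      moreover have "\<eta> *s w \<in> ?X" using w by simp
      ultimately have "norm (?f (\<eta> *s w)) \<le> C * norm (\<eta> *s w) ^ Suc l" using C(3) by blast
      then show "norm (((\<lambda>x. \<rho> (a + x)) \<circ> \<theta>) \<eta>) \<le> C * norm w ^ Suc l * norm \<eta> ^ Suc l"
        by (simp add: \<theta>_def norm_cmul_vec power_mult_distrib mult_ac)
    qed (rule d2(1))
    obtain C' where C': "\<And>\<zeta>. norm \<zeta> < d / 2 \<Longrightarrow>
        norm (\<theta> \<zeta> - (\<Sum>i\<le>Suc l. \<zeta> ^ i *s taylor_coeff \<theta> i)) \<le> C' * norm \<zeta> ^ Suc (Suc l)"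
      using taylor_coeff_expansion[OF hol d, of "Suc l"] by blast
    have "taylor_coeff \<theta> 1 \<in> V (Suc l)"
      by (rule curve_coefficient[where e = "d / 2", OF _ C' _ _ bigo]) (use d in \<open>auto simp: taylor_coeff_0 \<theta>_def \<psi>0\<close>)
    then show ?thesis by (simp only: c1)
  qed
  then have "(\<lambda>w. A *v w) ` ?X \<subseteq> V (Suc l)" by blast
  then have "vec.dim ((\<lambda>w. A *v w) ` ?X) \<le> vec.dim (V (Suc l))" by (rule vec.dim_subset)
  moreover have "vec.dim ((\<lambda>w. A *v w) ` ?X) = vec.dim ?X"
  proof (rule vec.dim_image_eq)
    show "inj_on (\<lambda>w. A *v w) (vec.span ?X)" by (rule inj_on_inverseI[of _ "\<lambda>v. A' *v v"]) (rule AA)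
  qed (rule matrix_vector_mul_linear_gen)
  moreover have "vec.dim ?X = card {k..}" by (rule dim_substandard_cart)
  moreover have "card {..k} + card {k..} = Suc (CARD('n))"
  proof -
    have "card {..k} + card {k..} = card ({..k} \<union> {k..}) + card ({..k} \<inter> {k..})" by (rule card_Un_Int) auto
    moreover have "{..k} \<union> {k..} = UNIV" "{..k} \<inter> {k..} = {k}" by auto
    ultimately show ?thesis by simp
  qed
  ultimately show False using contact_finite_dim[OF l(2)] by linarith
qed

end

section \<open>From the local estimates to the theorem\<close>

lemma lex_le_antisym: "lex_le \<Lambda> M \<Longrightarrow> lex_le M \<Lambda> \<Longrightarrow> \<Lambda> = M"
  unfolding lex_le_def using less_fun_asym by blast

text \<open>An upper bound that belongs to \<open>X\<close> is the least one. This applies to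
  \<open>contact\<close>, which is itself distinguished by affine coordinates.\<close>

lemma least_upper_weight_maximum:
  assumes "M \<in> weights" "M \<in> X" "\<And>\<Lambda>. \<Lambda> \<in> X \<Longrightarrow> lex_le \<Lambda> M"
  shows "(THE M. least_upper_weight X M) = M"
proof (rule the_equality)
  show "least_upper_weight X M" using assms unfolding least_upper_weight_def by blast
  show "M' = M" if "least_upper_weight X M'" for M'
    using that assms unfolding least_upper_weight_def by (metis lex_le_antisym)
qed

lemma affine_coordinates_local_holomorphic:
  fixes a :: "complex ^ 'n"
  assumes "affine_coordinates a z \<psi>"
  shows "local_holomorphic_coordinates a z \<psi>"
proof -
  obtain B :: "complex ^ 'n ^ 'n" where B: "invertible B" and z: "z = (\<lambda>x. B *v (x - a))"
    and \<psi>: "\<psi> = (\<lambda>w. a + matrix_inv B *v w)" using assms unfolding affine_coordinates_def by blast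
  obtain E where E: "B ** E = mat 1" using B invertible_right_inverse by blast
  have inv: "B *v (matrix_inv B *v w) = w" "matrix_inv B *v (B *v w) = w" for w
    using E matrix_left_right_inverse[of B E] by (simp_all add: matrix_inv_eq[OF E] matrix_vector_mul_assoc)
  have bl: "bounded_linear ((*v) M)" for M :: "complex ^ 'n ^ 'n" by (rule matrix_vector_mul_bounded_linear)
  have dz: "(z has_derivative (\<lambda>v. B *v v)) (at x)" for x
  proof -
    have "((\<lambda>x. x - a) has_derivative (\<lambda>v. v)) (at x)" by (auto intro!: derivative_eq_intros)
    from bounded_linear.has_derivative[OF bl[of B] this] show ?thesis unfolding z .
  qed
  have d\<psi>: "(\<psi> has_derivative (\<lambda>v. matrix_inv B *v v)) (at x)" for x
    unfolding \<psi> using bounded_linear.has_derivative[OF bl[of "matrix_inv B"] has_derivative_ident, of "at x"]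
    by (auto intro!: derivative_eq_intros)
  have "homeomorphism UNIV UNIV z \<psi>"
  proof (rule homeomorphismI)
    show "continuous_on UNIV z" "continuous_on UNIV \<psi>"
      by (rule continuous_at_imp_continuous_on, rule ballI, rule has_derivative_continuous, rule dz d\<psi>)+
  qed (auto simp: z \<psi> inv)
  moreover have "holomorphic_map_on z UNIV" "holomorphic_map_on \<psi> UNIV"
    unfolding holomorphic_map_on_def using dz d\<psi> by blast+
  ultimately show ?thesis unfolding local_holomorphic_coordinates_def z by auto
qed

lemma linearly_distinguished_subset: "linearly_distinguished r a \<subseteq> distinguished r a"
  unfolding linearly_distinguished_def distinguished_def using affine_coordinates_local_holomorphic by blast

lemma (in weakly_linearly_convex_point) multitypes_eq_contact:
  "linear_multitype \<rho> a = contact" "catlin_multitype \<rho> a = contact" "dangelo_multitype \<rho> a = contact"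
proof -
  show "linear_multitype \<rho> a = contact" unfolding linear_multitype_def
    by (rule least_upper_weight_maximum[OF contact_weights contact_linearly_distinguished])
      (use linearly_distinguished_subset distinguished_lex_le_contact in blast)
  show "catlin_multitype \<rho> a = contact" unfolding catlin_multitype_def
    by (rule least_upper_weight_maximum[OF contact_weights _ distinguished_lex_le_contact])
      (use linearly_distinguished_subset contact_linearly_distinguished in blast)+
qed (rule dangelo_multitype_eq_contact)

text \<open>The radius is chosen so that a single vector \<open>w\<close> has nonzero derivative at
  all points of the ball. Every boundary point in it is then a smooth one, and
  \<open>tangent_hyperplane_misses_domain\<close> applies there to the \<complex>-convex domain
  \<open>D \<inter> U\<close>.\<close>

lemma C_convex_boundary_weakly_linearly_convex:
  fixes D :: "(complex ^ 'n::{finite,linorder}) set"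
  assumes "open D" "C_convex_boundary_point D a" "smooth_defining_function D a r"
  shows "\<exists>R. weakly_linearly_convex_point r a R"
proof -
  obtain V where V: "open V" "a \<in> V" "C_infinity_on r V" "D \<inter> V = {x \<in> V. r x < 0}"
    and nondeg: "frechet_derivative r (at a) \<noteq> (\<lambda>v. 0)" using assms(3) unfolding smooth_defining_function_def by blast
  obtain U where a: "a \<in> frontier D" and U: "open U" "a \<in> U" "C_convex_domain (D \<inter> U)"
    using assms(2) unfolding C_convex_boundary_point_def by blast
  have mem: "x \<in> D \<longleftrightarrow> r x < 0" if "x \<in> V" for x
  proof -
    have "x \<in> D \<inter> V \<longleftrightarrow> x \<in> {x \<in> V. r x < 0}" by (simp only: V(4))
    then show ?thesis using that by simp
  qed
  define G where "G = D \<inter> U"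
  have G: "open G" "\<And>p v. v \<noteq> 0 \<Longrightarrow> G \<inter> complex_line p v \<noteq> {} \<Longrightarrow> simply_connected (G \<inter> complex_line p v)"
    using U(3) unfolding C_convex_domain_def G_def by auto
  obtain w where w: "deriv_along w r a \<noteq> 0" using nondeg unfolding deriv_along_def by (auto simp: fun_eq_iff)
  have contr: "continuous_on V r" by (rule C_infinity_on_continuous_on[OF V(3)])
  \<comment> \<open>Both halves of the frontier condition enter: \<open>r a < 0\<close> would put
    \<open>a\<close> into the open set \<open>D\<close>, and \<open>r a > 0\<close> would make
    \<open>r\<close> positive near \<open>a\<close>, so that \<open>a\<close> would not be in the
    closure.\<close>
  have ra: "r a = 0"
  proof (rule antisym)
    show "0 \<le> r a"
    proof (rule ccontr)
      assume "\<not> 0 \<le> r a"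
      then have "a \<in> D" using mem[OF V(2)] by simp
      then show False using a assms(1) by (simp add: frontier_def interior_open)
    qed
    show "r a \<le> 0"
    proof (rule ccontr)
      assume "\<not> r a \<le> 0"
      then have pos: "0 < r a" by simp
      have "open (V \<inter> r -` {0<..})" by (rule continuous_open_preimage[OF contr V(1)]) simp
      moreover have "a \<in> V \<inter> r -` {0<..}" using V(2) pos by simp
      ultimately obtain e where e: "e > 0" "ball a e \<subseteq> V \<inter> r -` {0<..}" using openE by blast
      have "a \<in> closure D" using a by (simp add: frontier_def)
      then obtain y where y: "y \<in> D" "dist y a < e" using e(1) closure_approachable by blast
      then have "y \<in> ball a e" by (simp add: dist_commute)
      then have "y \<in> V" "0 < r y" using e(2) by auto
      then show False using y(1) mem by simp
    qed
  qed
  have "isCont (deriv_along w r) a"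
    using C_infinity_on_continuous_on[OF C_infinity_on_deriv_along[OF V(3)]] V(1,2) continuous_on_eq_continuous_at by blast
  then obtain e1 where e1: "e1 > 0" "\<And>y. dist y a < e1 \<Longrightarrow> dist (deriv_along w r y) (deriv_along w r a) < norm (deriv_along w r a)"
    using w unfolding continuous_at_eps_delta by (metis zero_less_norm_iff)
  obtain e2 where e2: "e2 > 0" "ball a e2 \<subseteq> V \<inter> U" using V(1,2) U(1,2) openE[of "V \<inter> U" a] by blast
  define R where "R = min e1 e2"
  have R: "0 < R" "ball a R \<subseteq> V" "ball a R \<subseteq> U" using e1(1) e2 by (auto simp: R_def)
  have inG: "y \<in> G \<longleftrightarrow> r y < 0" if "y \<in> ball a R" for y
    using that R(2,3) mem[of y] by (auto simp: G_def)
  have shift: "((\<lambda>x. r (a + x)) has_derivative (\<lambda>v. deriv_along v r (a + p))) (at p)" if "norm p < R" for p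
  proof -
    have "a + p \<in> V" using that R(2) by (auto simp: subset_iff dist_norm)
    from C_infinity_on_has_derivative[OF V(3) this]
    have "(r has_derivative (\<lambda>v. deriv_along v r (a + p))) (at (a + p))" .
    moreover have "((\<lambda>x. a + x) has_derivative (\<lambda>v. v)) (at p)" by (auto intro!: derivative_eq_intros)
    ultimately show ?thesis using diff_chain_at[of "\<lambda>x. a + x" "\<lambda>v. v" p r] by (simp add: o_def)
  qed
  have "weakly_linearly_convex_germ (\<lambda>x. r (a + x)) R"
  proof
    show "0 < R" by (rule R(1))
    have "C_infinity_on (r \<circ> (\<lambda>x. a + x)) (ball 0 R)"
      by (rule C_infinity_on_compose[OF open_ball V(1) _ C_infinity_on_affine[OF open_ball bounded_linear_ident] V(3)])
        (use R(2) in \<open>auto simp: subset_iff dist_norm\<close>)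
    then show "C_infinity_on (\<lambda>x. r (a + x)) (ball 0 R)" by (simp add: o_def)
    show "r (a + 0) = 0" by (simp add: ra)
    show "\<exists>w. deriv_along w (\<lambda>x. r (a + x)) 0 \<noteq> 0" using deriv_along_eq[OF shift[of 0]] w R(1) by auto
  next
    fix p x assume p: "norm p < R" "r (a + p) = 0" and x: "norm x < R" "r (a + x) < 0"
    have "deriv_along w r (a + p) \<noteq> 0" using e1(2)[of "a + p"] p(1) by (auto simp: R_def dist_norm)
    have "complex_gradient_form (\<lambda>v. deriv_along v r (a + p)) ((a + x) - (a + p)) \<noteq> 0"
    \<comment> \<open>The radius \<open>R - norm p\<close> keeps the ball around the boundary point
      \<open>a + p\<close> inside the ball around \<open>a\<close> where \<open>G\<close> is
      described by \<open>r < 0\<close>.\<close>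
    proof (rule tangent_hyperplane_misses_domain[OF G, where r = r and w = w and e = "R - norm p"])
      show "(r has_derivative (\<lambda>v. deriv_along v r (a + p))) (at (a + p))"
        using p(1) R(2) by (intro C_infinity_on_has_derivative[OF V(3)]) (auto simp: subset_iff dist_norm)
      show "a + p \<notin> G" "a + x \<in> G" using inG[of "a + p"] inG[of "a + x"] p x by (auto simp: dist_norm)
      show "y \<in> G" if "dist y (a + p) < R - norm p" "r y < 0" for y
      proof -
        have "dist a y \<le> dist a (a + p) + dist (a + p) y" by (rule dist_triangle)
        then have "y \<in> ball a R" using that(1) by (simp add: dist_norm norm_minus_commute)
        then show ?thesis using inG that(2) by simp
      qed
    qed (use p \<open>deriv_along w r (a + p) \<noteq> 0\<close> in auto)
    moreover have "(\<lambda>v. deriv_along v (\<lambda>x. r (a + x)) p) = (\<lambda>v. deriv_along v r (a + p))"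
      using deriv_along_eq[OF shift[OF p(1)]] by blast
    ultimately show "complex_gradient_form (\<lambda>v. deriv_along v (\<lambda>x. r (a + x)) p) (x - p) \<noteq> 0" by simp
  qed
  then show ?thesis unfolding weakly_linearly_convex_point_def by blast
qed

theorem proposition8:
  fixes D :: "(complex ^ 'n::{finite,linorder}) set"
    and a :: "complex ^ 'n::{finite,linorder}"
    and r :: "complex ^ 'n::{finite,linorder} \<Rightarrow> real"
  assumes "open D" and "connected D"
    and "C_convex_boundary_point D a"
    and "smooth_defining_function D a r"
  shows "linear_multitype r a = catlin_multitype r a \<and>
         catlin_multitype r a = dangelo_multitype r a"
proof -
  obtain R where "weakly_linearly_convex_point r a R"
    using C_convex_boundary_weakly_linearly_convex assms(1,3,4) by blast
  then interpret weakly_linearly_convex_point r a R .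
  show ?thesis using multitypes_eq_contact by simp
qed

end
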